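(* Let $d = 1$. Then there exists a smooth non-increasing function $f^1 : \mathbb{R}^+ \to \mathbb{R}^+$ such that, as $N \to \infty$, \[ D^N_\beta = \begin{cases} \frac{1}{\beta} \times \left( 1 + O(\beta^{1/2}) + O((\beta N)^{-1/2}) \right), & \text{if } 1/N \ll \beta \ll 1, \\ N f^1(c) \times (1 + o(1)), & \text{if } \beta \sim c/N, \ c > 0, \\ \frac{N}{3} \times (1 + o(1)), & \text{if } \beta \ll 1/N. \end{cases} \] The function $f^1$ satisfies $\lim_{c \to 0} f^1(c) = 1/3$ and $f^1(c) = \Theta(1/c)$ as $c \to \infty$, and can be represented as \[ f^1(c) = - \frac{d}{dc} \left( - h_c(0)^2 + \int_0^c \left[ \frac{2}{c} \log h_c(s) - \frac{1}{2} \left( h_c(s) + \dot{h}_c(s) \right)^2 \right] ds \right), \] where $h_c$ is the positive analytic function that is the unique solution to the boundary value ODE on $[0,c]$ \[ \ddot{y} = -\frac{2}{c y} + y, \qquad \dot{y}(0) = y(0) = y(c) = -\dot{y}(c). \]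
   Context: For $N \ge 1$ let $\mathcal{T}^N = \{1,\dots,N\}$ (dimension $d=1$) and let $\pi^N$ be the set of all permutations $\pi$ of $\mathcal{T}^N$. Define $H^N(\pi) = \sum_{x \in \mathcal{T}^N} |x - \pi(x)|$. For $\beta \ge 0$ let $P^N_\beta$ be the probability measure on $\pi^N$ given by $P^N_\beta(\pi) = \frac{1}{Z^N_\beta} e^{-\beta H^N(\pi)}$, where $Z^N_\beta = \sum_{\pi \in \pi^N} e^{-\beta H^N(\pi)}$. The mean displacement per site is $D^N_\beta = \frac{1}{N} \sum_{x \in \mathcal{T}^N} E[|x - \pi(x)|] = \frac1N E[H^N(\pi)]$, where $E$ is expectation under $P^N_\beta$. $\mathbb{R}^+$ denotes the positive reals. The parameter $\beta = \beta(N)$ varies with $N$. For functions $f,g$ of $N$: $f \ll g$ (or $f = o(g)$) means $|f|/|g| \to 0$ as $N \to \infty$; $f \sim g$ means $f/g \to 1$; $f = O(g)$ means there is a constant $C>0$ with $|f|/|g| < C$ for all sufficiently large $N$; $f = \Theta(g)$ means $f = O(g)$ and $g = O(f)$ (and analogously for asymptotics as $c \to \infty$). Dots denote derivatives in the variable $s \in [0,c]$. *)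

theory Defs
  imports
    "HOL-Probability.Probability"
    "HOL-Combinatorics.Permutations"
    "HOL-Library.Landau_Symbols"
begin

definition perms :: "nat \<Rightarrow> (nat \<Rightarrow> nat) set" where
  "perms N = {\<pi>. \<pi> permutes {1..N}}"

definition energy :: "nat \<Rightarrow> (nat \<Rightarrow> nat) \<Rightarrow> real" where
  "energy N \<pi> = (\<Sum>x\<in>{1..N}. \<bar>real x - real (\<pi> x)\<bar>)"

definition partition_fun :: "nat \<Rightarrow> real \<Rightarrow> real" where
  "partition_fun N \<beta> = (\<Sum>\<pi>\<in>perms N. exp (- \<beta> * energy N \<pi>))"

definition gibbs :: "nat \<Rightarrow> real \<Rightarrow> (nat \<Rightarrow> nat) measure" where
  "gibbs N \<beta> = point_measure (perms N)
     (\<lambda>\<pi>. ennreal (exp (- \<beta> * energy N \<pi>) / partition_fun N \<beta>))"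

definition mean_displacement :: "nat \<Rightarrow> real \<Rightarrow> real" where
  "mean_displacement N \<beta> =
     1 / real N * (\<Sum>x\<in>{1..N}. \<integral>\<pi>. \<bar>real x - real (\<pi> x)\<bar> \<partial>gibbs N \<beta>)"

lemma finite_perms: "finite (perms N)"
  by (simp add: perms_def finite_permutations)

lemma partition_fun_pos: "partition_fun N \<beta> > 0"
proof -
  have "id \<in> perms N"
    by (simp add: perms_def permutes_id)
  then show ?thesis
    unfolding partition_fun_def by (intro sum_pos finite_perms) auto
qed

lemma prob_space_gibbs: "prob_space (gibbs N \<beta>)"
proof (rule prob_spaceI)
  have "emeasure (gibbs N \<beta>) (space (gibbs N \<beta>)) =
      (\<Sum>\<pi>\<in>perms N. ennreal (exp (- \<beta> * energy N \<pi>) / partition_fun N \<beta>))"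
    unfolding gibbs_def
    by (simp add: space_point_measure emeasure_point_measure_finite finite_perms)
  also have "\<dots> = ennreal (\<Sum>\<pi>\<in>perms N. exp (- \<beta> * energy N \<pi>) / partition_fun N \<beta>)"
    using partition_fun_pos[of N \<beta>] by (intro sum_ennreal) simp
  also have "(\<Sum>\<pi>\<in>perms N. exp (- \<beta> * energy N \<pi>) / partition_fun N \<beta>) = 1"
    using partition_fun_pos[of N \<beta>]
    by (simp add: sum_divide_distrib[symmetric] partition_fun_def)
  finally show "emeasure (gibbs N \<beta>) (space (gibbs N \<beta>)) = 1"
    by simp
qed

text \<open>Intended for open \<open>S\<close> only, since \<^const>\<open>deriv\<close> is the two-sided derivative.\<close>

definition smooth_on :: "real set \<Rightarrow> (real \<Rightarrow> real) \<Rightarrow> bool" where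
  "smooth_on S f \<longleftrightarrow> (\<forall>n. ((deriv ^^ n) f) differentiable_on S)"

text \<open>The expansion is only required to represent \<open>f\<close> inside \<open>S\<close>. At an endpoint of a
  compact interval this says that \<open>f\<close> extends analytically across it.\<close>

definition real_analytic_on :: "(real \<Rightarrow> real) \<Rightarrow> real set \<Rightarrow> bool" where
  "real_analytic_on f S \<longleftrightarrow>
     (\<forall>x\<in>S. \<exists>r>0. \<exists>a :: nat \<Rightarrow> real. \<forall>y\<in>S. \<bar>y - x\<bar> < r \<longrightarrow>
        (\<lambda>n. a n * (y - x) ^ n) sums f y)"

text \<open>The derivative on \<open>[0, c]\<close>, one-sided at the endpoints.\<close>

definition sdot :: "real \<Rightarrow> (real \<Rightarrow> real) \<Rightarrow> real \<Rightarrow> real" where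
  "sdot c y s = vector_derivative y (at s within {0..c})"

text \<open>The condition \<open>y s \<noteq> 0\<close> makes the term \<open>2 / (c * y s)\<close> meaningful.\<close>

definition solves_bvp :: "real \<Rightarrow> (real \<Rightarrow> real) \<Rightarrow> bool" where
  "solves_bvp c y \<longleftrightarrow>
     y differentiable_on {0..c} \<and>
     (\<forall>s\<in>{0..c}. y s \<noteq> 0 \<and>
        (sdot c y has_real_derivative - 2 / (c * y s) + y s) (at s within {0..c})) \<and>
     sdot c y 0 = y 0 \<and> y 0 = y c \<and> y c = - sdot c y c"

text \<open>If \<open>y\<close> solves the boundary value problem then so does \<open>-y\<close>; uniqueness is therefore
  among positive solutions. Values of \<open>h\<close> outside \<open>[0, c]\<close> are irrelevant.\<close>

definition unique_positive_solution :: "real \<Rightarrow> (real \<Rightarrow> real) \<Rightarrow> bool" where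
  "unique_positive_solution c h \<longleftrightarrow>
     solves_bvp c h \<and> (\<forall>s\<in>{0..c}. h s > 0) \<and>
     (\<forall>y. solves_bvp c y \<and> (\<forall>s\<in>{0..c}. y s > 0) \<longrightarrow> (\<forall>s\<in>{0..c}. y s = h s))"

definition bvp_functional :: "real \<Rightarrow> (real \<Rightarrow> real) \<Rightarrow> real" where
  "bvp_functional c h =
     - (h 0)\<^sup>2 + integral {0..c} (\<lambda>s. 2 / c * ln (h s) - 1 / 2 * (h s + sdot c h s)\<^sup>2)"

end

(* The partition function Z is the permanent of the matrix with entries exp (-beta |i - j|).
   A lower bound for ln Z comes from the Cauchy-Schwarz inequality for the symmetrised tensor of
   Gram vectors of this matrix, an upper bound from the row-by-row recursion for the permanents of
   the matrices exp (-2 beta max(i, j)) + r. Both bounds contain a free function (the weights w_j,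
   the values r_k). The choices w = 1 and r_k = exp (-2 beta k) give
   ln Z = N ln (2 / (e beta)) + O(1 / beta + beta N), and at beta = c / N the choices
   dictated by the solution h of the boundary value problem make the bounds meet:
   (ln Z - ln N!) / N tends to F c = 2 / c times the integral of ln h over [0, c].
   Since ln Z is convex in beta with derivative -N D, difference quotients of ln Z squeeze D and
   give the first two regimes; the third follows as D decreases in beta, D <= N / 3 at beta = 0,
   and -F' tends to 1 / 3 at 0.

   The boundary value problem is solved by quadrature. With t = s^2 and
   E W t = (1 - (1 - t) exp (2 W t)) / t, h is sqrt (4 W / c) exp (- W sigma^2), where sigma runs
   from 1 to -1 with sigma' = - sqrt (E W (sigma^2)) / (2 W), and W in (0, 1/2) is fixed by
   c = 4 W times the integral of E W (s^2) ^ (-1/2) over [0, 1]. *)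
theory Submission
  imports Defs "HOL-Complex_Analysis.Complex_Analysis" "HOL-Real_Asymp.Real_Asymp"
begin

section \<open>Bounds for the partition function\<close>

text \<open>Why the two bounds meet: both rest on the same scaling of the kernel. The Cauchy-Schwarz
  bound loses nothing to leading order when the weights make the kernel nearly doubly stochastic.
  With weights proportional to 1 / h this asks that h(s) be the integral of exp (- |s - t|) / (c
  h(t)) over t, which is the boundary value problem in integral form, and it leaves N! times the
  product of h^2. For the upper bound, split h = p + m into the contributions of t >= s and of t <=
  s to that integral. With X = exp (-2 s) and r = (p / m) X, the ratio (r + X)^2 / (X r) is h^2 / (p
  m), and ln r has slope -1 / (c p m). Consecutive logarithms then differ by about 1 / (N p m), so
  each factor is about N h^2 / e: the same product, as N! is (N / e)^N to leading order. The
  obstacle is that p vanishes at c and m at 0; both are shifted by a small constant. The exponents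
  1/2 of the first regime come from convexity. There ln Z is known up to an error of order N d^2,
  with d^2 = \<beta> + 1 / (\<beta> N), and a difference quotient with relative step d turns this
  into a relative error of order d in D.\<close>

lemma mean_displacement_eq:
  assumes "N \<ge> 1"
  shows "real N * mean_displacement N \<beta> =
    (\<Sum>\<pi>\<in>perms N. energy N \<pi> * exp (- \<beta> * energy N \<pi>)) / partition_fun N \<beta>"
proof -
  have "(\<integral>\<pi>. \<bar>real x - real (\<pi> x)\<bar> \<partial>gibbs N \<beta>) =
      (\<Sum>\<pi>\<in>perms N. exp (- \<beta> * energy N \<pi>) / partition_fun N \<beta> * \<bar>real x - real (\<pi> x)\<bar>)" for x
    unfolding gibbs_def point_measure_def
    by (subst integral_density)
       (auto simp: AE_count_space lebesgue_integral_count_space_finite finite_perms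
          less_imp_le[OF partition_fun_pos] sum_divide_distrib)
  then have "real N * mean_displacement N \<beta> =
      (\<Sum>x\<in>{1..N}. \<Sum>\<pi>\<in>perms N. exp (- \<beta> * energy N \<pi>) / partition_fun N \<beta> * \<bar>real x - real (\<pi> x)\<bar>)"
    using assms by (simp add: mean_displacement_def)
  also have "\<dots> = (\<Sum>\<pi>\<in>perms N. \<Sum>x\<in>{1..N}. exp (- \<beta> * energy N \<pi>) / partition_fun N \<beta> * \<bar>real x - real (\<pi> x)\<bar>)"
    by (rule sum.swap)
  also have "\<dots> = (\<Sum>\<pi>\<in>perms N. energy N \<pi> * exp (- \<beta> * energy N \<pi>)) / partition_fun N \<beta>"
    by (simp add: energy_def sum_distrib_left sum_divide_distrib sum_distrib_right mult_ac)
  finally show ?thesis .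
qed

text \<open>Supporting line of the convex function ln Z at \<open>\<beta>\<close>, where the slope
  is minus N times the mean displacement. The inequality exp x >= 1 + x is applied to the energy
  centred at its mean \<open>m\<close>, so the linear term averages out.\<close>

lemma ln_partition_fun_diff_le:
  assumes "N \<ge> 1"
  shows "ln (partition_fun N \<beta>) - ln (partition_fun N \<beta>') \<le> real N * mean_displacement N \<beta> * (\<beta>' - \<beta>)"
proof -
  define m where "m = real N * mean_displacement N \<beta>"
  define d where "d = \<beta>' - \<beta>"
  define Z where "Z = partition_fun N \<beta>"
  have Z: "Z > 0" unfolding Z_def by (rule partition_fun_pos)
  have mZ: "(\<Sum>\<pi>\<in>perms N. energy N \<pi> * exp (- \<beta> * energy N \<pi>)) = m * Z"
    using mean_displacement_eq[OF assms, of \<beta>] Z by (simp add: m_def Z_def field_simps)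
  have "exp (- d * m) * exp (- \<beta> * energy N \<pi>) * (1 - d * (energy N \<pi> - m)) \<le> exp (- \<beta>' * energy N \<pi>)" for \<pi>
  proof -
    have "exp (- d * m) * exp (- \<beta> * energy N \<pi>) * (1 - d * (energy N \<pi> - m))
        \<le> exp (- d * m) * exp (- \<beta> * energy N \<pi>) * exp (- d * (energy N \<pi> - m))"
      using exp_ge_add_one_self[of "- d * (energy N \<pi> - m)"] by (intro mult_left_mono) auto
    also have "\<dots> = exp (- \<beta>' * energy N \<pi>)"
      by (simp add: d_def exp_add[symmetric] algebra_simps)
    finally show ?thesis .
  qed
  then have "(\<Sum>\<pi>\<in>perms N. exp (- d * m) * exp (- \<beta> * energy N \<pi>) * (1 - d * (energy N \<pi> - m)))
      \<le> partition_fun N \<beta>'"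
    unfolding partition_fun_def by (intro sum_mono)
  also have "(\<Sum>\<pi>\<in>perms N. exp (- d * m) * exp (- \<beta> * energy N \<pi>) * (1 - d * (energy N \<pi> - m)))
      = exp (- d * m) * ((1 + d * m) * (\<Sum>\<pi>\<in>perms N. exp (- \<beta> * energy N \<pi>))
          - d * (\<Sum>\<pi>\<in>perms N. energy N \<pi> * exp (- \<beta> * energy N \<pi>)))"
    by (simp add: sum_distrib_left sum_subtractf[symmetric] algebra_simps)
  also have "\<dots> = exp (- d * m) * Z"
    unfolding mZ by (simp add: Z_def partition_fun_def algebra_simps)
  finally have "ln (exp (- d * m) * Z) \<le> ln (partition_fun N \<beta>')"
    using Z by (subst ln_le_cancel_iff) (auto simp: partition_fun_pos)
  then show ?thesis using Z by (simp add: ln_mult Z_def d_def m_def algebra_simps)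
qed

text \<open>Adding the supporting-line inequalities at \<open>\<beta>\<close> and at
  \<open>\<beta>'\<close> cancels the logarithms.\<close>

lemma mean_displacement_antimono:
  assumes "N \<ge> 1" "\<beta> \<le> \<beta>'"
  shows "mean_displacement N \<beta>' \<le> mean_displacement N \<beta>"
proof (cases "\<beta> = \<beta>'")
  case False
  have "0 \<le> real N * ((mean_displacement N \<beta> - mean_displacement N \<beta>') * (\<beta>' - \<beta>))"
    using ln_partition_fun_diff_le[OF assms(1), of \<beta> \<beta>'] ln_partition_fun_diff_le[OF assms(1), of \<beta>' \<beta>]
    by (simp add: algebra_simps)
  then show ?thesis
    using assms False by (simp add: zero_le_mult_iff)
qed simp

text \<open>At \<beta> = 0 the law is uniform, so each \<open>\<pi> x\<close> is uniform on {1..N};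
  the exact value is (N^2 - 1) / (3 N).\<close>

lemma mean_displacement_zero_le:
  assumes "N \<ge> 1"
  shows "mean_displacement N 0 \<le> real N / 3"
proof -
  \<comment> \<open>A permutation factors as the transposition of x and b after a permutation fixing
    x; it sends x to b, and each b arises fact (N - 1) times.\<close>
  have perm: "(\<Sum>\<pi>\<in>perms N. g (\<pi> x)) = fact (N - 1) * (\<Sum>j\<in>{1..N}. g j)"
    if "x \<in> {1..N}" for x and g :: "nat \<Rightarrow> real"
  proof -
    have ins: "insert x ({1..N} - {x}) = {1..N}" using that by auto
    have "(\<Sum>\<pi>\<in>perms N. g (\<pi> x)) =
        (\<Sum>b\<in>{1..N}. \<Sum>q | q permutes ({1..N} - {x}). g ((Transposition.transpose x b \<circ> q) x))"
      unfolding perms_def using sum_over_permutations_insert[of "{1..N} - {x}" x "\<lambda>\<pi>. g (\<pi> x)"]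
      by (simp only: ins) simp
    also have "\<dots> = (\<Sum>b\<in>{1..N}. \<Sum>q | q permutes ({1..N} - {x}). g b)"
      by (intro sum.cong refl) (auto simp: permutes_not_in)
    also have "\<dots> = fact (N - 1) * (\<Sum>j\<in>{1..N}. g j)"
      using that by (simp add: card_permutations sum_distrib_left)
    finally show ?thesis .
  qed
  have S: "(\<Sum>j\<in>{1..N}. \<bar>real x - real j\<bar>) = (real x * (real x - 1) + (real N - real x) * (real N - real x + 1)) / 2"
    if "x \<in> {1..N}" for x
    using that
  proof (induction N)
    case (Suc n)
    show ?case
    proof (cases "x = Suc n")
      case True
      have "(\<Sum>j\<in>{1..m}. \<bar>real (Suc n) - real j\<bar>) = real m * real (Suc n) - real m * (real m + 1) / 2" if "m \<le> Suc n" for m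
        using that by (induction m) (auto simp: field_simps)
      from this[of "Suc n"] show ?thesis using True by (simp add: field_simps)
    next
      case False
      with Suc show ?thesis by (simp add: field_simps)
    qed
  qed simp
  \<comment> \<open>The N inside the summand is decoupled as \<open>a\<close>, so the induction can
    run over the range alone.\<close>
  have T: "(\<Sum>x\<in>{1..n}. (real x * (real x - 1) + (a - real x) * (a - real x + 1)) / 2)
     = (real n * (real n + 1) * (2 * real n + 1) / 6) - (1 + a) * (real n * (real n + 1) / 2) + real n * a * (a + 1) / 2" for n and a :: real
    by (induction n) (auto simp: field_simps)
  have "(\<Sum>\<pi>\<in>perms N. energy N \<pi>) = (\<Sum>x\<in>{1..N}. \<Sum>\<pi>\<in>perms N. \<bar>real x - real (\<pi> x)\<bar>)"
    unfolding energy_def by (rule sum.swap)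
  also have "\<dots> = fact (N - 1) * (\<Sum>x\<in>{1..N}. \<Sum>j\<in>{1..N}. \<bar>real x - real j\<bar>)"
    by (simp add: perm[where g = "\<lambda>j. \<bar>real _ - real j\<bar>"] sum_distrib_left)
  also have "(\<Sum>x\<in>{1..N}. \<Sum>j\<in>{1..N}. \<bar>real x - real j\<bar>) =
      (\<Sum>x\<in>{1..N}. (real x * (real x - 1) + (real N - real x) * (real N - real x + 1)) / 2)"
    by (intro sum.cong refl S)
  also have "\<dots> = real N * (real N ^ 2 - 1) / 3"
    by (simp only: T) (simp add: field_simps power2_eq_square)
  finally have *: "(\<Sum>\<pi>\<in>perms N. energy N \<pi>) = fact (N - 1) * (real N * (real N ^ 2 - 1) / 3)" .
  have Z: "partition_fun N 0 = fact N"
    unfolding partition_fun_def by (simp add: perms_def card_permutations)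
  have "real N * mean_displacement N 0 = (real N ^ 2 - 1) / 3"
    using mean_displacement_eq[OF assms, of 0] assms by (simp add: * Z fact_reduce[of N])
  also have "\<dots> \<le> real N * (real N / 3)" by (simp add: power2_eq_square)
  finally show ?thesis using assms by simp
qed

section \<open>Bounds for permanents with a free function\<close>

text \<open>Cauchy--Schwarz between the sum over \<open>\<sigma>\<close> of the tensors with factors \<open>v (\<sigma> i)\<close> and the tensor power
  of \<open>u = (\<Sum>j. w j * v j)\<close>.\<close>

theorem permanent_ge:
  fixes v :: "nat \<Rightarrow> 'a \<Rightarrow> real" and A :: "nat \<Rightarrow> nat \<Rightarrow> real"
  assumes "finite S" "finite B"
    and A: "\<And>i j. i \<in> S \<Longrightarrow> j \<in> S \<Longrightarrow> A i j = (\<Sum>b\<in>B. v i b * v j b)"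
  shows "fact (card S) * (\<Prod>i\<in>S. \<Sum>j\<in>S. A i j * w j)\<^sup>2
    \<le> (\<Sum>\<pi> | \<pi> permutes S. \<Prod>i\<in>S. A i (\<pi> i)) * (\<Sum>i\<in>S. \<Sum>j\<in>S. w i * A i j * w j) ^ card S"
proof -
  let ?P = "{\<pi>. \<pi> permutes S}" and ?F = "S \<rightarrow>\<^sub>E B"
  define T where "T a = (\<Sum>\<sigma>\<in>?P. \<Prod>i\<in>S. v (\<sigma> i) (a i))" for a
  define u where "u b = (\<Sum>j\<in>S. w j * v j b)" for b
  define U where "U a = (\<Prod>i\<in>S. u (a i))" for a
  define g where "g i = (\<Sum>j\<in>S. A i j * w j)" for i
  define per where "per = (\<Sum>\<pi>\<in>?P. \<Prod>i\<in>S. A i (\<pi> i))"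
  have finP: "finite ?P" using assms(1) by (rule finite_permutations)
  have cardP: "real (card ?P) = fact (card S)" using assms(1) by (simp add: card_permutations)
  have g: "(\<Sum>b\<in>B. v i b * u b) = g i" if "i \<in> S" for i
  proof -
    have "(\<Sum>b\<in>B. v i b * u b) = (\<Sum>j\<in>S. \<Sum>b\<in>B. v i b * v j b * w j)"
      unfolding u_def by (subst sum.swap) (simp add: sum_distrib_left mult_ac)
    then show ?thesis using that by (simp add: g_def A sum_distrib_right)
  qed
  have TU: "(\<Sum>a\<in>?F. T a * U a) = fact (card S) * (\<Prod>i\<in>S. g i)"
  proof -
    have "(\<Sum>a\<in>?F. T a * U a) = (\<Sum>\<sigma>\<in>?P. \<Sum>a\<in>?F. \<Prod>i\<in>S. v (\<sigma> i) (a i) * u (a i))"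
      unfolding T_def U_def by (subst sum.swap) (simp add: sum_distrib_right prod.distrib)
    also have "\<dots> = (\<Sum>\<sigma>\<in>?P. \<Prod>i\<in>S. \<Sum>b\<in>B. v (\<sigma> i) b * u b)"
      using assms by (subst prod_sum_PiE) auto
    also have "\<dots> = (\<Sum>\<sigma>\<in>?P. \<Prod>i\<in>S. g (\<sigma> i))"
      by (intro sum.cong prod.cong refl g) (auto simp: permutes_in_image)
    also have "\<dots> = (\<Sum>\<sigma>\<in>?P. \<Prod>i\<in>S. g i)"
      by (intro sum.cong refl) (auto intro!: prod.reindex_bij_betw permutes_imp_bij)
    also have "\<dots> = fact (card S) * (\<Prod>i\<in>S. g i)" using cardP by simp
    finally show ?thesis .
  qed
  have TT: "(\<Sum>a\<in>?F. (T a)\<^sup>2) = fact (card S) * per"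
  proof -
    have "(\<Sum>a\<in>?F. (T a)\<^sup>2) = (\<Sum>a\<in>?F. \<Sum>\<sigma>\<in>?P. \<Sum>\<tau>\<in>?P. \<Prod>i\<in>S. v (\<sigma> i) (a i) * v (\<tau> i) (a i))"
      unfolding T_def by (simp add: power2_eq_square sum_product prod.distrib)
    also have "\<dots> = (\<Sum>\<sigma>\<in>?P. \<Sum>\<tau>\<in>?P. \<Sum>a\<in>?F. \<Prod>i\<in>S. v (\<sigma> i) (a i) * v (\<tau> i) (a i))"
      by (subst sum.swap) (intro sum.cong refl sum.swap)
    also have "\<dots> = (\<Sum>\<sigma>\<in>?P. \<Sum>\<tau>\<in>?P. \<Prod>i\<in>S. \<Sum>b\<in>B. v (\<sigma> i) b * v (\<tau> i) b)"
      using assms by (subst prod_sum_PiE) auto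
    also have "\<dots> = (\<Sum>\<sigma>\<in>?P. \<Sum>\<tau>\<in>?P. \<Prod>i\<in>S. A (\<sigma> i) (\<tau> i))"
      by (intro sum.cong prod.cong refl A[symmetric]) (auto simp: permutes_in_image)
    \<comment> \<open>Reindexing by composition with \<sigma> makes the inner sum independent of
      \<sigma>.\<close>
    also have "\<dots> = (\<Sum>\<sigma>\<in>?P. per)"
    proof (intro sum.cong refl)
      fix \<sigma> assume "\<sigma> \<in> ?P"
      then have \<sigma>: "\<sigma> permutes S" by simp
      have "(\<Sum>\<tau>\<in>?P. \<Prod>i\<in>S. A (\<sigma> i) (\<tau> i)) = (\<Sum>\<tau>\<in>?P. \<Prod>i\<in>S. A (\<sigma> i) ((\<tau> \<circ> \<sigma>) i))"
        by (rule sum_permutations_compose_right[OF \<sigma>])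
      also have "\<dots> = per" unfolding per_def
      proof (intro sum.cong refl)
        fix \<tau>
        show "(\<Prod>i\<in>S. A (\<sigma> i) ((\<tau> \<circ> \<sigma>) i)) = (\<Prod>i\<in>S. A i (\<tau> i))"
          using prod.reindex_bij_betw[OF permutes_imp_bij[OF \<sigma>], of "\<lambda>i. A i (\<tau> i)"] by simp
      qed
      finally show "(\<Sum>\<tau>\<in>?P. \<Prod>i\<in>S. A (\<sigma> i) (\<tau> i)) = per" .
    qed
    also have "\<dots> = fact (card S) * per" using cardP by simp
    finally show ?thesis .
  qed
  have UU: "(\<Sum>a\<in>?F. (U a)\<^sup>2) = (\<Sum>i\<in>S. \<Sum>j\<in>S. w i * A i j * w j) ^ card S"
  proof -
    have "(\<Sum>a\<in>?F. (U a)\<^sup>2) = (\<Sum>a\<in>?F. \<Prod>i\<in>S. (u (a i))\<^sup>2)"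
      by (simp add: U_def prod_power_distrib)
    also have "\<dots> = (\<Prod>i\<in>S. \<Sum>b\<in>B. (u b)\<^sup>2)"
      using assms by (subst prod_sum_PiE) auto
    also have "(\<Sum>b\<in>B. (u b)\<^sup>2) = (\<Sum>b\<in>B. \<Sum>i\<in>S. \<Sum>j\<in>S. w i * (v i b * v j b) * w j)"
      by (simp add: u_def power2_eq_square sum_product mult_ac)
    also have "\<dots> = (\<Sum>i\<in>S. \<Sum>j\<in>S. \<Sum>b\<in>B. w i * (v i b * v j b) * w j)"
      by (subst sum.swap) (intro sum.cong refl sum.swap)
    also have "\<dots> = (\<Sum>i\<in>S. \<Sum>j\<in>S. w i * A i j * w j)"
      by (simp add: A sum_distrib_left sum_distrib_right)
    finally show ?thesis by simp
  qed
  have "(fact (card S) * (\<Prod>i\<in>S. g i))\<^sup>2 \<le> (fact (card S) * per) * (\<Sum>i\<in>S. \<Sum>j\<in>S. w i * A i j * w j) ^ card S"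
    using Cauchy_Schwarz_ineq_sum[of T U ?F] by (simp only: TU TT UU)
  then have "fact (card S) * (fact (card S) * (\<Prod>i\<in>S. g i)\<^sup>2)
      \<le> fact (card S) * (per * (\<Sum>i\<in>S. \<Sum>j\<in>S. w i * A i j * w j) ^ card S)"
    by (simp add: power_mult_distrib power2_eq_square mult_ac)
  then show ?thesis
    by (subst (asm) mult_le_cancel_left_pos) (simp_all add: g_def per_def)
qed

text \<open>The permanent of the matrix \<open>t (max i j) + r\<close> as a polynomial in \<open>r\<close>. The last row and column are
  constant, so expanding along them leaves only the previous permanent and its derivative.\<close>

definition max_permanent :: "(nat \<Rightarrow> real) \<Rightarrow> nat \<Rightarrow> real poly" where
  "max_permanent t k = (\<Sum>\<pi>\<in>perms k. \<Prod>i\<in>{1..k}. [:t (max i (\<pi> i)), 1:])"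

lemma pderiv_sum: "pderiv (\<Sum>i\<in>A. f i) = (\<Sum>i\<in>A. pderiv (f i))"
  by (induction A rule: infinite_finite_induct) (auto simp: pderiv_add)

text \<open>A permutation of {1..Suc k} either fixes \<open>Suc k\<close> or arises from a
  permutation q of {1..k} by inserting \<open>Suc k\<close> between some a and q a. The insertion
  replaces the factor at a by two factors of the last row and column. Every entry has derivative 1
  in r, so the sum over the deleted factor is \<open>pderiv\<close>.\<close>

lemma max_permanent_Suc:
  "max_permanent t (Suc k) = [:t (Suc k), 1:] * max_permanent t k
     + [:t (Suc k), 1:]\<^sup>2 * pderiv (max_permanent t k)"
proof -
  define T where "T = [:t (Suc k), 1:]"
  define G where "G i j = [:t (max i j), 1:]" for i j :: nat
  let ?S = "{1..k}"
  have ins: "{1..Suc k} = insert (Suc k) ?S" by auto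
  have notin: "Suc k \<notin> ?S" by simp
  have GT: "G (Suc k) j = T" "G j (Suc k) = T" if "j \<le> Suc k" for j
    using that by (auto simp: G_def T_def max_def)
  have stay: "(\<Prod>i\<in>insert (Suc k) ?S. G i ((Transposition.transpose (Suc k) (Suc k) \<circ> q) i)) = T * (\<Prod>i\<in>?S. G i (q i))"
    if "q permutes ?S" for q
    using that by (simp add: permutes_not_in[OF that] GT)
  have move: "(\<Prod>i\<in>insert (Suc k) ?S. G i ((Transposition.transpose (Suc k) (q a) \<circ> q) i)) = T\<^sup>2 * (\<Prod>i\<in>?S - {a}. G i (q i))"
    if q: "q permutes ?S" and a: "a \<in> ?S" for q a
  proof -
    have qa: "q a \<in> ?S" using q a by (simp only: permutes_in_image)
    have qk: "q (Suc k) = Suc k" using q by (rule permutes_not_in) simp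
    have "(\<Prod>i\<in>insert (Suc k) ?S. G i ((Transposition.transpose (Suc k) (q a) \<circ> q) i)) =
       G (Suc k) (q a) * (\<Prod>i\<in>?S. G i ((Transposition.transpose (Suc k) (q a) \<circ> q) i))"
      using qk by simp
    also have "(\<Prod>i\<in>?S. G i ((Transposition.transpose (Suc k) (q a) \<circ> q) i)) =
       G a (Suc k) * (\<Prod>i\<in>?S - {a}. G i ((Transposition.transpose (Suc k) (q a) \<circ> q) i))"
      using a by (subst prod.remove[of _ a]) auto
    also have "(\<Prod>i\<in>?S - {a}. G i ((Transposition.transpose (Suc k) (q a) \<circ> q) i)) = (\<Prod>i\<in>?S - {a}. G i (q i))"
    proof (intro prod.cong refl)
      fix i assume i: "i \<in> ?S - {a}"
      have "q i \<noteq> q a" using i permutes_inj[OF q] by (auto simp: inj_def)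
      moreover have "q i \<in> ?S" using i permutes_in_image[OF q] by blast
      then have "q i \<noteq> Suc k" by auto
      ultimately show "G i ((Transposition.transpose (Suc k) (q a) \<circ> q) i) = G i (q i)"
        by (simp add: transpose_eq_iff)
    qed
    finally show ?thesis using a qa by (simp add: GT power2_eq_square mult.assoc)
  qed
  have der: "pderiv (\<Prod>i\<in>?S. G i (q i)) = (\<Sum>a\<in>?S. \<Prod>i\<in>?S - {a}. G i (q i))" for q
    by (simp add: pderiv_prod G_def pderiv_pCons)
  have "max_permanent t (Suc k) = (\<Sum>\<pi> | \<pi> permutes insert (Suc k) ?S. \<Prod>i\<in>insert (Suc k) ?S. G i (\<pi> i))"
    unfolding max_permanent_def perms_def G_def ins by simp
  also have "\<dots> = (\<Sum>b\<in>insert (Suc k) ?S. \<Sum>q | q permutes ?S.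
       \<Prod>i\<in>insert (Suc k) ?S. G i ((Transposition.transpose (Suc k) b \<circ> q) i))"
    by (rule sum_over_permutations_insert) auto
  also have "\<dots> = (\<Sum>q | q permutes ?S. \<Prod>i\<in>insert (Suc k) ?S. G i ((Transposition.transpose (Suc k) (Suc k) \<circ> q) i))
      + (\<Sum>b\<in>?S. \<Sum>q | q permutes ?S. \<Prod>i\<in>insert (Suc k) ?S. G i ((Transposition.transpose (Suc k) b \<circ> q) i))"
    by (rule sum.insert) auto
  also have "(\<Sum>q | q permutes ?S. \<Prod>i\<in>insert (Suc k) ?S. G i ((Transposition.transpose (Suc k) (Suc k) \<circ> q) i))
      = T * max_permanent t k"
    unfolding max_permanent_def perms_def G_def[symmetric] sum_distrib_left
    by (intro sum.cong refl stay) simp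
  also have "(\<Sum>b\<in>?S. \<Sum>q | q permutes ?S. \<Prod>i\<in>insert (Suc k) ?S. G i ((Transposition.transpose (Suc k) b \<circ> q) i))
     = (\<Sum>q | q permutes ?S. \<Sum>b\<in>?S. \<Prod>i\<in>insert (Suc k) ?S. G i ((Transposition.transpose (Suc k) b \<circ> q) i))"
    by (rule sum.swap)
  also have "\<dots> = (\<Sum>q | q permutes ?S. T\<^sup>2 * pderiv (\<Prod>i\<in>?S. G i (q i)))"
  proof (intro sum.cong refl)
    fix q assume "q \<in> {q. q permutes ?S}"
    then have q: "q permutes ?S" by simp
    have "(\<Sum>b\<in>?S. \<Prod>i\<in>insert (Suc k) ?S. G i ((Transposition.transpose (Suc k) b \<circ> q) i))
       = (\<Sum>a\<in>?S. \<Prod>i\<in>insert (Suc k) ?S. G i ((Transposition.transpose (Suc k) (q a) \<circ> q) i))"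
      by (rule sum.reindex_bij_betw[symmetric, OF permutes_imp_bij[OF q]])
    also have "\<dots> = (\<Sum>a\<in>?S. T\<^sup>2 * (\<Prod>i\<in>?S - {a}. G i (q i)))"
      by (intro sum.cong refl move q)
    finally show "(\<Sum>b\<in>?S. \<Prod>i\<in>insert (Suc k) ?S. G i ((Transposition.transpose (Suc k) b \<circ> q) i))
       = T\<^sup>2 * pderiv (\<Prod>i\<in>?S. G i (q i))"
      unfolding der sum_distrib_left .
  qed
  also have "\<dots> = T\<^sup>2 * pderiv (max_permanent t k)"
    unfolding max_permanent_def perms_def G_def[symmetric] sum_distrib_left pderiv_sum
    by simp
  finally show ?thesis unfolding T_def .
qed

lemma max_permanent_0: "max_permanent t 0 = 1"
  by (simp add: max_permanent_def perms_def)

lemma coeff_mult_nonneg: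
  fixes p q :: "real poly"
  assumes "\<And>n. coeff p n \<ge> 0" "\<And>n. coeff q n \<ge> 0"
  shows "coeff (p * q) n \<ge> 0"
  unfolding coeff_mult by (intro sum_nonneg mult_nonneg_nonneg assms)

lemma coeff_max_permanent_nonneg:
  assumes "\<And>k. t k \<ge> 0"
  shows "coeff (max_permanent t k) n \<ge> 0"
proof (induction k arbitrary: n)
  case (Suc k)
  have T: "coeff [:t (Suc k), 1:] n \<ge> 0" for n
    using assms by (auto simp: coeff_pCons split: nat.splits)
  have D: "coeff (pderiv (max_permanent t k)) n \<ge> 0" for n
    using Suc.IH by (simp add: coeff_pderiv)
  show ?case
    unfolding max_permanent_Suc coeff_add power2_eq_square
    by (intro add_nonneg_nonneg coeff_mult_nonneg T D Suc.IH)
qed (simp add: max_permanent_0)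

text \<open>Coefficientwise, the left side multiplies r^i by i + 1. With \<kappa> = ln (s / r), the
  inequality x <= exp (\<kappa> x - 1) / \<kappa> at x = i + 1 absorbs this factor into (s / r)^i.
  It is an equality at i + 1 = 1 / \<kappa>, so a good choice of s / r aims at the dominant degree
  of p.\<close>

lemma poly_add_pderiv_le:
  fixes p :: "real poly"
  assumes nonneg: "\<And>n. coeff p n \<ge> 0" and "0 < r" "r < s"
  shows "poly p r + r * poly (pderiv p) r \<le> exp (ln (s / r) - 1) / ln (s / r) * poly p s"
proof -
  define \<kappa> where "\<kappa> = ln (s / r)"
  have \<kappa>: "\<kappa> > 0" using assms by (simp add: \<kappa>_def)
  have s: "s = r * exp \<kappa>" using assms by (simp add: \<kappa>_def)
  have p: "p = (\<Sum>i\<le>degree p. monom (coeff p i) i)" by (rule poly_as_sum_of_monoms[symmetric])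
  have "r * poly (pderiv p) r = r * poly (pderiv (\<Sum>i\<le>degree p. monom (coeff p i) i)) r"
    using p by simp
  also have "\<dots> = (\<Sum>i\<le>degree p. real i * coeff p i * r ^ i)"
    unfolding pderiv_sum poly_sum sum_distrib_left
    by (intro sum.cong refl) (auto simp: pderiv_monom poly_monom power_eq_if)
  finally have "poly p r + r * poly (pderiv p) r = (\<Sum>i\<le>degree p. coeff p i * ((real i + 1) * r ^ i))"
    by (simp add: poly_altdef sum.distrib[symmetric] algebra_simps)
  also have "\<dots> \<le> (\<Sum>i\<le>degree p. coeff p i * (exp (\<kappa> - 1) / \<kappa> * s ^ i))"
  proof (intro sum_mono mult_left_mono nonneg)
    fix i
    have "(real i + 1) * \<kappa> \<le> exp ((real i + 1) * \<kappa> - 1)"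
      using exp_ge_add_one_self[of "(real i + 1) * \<kappa> - 1"] by simp
    also have "\<dots> = exp (\<kappa> - 1) * exp \<kappa> ^ i"
      by (simp add: exp_add[symmetric] exp_of_nat_mult[symmetric] algebra_simps)
    finally have "real i + 1 \<le> exp (\<kappa> - 1) / \<kappa> * exp \<kappa> ^ i"
      using \<kappa> by (simp add: field_simps)
    then have "(real i + 1) * r ^ i \<le> exp (\<kappa> - 1) / \<kappa> * exp \<kappa> ^ i * r ^ i"
      using assms by (intro mult_right_mono) auto
    then show "(real i + 1) * r ^ i \<le> exp (\<kappa> - 1) / \<kappa> * s ^ i"
      by (simp add: s power_mult_distrib mult_ac)
  qed
  also have "\<dots> = exp (\<kappa> - 1) / \<kappa> * poly p s"
    by (simp add: poly_altdef sum_distrib_left mult_ac)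
  finally show ?thesis by (simp only: \<kappa>_def)
qed

text \<open>The energy is \<open>2 * (\<Sum>i. max i (\<pi> i)) - N * (N + 1)\<close>, so the partition function is a rescaled
  \<^const>\<open>max_permanent\<close>.\<close>

theorem partition_fun_le:
  assumes pos: "\<And>k. k \<le> N \<Longrightarrow> r k > 0" and dec: "\<And>k. k < N \<Longrightarrow> r (Suc k) < r k"
  shows "partition_fun N \<beta> \<le> (\<Prod>k\<in>{1..N}. (r k + exp (- 2 * \<beta> * real k))\<^sup>2 / (exp (- 2 * \<beta> * real k) * r k)
    * (exp (ln (r (k - 1) / r k) - 1) / ln (r (k - 1) / r k)))"
proof -
  define t where "t k = exp (- 2 * \<beta> * real k)" for k :: nat
  have t: "t k > 0" for k by (simp add: t_def)
  define a where "a k = exp (ln (r (k - 1) / r k) - 1) / ln (r (k - 1) / r k)" for k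
  have step: "poly (max_permanent t k) (r k) \<le> (\<Prod>j\<in>{1..k}. (r j + t j)\<^sup>2 / r j * a j)" if "k \<le> N" for k
    using that
  proof (induction k)
    case (Suc k)
    let ?p = "max_permanent t k" and ?r = "r (Suc k)" and ?t = "t (Suc k)"
    have r: "0 < ?r" "?r < r k" using pos dec Suc.prems by auto
    have nn: "coeff ?p n \<ge> 0" for n using t by (intro coeff_max_permanent_nonneg less_imp_le)
    have p: "poly ?p ?r \<ge> 0" unfolding poly_altdef using r nn by (intro sum_nonneg) auto
    \<comment> \<open>The first term of the recursion is enlarged so that both terms share the
      factor (t + r)^2 / r and combine into p + r p', the left side of
      \<open>poly_add_pderiv_le\<close>.\<close>
    have "(?t + ?r) * ?r \<le> (?t + ?r)\<^sup>2" using r t[of "Suc k"] by (simp add: power2_eq_square algebra_simps)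
    then have "?t + ?r \<le> (?t + ?r)\<^sup>2 / ?r" using r by (simp add: field_simps)
    then have "(?t + ?r) * poly ?p ?r \<le> (?t + ?r)\<^sup>2 / ?r * poly ?p ?r"
      by (rule mult_right_mono) (rule p)
    then have "poly (max_permanent t (Suc k)) ?r \<le> (?t + ?r)\<^sup>2 / ?r * poly ?p ?r + (?t + ?r)\<^sup>2 * poly (pderiv ?p) ?r"
      unfolding max_permanent_Suc poly_add poly_mult poly_power by simp
    also have "\<dots> = (?t + ?r)\<^sup>2 / ?r * (poly ?p ?r + ?r * poly (pderiv ?p) ?r)"
      using r by (simp add: field_simps)
    also have "\<dots> \<le> (?t + ?r)\<^sup>2 / ?r * (a (Suc k) * poly ?p (r k))"
      using poly_add_pderiv_le[OF nn r] r unfolding a_def by (intro mult_left_mono) auto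
    also have "\<dots> \<le> (?t + ?r)\<^sup>2 / ?r * (a (Suc k) * (\<Prod>j\<in>{1..k}. (r j + t j)\<^sup>2 / r j * a j))"
      using Suc r by (intro mult_left_mono) (auto simp: a_def)
    finally show ?case by (simp add: add.commute mult_ac)
  qed (simp add: max_permanent_0)
  have "partition_fun N \<beta> = (\<Prod>i\<in>{1..N}. 1 / t i) * poly (max_permanent t N) 0"
  proof -
    have "exp (- \<beta> * energy N \<pi>) = (\<Prod>i\<in>{1..N}. 1 / t i) * (\<Prod>i\<in>{1..N}. t (max i (\<pi> i)))"
      if "\<pi> \<in> perms N" for \<pi>
    proof -
      have "energy N \<pi> = (\<Sum>i\<in>{1..N}. 2 * real (max i (\<pi> i)) - real i - real (\<pi> i))"
        unfolding energy_def by (intro sum.cong refl) (auto simp: max_def)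
      also have "\<dots> = (\<Sum>i\<in>{1..N}. 2 * real (max i (\<pi> i))) - (\<Sum>i\<in>{1..N}. real i) - (\<Sum>i\<in>{1..N}. real (\<pi> i))"
        by (simp add: sum_subtractf)
      also have "(\<Sum>i\<in>{1..N}. real (\<pi> i)) = (\<Sum>i\<in>{1..N}. real i)"
        using that by (intro sum.reindex_bij_betw permutes_imp_bij) (simp add: perms_def)
      finally have E0: "energy N \<pi> = (\<Sum>i\<in>{1..N}. 2 * real (max i (\<pi> i))) - (\<Sum>i\<in>{1..N}. real i) - (\<Sum>i\<in>{1..N}. real i)" .
      have m: "(\<Sum>i\<in>{1..N}. 2 * real (max i (\<pi> i))) = 2 * (\<Sum>i\<in>{1..N}. real (max i (\<pi> i)))"
        "(\<Sum>i\<in>{1..N}. - 2 * \<beta> * real (max i (\<pi> i))) = - 2 * \<beta> * (\<Sum>i\<in>{1..N}. real (max i (\<pi> i)))"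
        "(\<Sum>i\<in>{1..N}. 2 * \<beta> * real i) = 2 * \<beta> * (\<Sum>i\<in>{1..N}. real i)"
        by (simp_all only: sum_distrib_left)
      have E: "- \<beta> * energy N \<pi> = (\<Sum>i\<in>{1..N}. 2 * \<beta> * real i) + (\<Sum>i\<in>{1..N}. - 2 * \<beta> * real (max i (\<pi> i)))"
        unfolding E0 m by (simp only: algebra_simps) 
      show ?thesis
        unfolding E exp_add by (simp add: exp_sum t_def exp_minus inverse_eq_divide)
    qed
    then show ?thesis
      unfolding partition_fun_def max_permanent_def
      by (simp add: poly_sum poly_prod sum_distrib_left)
  qed
  \<comment> \<open>The partition function sits at r = 0. Nonnegative coefficients allow moving to
    \<open>r N > 0\<close>, where the recursive bound is available.\<close>
  also have "\<dots> \<le> (\<Prod>i\<in>{1..N}. 1 / t i) * poly (max_permanent t N) (r N)"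
  proof (intro mult_left_mono prod_nonneg)
    have nn: "coeff (max_permanent t N) n \<ge> 0" for n using t by (intro coeff_max_permanent_nonneg less_imp_le)
    show "poly (max_permanent t N) 0 \<le> poly (max_permanent t N) (r N)"
      unfolding poly_altdef using nn pos[of N]
      by (intro sum_mono mult_left_mono) (auto simp: power_mono)
  qed (auto simp: t less_imp_le)
  also have "\<dots> \<le> (\<Prod>i\<in>{1..N}. 1 / t i) * (\<Prod>j\<in>{1..N}. (r j + t j)\<^sup>2 / r j * a j)"
    by (intro mult_left_mono prod_nonneg step) (auto simp: t less_imp_le)
  also have "\<dots> = (\<Prod>k\<in>{1..N}. (r k + t k)\<^sup>2 / (t k * r k) * a k)"
    by (simp add: prod.distrib[symmetric] mult_ac)
  finally show ?thesis unfolding t_def a_def by (simp add: algebra_simps)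
qed

text \<open>The kernel q^|i - j| is the covariance of a stationary first-order autoregression, and
  \<open>v\<close> is its Cholesky factor: \<open>s\<close> holds the innovation variances, 1 at the
  first site and 1 - q^2 afterwards. They are nonnegative because
  \<open>\<beta> \<ge> 0\<close>.\<close>

lemma partition_fun_ge:
  fixes w :: "nat \<Rightarrow> real"
  assumes "\<beta> \<ge> 0"
  shows "fact N * (\<Prod>i\<in>{1..N}. \<Sum>j\<in>{1..N}. exp (- \<beta> * \<bar>real i - real j\<bar>) * w j)\<^sup>2
    \<le> partition_fun N \<beta> * (\<Sum>i\<in>{1..N}. \<Sum>j\<in>{1..N}. w i * exp (- \<beta> * \<bar>real i - real j\<bar>) * w j) ^ N"
proof -
  define q where "q = exp (- \<beta>)"
  have q: "0 < q" "q \<le> 1" using assms by (auto simp: q_def)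
  define s where "s a = (if a = 1 then 1 else 1 - q\<^sup>2)" for a :: nat
  have s: "s a \<ge> 0" for a using q by (auto simp: s_def power_le_one)
  have S: "(\<Sum>a\<in>{1..Suc i}. (q ^ (Suc i - a))\<^sup>2 * s a) = 1" for i
  proof (induction i)
    case (Suc i)
    have "(\<Sum>a\<in>{1..Suc (Suc i)}. (q ^ (Suc (Suc i) - a))\<^sup>2 * s a) =
        (\<Sum>a\<in>{1..Suc i}. (q ^ (Suc (Suc i) - a))\<^sup>2 * s a) + (1 - q\<^sup>2)"
      by (simp add: s_def)
    also have "(\<Sum>a\<in>{1..Suc i}. (q ^ (Suc (Suc i) - a))\<^sup>2 * s a) =
       (\<Sum>a\<in>{1..Suc i}. q\<^sup>2 * ((q ^ (Suc i - a))\<^sup>2 * s a))"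
      by (intro sum.cong refl) (auto simp: Suc_diff_le power_mult_distrib)
    also have "\<dots> = q\<^sup>2" unfolding sum_distrib_left[symmetric] Suc.IH by simp
    finally show ?case by simp
  qed (simp add: s_def)
  define v where "v i a = (if a \<le> i then q ^ (i - a) * sqrt (s a) else 0)" for i a :: nat
  have half: "exp (- \<beta> * \<bar>real i - real j\<bar>) = (\<Sum>a\<in>{1..N}. v i a * v j a)"
    if "i \<in> {1..N}" "j \<in> {1..N}" "i \<le> j" for i j
  proof -
    have "(\<Sum>a\<in>{1..N}. v i a * v j a) = (\<Sum>a\<in>{1..i}. v i a * v j a)"
      using that by (intro sum.mono_neutral_right) (auto simp: v_def)
    also have "\<dots> = (\<Sum>a\<in>{1..i}. q ^ (j - i) * ((q ^ (i - a))\<^sup>2 * s a))"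
    proof (intro sum.cong refl)
      fix a assume a: "a \<in> {1..i}"
      have "q ^ (j - a) = q ^ (j - i) * q ^ (i - a)"
        using a that by (simp add: power_add[symmetric])
      then show "v i a * v j a = q ^ (j - i) * ((q ^ (i - a))\<^sup>2 * s a)"
        using a that s[of a] by (simp add: v_def power2_eq_square mult_ac)
    qed
    also have "(\<Sum>a\<in>{1..i}. q ^ (j - i) * ((q ^ (i - a))\<^sup>2 * s a)) = q ^ (j - i)"
    proof (cases i)
      case (Suc i')
      show ?thesis unfolding sum_distrib_left[symmetric] Suc S by simp
    qed (use that in simp)
    also have "\<dots> = exp (- \<beta> * \<bar>real i - real j\<bar>)"
      using that by (simp add: q_def exp_of_nat_mult[symmetric] of_nat_diff algebra_simps)
    finally show ?thesis by simp
  qed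
  have full: "exp (- \<beta> * \<bar>real i - real j\<bar>) = (\<Sum>a\<in>{1..N}. v i a * v j a)"
    if "i \<in> {1..N}" "j \<in> {1..N}" for i j
    using half[of i j] half[of j i] that
    by (cases "i \<le> j") (simp_all add: mult.commute abs_minus_commute)
  have Z: "(\<Sum>\<pi> | \<pi> permutes {1..N}. \<Prod>i\<in>{1..N}. exp (- \<beta> * \<bar>real i - real (\<pi> i)\<bar>)) = partition_fun N \<beta>"
    unfolding partition_fun_def perms_def energy_def by (simp add: exp_sum[symmetric] sum_distrib_left sum_negf)
  from permanent_ge[of "{1..N}" "{1..N}" "\<lambda>i j. exp (- \<beta> * \<bar>real i - real j\<bar>)" v w, OF _ _ full]
  show ?thesis unfolding Z by simp
qed

section \<open>Explicit bounds with constant weights, and the mean displacement for small \<beta>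
  and large \<beta> N\<close>

lemma ln_fact_ge: "real n * ln (real n) - real n \<le> ln (fact n)"
proof (induction n)
  case (Suc n)
  show ?case
  proof (cases "n = 0")
    case False
    then have n: "real n > 0" by simp
    have "ln (real (Suc n) / real n) \<le> real (Suc n) / real n - 1"
      using n by (intro ln_le_minus_one) auto
    also have "\<dots> = 1 / real n" using n by (simp add: field_simps)
    finally have "real n * (ln (real (Suc n)) - ln (real n)) \<le> 1"
      using n by (simp add: ln_div field_simps)
    moreover have "ln (fact (Suc n) :: real) = ln (real (Suc n)) + ln (fact n)"
      using n by (simp add: ln_mult del: of_nat_Suc)
    ultimately show ?thesis using Suc.IH n by (simp add: algebra_simps)
  qed simp
qed simp

text \<open>For \<open>r k = exp (- 2 * \<beta> * k)\<close> every factor of the product is 4 exp (2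
  \<beta> - 1) / (2 \<beta>), independently of k.\<close>

lemma ln_partition_fun_le:
  assumes "\<beta> > 0"
  shows "ln (partition_fun N \<beta>) \<le> real N * ln (2 / (exp 1 * \<beta>)) + 2 * \<beta> * real N"
proof -
  have "partition_fun N \<beta> \<le> (\<Prod>k\<in>{1..N}. (exp (- 2 * \<beta> * real k) + exp (- 2 * \<beta> * real k))\<^sup>2 / (exp (- 2 * \<beta> * real k) * exp (- 2 * \<beta> * real k))
    * (exp (ln (exp (- 2 * \<beta> * real (k - 1)) / exp (- 2 * \<beta> * real k)) - 1) / ln (exp (- 2 * \<beta> * real (k - 1)) / exp (- 2 * \<beta> * real k))))"
    using assms by (intro partition_fun_le) auto
  also have "\<dots> = (\<Prod>k\<in>{1..N}. exp (ln (2 / (exp 1 * \<beta>)) + 2 * \<beta>))"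
  proof (intro prod.cong refl)
    fix k assume k: "k \<in> {1..N}"
    have "exp (- 2 * \<beta> * real (k - 1)) / exp (- 2 * \<beta> * real k) = exp (2 * \<beta>)"
      using k by (simp add: exp_diff[symmetric] of_nat_diff algebra_simps)
    then show "(exp (- 2 * \<beta> * real k) + exp (- 2 * \<beta> * real k))\<^sup>2 / (exp (- 2 * \<beta> * real k) * exp (- 2 * \<beta> * real k))
    * (exp (ln (exp (- 2 * \<beta> * real (k - 1)) / exp (- 2 * \<beta> * real k)) - 1) / ln (exp (- 2 * \<beta> * real (k - 1)) / exp (- 2 * \<beta> * real k)))
      = exp (ln (2 / (exp 1 * \<beta>)) + 2 * \<beta>)"
      using assms by (simp add: exp_add exp_diff power2_eq_square)
  qed
  also have "\<dots> = exp (real N * ln (2 / (exp 1 * \<beta>)) + 2 * \<beta> * real N)"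
    by (simp add: exp_of_nat_mult[symmetric] algebra_simps)
  finally show ?thesis
    using partition_fun_pos[of N \<beta>] by (metis ln_exp ln_mono)
qed

text \<open>The right side is coth (\<beta> / 2), the row sum of exp (- \<beta> |i - j|) over all
  integers j.\<close>

lemma two_div_le_coth:
  assumes "(\<beta>::real) > 0"
  shows "2 / \<beta> \<le> (1 + exp (- \<beta>)) / (1 - exp (- \<beta>))"
proof -
  define f where "f x = x * (1 + exp (- x)) - 2 * (1 - exp (- x))" for x :: real
  have "f 0 \<le> f \<beta>"
  proof (rule DERIV_nonneg_imp_nondecreasing[of 0 \<beta> f])
    fix x :: real assume "0 \<le> x" "x \<le> \<beta>"
    have "(f has_real_derivative 1 - exp (- x) * (1 + x)) (at x)"
      unfolding f_def by (auto intro!: derivative_eq_intros simp: algebra_simps)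
    moreover have "exp (- x) * (1 + x) \<le> exp (- x) * exp x"
      by (intro mult_left_mono) auto
    ultimately show "\<exists>y. (f has_real_derivative y) (at x) \<and> y \<ge> 0"
      by (intro exI[of _ "1 - exp (- x) * (1 + x)"]) (simp add: exp_minus)
  qed (use assms in auto)
  then show ?thesis using assms by (simp add: f_def field_simps)
qed

lemma sum_exp_abs_diff:
  assumes "i \<in> {1..N}" "q \<noteq> (1::real)"
  shows "(\<Sum>j\<in>{1..N}. q ^ nat \<bar>int i - int j\<bar>) = (1 + q - q ^ i - q ^ (N + 1 - i)) / (1 - q)"
proof -
  have q: "1 - q \<noteq> 0" using assms by simp
  have left: "(\<Sum>j\<in>{1..m}. q ^ (m - j)) = (1 - q ^ m) / (1 - q)" for m
  proof (induction m)
    case (Suc m)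
    have "(\<Sum>j\<in>{1..m}. q ^ (Suc m - j)) = q * (\<Sum>j\<in>{1..m}. q ^ (m - j))"
      unfolding sum_distrib_left by (intro sum.cong) (auto simp: Suc_diff_le)
    also have "\<dots> = q * ((1 - q ^ m) / (1 - q))" by (simp only: Suc.IH)
    finally show ?case using q by (simp add: field_simps)
  qed simp
  have *: "(1 - q) * (\<Sum>j\<in>{1..n}. q ^ nat \<bar>int i - int j\<bar>) = 1 + q - q ^ i - q ^ (n + 1 - i)" if "i \<le> n" for n
    using that
  proof (induction n rule: dec_induct)
    case base
    have "(\<Sum>j\<in>{1..i}. q ^ nat \<bar>int i - int j\<bar>) = (\<Sum>j\<in>{1..i}. q ^ (i - j))"
      by (intro sum.cong refl) (auto simp: nat_diff_distrib')
    also have "\<dots> = (1 - q ^ i) / (1 - q)" by (rule left)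
    finally have "(1 - q) * (\<Sum>j\<in>{1..i}. q ^ nat \<bar>int i - int j\<bar>) = 1 - q ^ i" using q by simp
    then show ?case by simp
  next
    case (step n)
    have "nat \<bar>int i - int (Suc n)\<bar> = Suc n - i" "nat (1 + int n - int i) = Suc n - i" using step by auto
    then have "(1 - q) * (\<Sum>j\<in>{1..Suc n}. q ^ nat \<bar>int i - int j\<bar>) =
       (1 - q) * (\<Sum>j\<in>{1..n}. q ^ nat \<bar>int i - int j\<bar>) + (1 - q) * q ^ (Suc n - i)"
      by (simp add: distrib_left)
    moreover have "q ^ (Suc n + 1 - i) = q * q ^ (Suc n - i)" using step by (simp add: Suc_diff_le)
    ultimately show ?case unfolding step.IH by (simp add: algebra_simps)
  qed
  show ?thesis using *[of N] assms q by (simp add: field_simps)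
qed

text \<open>With unit weights the row sums are \<open>C * (1 - u i)\<close>, where
  \<open>u i\<close> is the relative loss at the two ends. The third hypothesis keeps
  \<open>u i\<close> at most 3/4, whence ln (1 - u) >= -4 u. The losses sum to at most 2 / \<beta>,
  and the square in \<open>partition_fun_ge\<close> doubles them: 16 = 2 * 4 * 2.\<close>

lemma ln_partition_fun_ge:
  assumes "\<beta> > 0" "N \<ge> 1" "exp (- \<beta> * real N) \<le> 1 / 4"
  shows "real N * ln (2 / (exp 1 * \<beta>)) - 16 / \<beta> \<le> ln (partition_fun N \<beta>)"
proof -
  define q where "q = exp (- \<beta>)"
  have q: "0 < q" "q < 1" using assms by (auto simp: q_def)
  have qN: "q ^ N \<le> 1 / 4" using assms(3) by (simp add: q_def exp_of_nat_mult[symmetric] mult.commute)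
  define C where "C = (1 + q) / (1 - q)"
  have C: "C > 0" using q by (simp add: C_def)
  define u where "u i = (q ^ i + q ^ (N + 1 - i)) / (1 + q)" for i
  have u0: "u i \<ge> 0" for i using q by (simp add: u_def)
  have u1: "u i \<le> 3 / 4" if "i \<in> {1..N}" for i
  proof -
    \<comment> \<open>Expanding this product shows that q^i + q^(N + 1 - i) is largest at the end
      points, where it equals q + q^N.\<close>
    have "0 \<le> q * ((1 - q ^ (i - 1)) * (1 - q ^ (N - i)))"
      using q by (intro mult_nonneg_nonneg) (auto simp: power_le_one)
    also have "\<dots> = q - q * q ^ (i - 1) - q * q ^ (N - i) + q * (q ^ (i - 1) * q ^ (N - i))"
      by (simp add: algebra_simps)
    also have "q * q ^ (i - 1) = q ^ i" using that by (simp add: power_eq_if)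
    also have "q * q ^ (N - i) = q ^ (N + 1 - i)" using that by (simp add: Suc_diff_le)
    also have "q * (q ^ (i - 1) * q ^ (N - i)) = q ^ N"
    proof -
      have "Suc (i - 1 + (N - i)) = N" using that by auto
      then show ?thesis by (metis power_Suc power_add)
    qed
    finally have "u i \<le> (q + q ^ N) / (1 + q)" using q by (simp add: u_def divide_right_mono)
    also have "\<dots> \<le> (q + 1 / 4) / (1 + q)" using qN q by (intro divide_right_mono) auto
    also have "\<dots> \<le> 3 / 4" using q by (simp add: field_simps)
    finally show ?thesis .
  qed
  have g: "(\<Sum>j\<in>{1..N}. exp (- \<beta> * \<bar>real i - real j\<bar>)) = C * (1 - u i)" if "i \<in> {1..N}" for i
  proof -
    have "exp (- \<beta> * \<bar>real i - real j\<bar>) = q ^ nat \<bar>int i - int j\<bar>" for j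
      unfolding q_def exp_of_nat_mult[symmetric] by (simp add: mult.commute of_nat_nat)
    then have "(\<Sum>j\<in>{1..N}. exp (- \<beta> * \<bar>real i - real j\<bar>)) = (1 + q - q ^ i - q ^ (N + 1 - i)) / (1 - q)"
      using sum_exp_abs_diff[OF that, of q] q by simp
    also have "\<dots> = C * (1 - u i)" 
    proof -
      have "(1 + q) * u i = q ^ i + q ^ (N + 1 - i)" using q by (simp add: u_def)
      then show ?thesis by (simp add: C_def algebra_simps)
    qed
    finally show ?thesis .
  qed
  have "(\<Sum>i\<in>{1..N}. \<Sum>j\<in>{1..N}. exp (- \<beta> * \<bar>real i - real j\<bar>)) = (\<Sum>i\<in>{1..N}. C * (1 - u i))"
    by (intro sum.cong refl g)
  also have "\<dots> \<le> (\<Sum>i\<in>{1..N}. C)" using C u0 by (intro sum_mono) (simp add: mult_left_le)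
  finally have W: "(\<Sum>i\<in>{1..N}. \<Sum>j\<in>{1..N}. exp (- \<beta> * \<bar>real i - real j\<bar>)) \<le> real N * C" by simp
  have prod: "(\<Prod>i\<in>{1..N}. \<Sum>j\<in>{1..N}. exp (- \<beta> * \<bar>real i - real j\<bar>)) = (\<Prod>i\<in>{1..N}. C * (1 - u i))"
    by (intro prod.cong refl g)
  have "fact N * (\<Prod>i\<in>{1..N}. C * (1 - u i))\<^sup>2
      \<le> partition_fun N \<beta> * (\<Sum>i\<in>{1..N}. \<Sum>j\<in>{1..N}. exp (- \<beta> * \<bar>real i - real j\<bar>)) ^ N"
    using partition_fun_ge[of \<beta> N "\<lambda>_. 1"] assms(1) prod by simp
  also have "\<dots> \<le> partition_fun N \<beta> * (real N * C) ^ N"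
    using W by (intro mult_left_mono power_mono sum_nonneg) (auto intro: less_imp_le partition_fun_pos)
  finally have "ln (fact N * (\<Prod>i\<in>{1..N}. C * (1 - u i))\<^sup>2) \<le> ln (partition_fun N \<beta> * (real N * C) ^ N)"
    using u1 C assms(2) by (subst ln_le_cancel_iff) (fastforce simp: partition_fun_pos intro!: mult_pos_pos prod_pos)+
  moreover have "ln (fact N * (\<Prod>i\<in>{1..N}. C * (1 - u i))\<^sup>2) = ln (fact N) + 2 * (\<Sum>i\<in>{1..N}. ln C + ln (1 - u i))"
  proof -
    have pos: "C * (1 - u i) > 0" if "i \<in> {1..N}" for i using u1[OF that] C by simp
    have ne: "C * (1 - u i) \<noteq> 0" if "i \<in> {1..N}" for i using pos[OF that] by linarith
    have "ln (\<Prod>i\<in>{1..N}. C * (1 - u i)) = (\<Sum>i\<in>{1..N}. ln (C * (1 - u i)))"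
      by (rule ln_prod) (use pos ne in blast)+
    also have "\<dots> = (\<Sum>i\<in>{1..N}. ln C + ln (1 - u i))"
    proof (intro sum.cong refl)
      fix i assume i: "i \<in> {1..N}"
      have "1 - u i > 0" using u1[OF i] by simp
      then show "ln (C * (1 - u i)) = ln C + ln (1 - u i)" using C by (simp add: ln_mult)
    qed
    finally have "ln (\<Prod>i\<in>{1..N}. C * (1 - u i)) = (\<Sum>i\<in>{1..N}. ln C + ln (1 - u i))" .
    moreover have "(\<Prod>i\<in>{1..N}. C * (1 - u i)) > 0" by (intro prod_pos) (use pos in auto)
    moreover have "ln (fact N * P\<^sup>2) = ln (fact N) + 2 * ln P" if "P > 0" for P :: real
      using that by (simp add: ln_mult ln_realpow)
    ultimately show ?thesis by simp
  qed
  moreover have "ln (partition_fun N \<beta> * (real N * C) ^ N) = ln (partition_fun N \<beta>) + real N * (ln (real N) + ln C)"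
    using assms(2) C partition_fun_pos[of N \<beta>] by (simp add: ln_mult ln_realpow)
  moreover have "(\<Sum>i\<in>{1..N}. ln C + ln (1 - u i)) \<ge> (\<Sum>i\<in>{1..N}. ln C - 4 * u i)"
  proof (intro sum_mono)
    fix i assume i: "i \<in> {1..N}"
    have "ln (1 / (1 - u i)) \<le> 1 / (1 - u i) - 1" using u1[OF i] by (intro ln_le_minus_one) auto
    also have "\<dots> = u i / (1 - u i)" using u1[OF i] by (simp add: field_simps)
    also have "\<dots> \<le> u i / (1 / 4)" using u1[OF i] u0[of i] by (intro divide_left_mono) auto
    finally show "ln C - 4 * u i \<le> ln C + ln (1 - u i)" using u1[OF i] by (simp add: ln_div)
  qed
  moreover have "(\<Sum>i\<in>{1..N}. u i) \<le> 2 / \<beta>"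
  proof -
    have rev: "(\<Sum>i\<in>{1..N}. q ^ (N + 1 - i)) = (\<Sum>i\<in>{1..N}. q ^ i)"
      by (intro sum.reindex_bij_witness[of _ "\<lambda>i. N + 1 - i" "\<lambda>i. N + 1 - i"]) auto
    have geo: "(1 - q) * (\<Sum>i\<in>{1..n}. q ^ i) = q - q * q ^ n" for n
    proof (induction n)
      case (Suc n)
      have "(1 - q) * (\<Sum>i\<in>{1..Suc n}. q ^ i) = (1 - q) * (\<Sum>i\<in>{1..n}. q ^ i) + (1 - q) * q ^ Suc n"
        by (simp add: distrib_left)
      also have "\<dots> = q - q * q ^ Suc n" unfolding Suc.IH by (simp add: algebra_simps)
      finally show ?case .
    qed simp
    have "(1 - q) * (\<Sum>i\<in>{1..N}. q ^ i) \<le> q" using geo[of N] q by simp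
    then have s: "(\<Sum>i\<in>{1..N}. q ^ i) \<le> q / (1 - q)" using q by (simp add: field_simps)
    have "(\<Sum>i\<in>{1..N}. u i) = 2 * (\<Sum>i\<in>{1..N}. q ^ i) / (1 + q)"
      unfolding u_def sum_divide_distrib[symmetric] sum.distrib rev by simp
    also have "\<dots> \<le> 2 * (\<Sum>i\<in>{1..N}. q ^ i)"
      using q sum_nonneg[of "{1..N}" "\<lambda>i. q ^ i"] by (simp add: field_simps)
    also have "\<dots> \<le> 2 * (q / (1 - q))" using s by simp
    also have "\<dots> \<le> 2 * (1 / \<beta>)"
    proof -
      have "q * (1 + \<beta>) \<le> q * exp \<beta>" using q by (intro mult_left_mono) auto
      then have "q * \<beta> \<le> 1 - q" by (simp add: q_def exp_minus algebra_simps)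
      then show ?thesis using q assms by (simp add: field_simps)
    qed
    finally show ?thesis by simp
  qed
  moreover have "ln (2 / \<beta>) \<le> ln C"
    using two_div_le_coth[OF assms(1)] C assms(1) unfolding C_def q_def by (subst ln_le_cancel_iff) auto
  then have "real N * ln (2 / \<beta>) \<le> real N * ln C" by (intro mult_left_mono) auto
  moreover have "real N * ln (2 / (exp 1 * \<beta>)) = real N * ln (2 / \<beta>) - real N"
    using assms by (simp add: ln_div ln_mult right_diff_distrib distrib_left)
  moreover have "(\<Sum>i\<in>{1..N}. ln C - 4 * u i) = real N * ln C - 4 * (\<Sum>i\<in>{1..N}. u i)"
    by (simp add: sum_subtractf sum_distrib_left)
  ultimately show ?thesis using ln_fact_ge[of N] by (simp add: algebra_simps)
qed

text \<open>The step \<open>\<beta> * \<delta>\<close> balances the error of ln Z, of order N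
  \<delta>^2, against the curvature of the logarithm. The constant collects 16 from the lower bound
  for ln Z, 4 from the upper bound at \<open>\<beta> * (1 + \<delta>)\<close>, and 1 from ln (1 +
  \<delta>) >= \<delta> - \<delta>^2. The step to the left costs 16 + 2 + 2.\<close>

lemma mean_displacement_bound:
  assumes "\<beta> > 0" "N \<ge> 1" and small: "\<beta> + 1 / (\<beta> * real N) \<le> 1 / 16"
  shows "\<bar>\<beta> * mean_displacement N \<beta> - 1\<bar> \<le> 21 * sqrt (\<beta> + 1 / (\<beta> * real N))"
proof -
  define \<delta> where "\<delta> = sqrt (\<beta> + 1 / (\<beta> * real N))"
  have N: "real N > 0" using assms by simp
  have bN: "\<beta> * real N > 0" using assms N by simp
  have \<delta>2: "\<delta>\<^sup>2 = \<beta> + 1 / (\<beta> * real N)" using assms bN by (simp add: \<delta>_def)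
  have \<delta>0: "\<delta> > 0" using assms bN unfolding \<delta>_def by (simp add: add_pos_pos)
  have \<delta>1: "\<delta> \<le> 1 / 4" unfolding \<delta>_def using small by (intro real_le_lsqrt) (auto simp: power2_eq_square)
  have "1 / (\<beta> * real N) \<le> 1 / 16" using small assms by linarith
  then have bN16: "\<beta> * real N \<ge> 16" using bN by (simp add: field_simps)
  have ex: "exp (- b * real N) \<le> 1 / 4" if "b \<ge> \<beta> / 2" for b
  proof -
    have "b * real N \<ge> \<beta> / 2 * real N" using that by (intro mult_right_mono) auto
    then have "b * real N \<ge> 3" using bN16 by simp
    then have "exp (b * real N) \<ge> 4" using exp_ge_add_one_self[of "b * real N"] by linarith
    then have "inverse (exp (b * real N)) \<le> inverse 4" by (intro le_imp_inverse_le) auto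
    then show ?thesis by (simp add: exp_minus)
  qed
  define L where "L b = ln (partition_fun N b)" for b
  define D where "D = mean_displacement N \<beta>"
  have lnq: "ln (2 / (exp 1 * (\<beta> * y))) = ln (2 / (exp 1 * \<beta>)) - ln y" if "y > 0" for y
    using assms that by (simp add: ln_div ln_mult)
  have e1: "16 / \<beta> \<le> 16 * \<delta>\<^sup>2 * real N" using \<delta>2 assms N by (simp add: field_simps)
  have e2: "2 * \<beta> * real N \<le> 2 * \<delta>\<^sup>2 * real N" 
  proof -
    have "\<beta> \<le> \<delta>\<^sup>2" using \<delta>2 bN by simp
    then have "\<beta> * real N \<le> \<delta>\<^sup>2 * real N" by (intro mult_right_mono) auto
    then show ?thesis by simp
  qed
  have low: "real N * D * (\<beta> * \<delta>) \<ge> real N * (\<delta> - 21 * \<delta>\<^sup>2)"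
  proof -
    have "L \<beta> - L (\<beta> * (1 + \<delta>)) \<le> real N * D * (\<beta> * \<delta>)"
      using ln_partition_fun_diff_le[OF assms(2), of \<beta> "\<beta> * (1 + \<delta>)"] by (simp add: L_def D_def algebra_simps)
    moreover have "L \<beta> \<ge> real N * ln (2 / (exp 1 * \<beta>)) - 16 / \<beta>"
      unfolding L_def using assms ex[of \<beta>] by (intro ln_partition_fun_ge) auto
    moreover have "L (\<beta> * (1 + \<delta>)) \<le> real N * ln (2 / (exp 1 * (\<beta> * (1 + \<delta>)))) + 2 * (\<beta> * (1 + \<delta>)) * real N"
      unfolding L_def using assms \<delta>0 by (intro ln_partition_fun_le) auto
    moreover have "2 * (\<beta> * (1 + \<delta>)) * real N \<le> 2 * (2 * \<beta> * real N)"
      using \<delta>1 bN mult_left_mono[of "1 + \<delta>" 2 "\<beta> * real N"] by (simp add: algebra_simps)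
    moreover have "real N * (\<delta> - \<delta>\<^sup>2) \<le> real N * ln (1 + \<delta>)"
      using ln_one_plus_pos_lower_bound[of \<delta>] \<delta>0 \<delta>1 by (intro mult_left_mono) auto
    moreover have "real N * \<delta>\<^sup>2 \<ge> 0" by simp
    moreover have "real N * ln (2 / (exp 1 * (\<beta> * (1 + \<delta>)))) = real N * ln (2 / (exp 1 * \<beta>)) - real N * ln (1 + \<delta>)"
      by (subst lnq) (use \<delta>0 in \<open>auto simp: right_diff_distrib\<close>)
    ultimately show ?thesis using e1 e2 by (simp add: algebra_simps)
  qed
  have up: "real N * D * (\<beta> * \<delta>) \<le> real N * (\<delta> + 20 * \<delta>\<^sup>2)"
  proof -
    have "L \<beta> - L (\<beta> * (1 - \<delta>)) \<le> - (real N * D * (\<beta> * \<delta>))"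
      using ln_partition_fun_diff_le[OF assms(2), of \<beta> "\<beta> * (1 - \<delta>)"] by (simp add: L_def D_def algebra_simps)
    moreover have "L \<beta> \<ge> real N * ln (2 / (exp 1 * \<beta>)) - 16 / \<beta>"
      unfolding L_def using assms ex[of \<beta>] by (intro ln_partition_fun_ge) auto
    moreover have "L (\<beta> * (1 - \<delta>)) \<le> real N * ln (2 / (exp 1 * (\<beta> * (1 - \<delta>)))) + 2 * (\<beta> * (1 - \<delta>)) * real N"
      unfolding L_def using assms \<delta>1 by (intro ln_partition_fun_le) auto
    moreover have "2 * (\<beta> * (1 - \<delta>)) * real N \<le> 2 * \<beta> * real N"
      using \<delta>0 bN mult_left_mono[of "1 - \<delta>" 1 "\<beta> * real N"] by (simp add: algebra_simps)
    moreover have "real N * (- \<delta> - 2 * \<delta>\<^sup>2) \<le> real N * ln (1 - \<delta>)"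
      using ln_one_minus_pos_lower_bound[of \<delta>] \<delta>0 \<delta>1 by (intro mult_left_mono) auto
    moreover have "real N * \<delta>\<^sup>2 \<ge> 0" by simp
    moreover have "real N * ln (2 / (exp 1 * (\<beta> * (1 - \<delta>)))) = real N * ln (2 / (exp 1 * \<beta>)) - real N * ln (1 - \<delta>)"
      by (subst lnq) (use \<delta>1 in \<open>auto simp: right_diff_distrib\<close>)
    ultimately show ?thesis using e1 e2 by (simp add: algebra_simps)
  qed
  have pos: "real N * \<delta> > 0" using N \<delta>0 by simp
  have "(real N * \<delta>) * (1 - 21 * \<delta>) \<le> (real N * \<delta>) * (\<beta> * D)"
    using low by (simp add: algebra_simps power2_eq_square)
  then have "1 - 21 * \<delta> \<le> \<beta> * D" using pos mult_le_cancel_left_pos by blast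
  moreover have "(real N * \<delta>) * (\<beta> * D) \<le> (real N * \<delta>) * (1 + 20 * \<delta>)"
    using up by (simp add: algebra_simps power2_eq_square)
  then have "\<beta> * D \<le> 1 + 20 * \<delta>" using pos mult_le_cancel_left_pos by blast
  ultimately have "\<bar>\<beta> * D - 1\<bar> \<le> 21 * \<delta>" using \<delta>0 by linarith
  then show ?thesis by (simp only: D_def \<delta>_def)
qed

section \<open>The energy integrals of the boundary value problem\<close>

text \<open>The entire function \<open>(exp z - 1) / z\<close>; the series avoids the junk value at \<open>0\<close>.\<close>

definition expm1_quot :: "'a::{real_normed_field,banach} \<Rightarrow> 'a" where
  "expm1_quot z = (\<Sum>n. inverse (fact (Suc n)) * z ^ n)"

lemma summable_expm1_quot: "summable (\<lambda>n. inverse (fact (Suc n)) * z ^ n :: 'a::{real_normed_field,banach})"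
proof (rule summable_comparison_test)
  have "norm (inverse (fact (Suc n)) * z ^ n) \<le> inverse (fact n) * norm z ^ n" for n
  proof -
    have "(fact n :: real) \<le> fact (Suc n)" by (rule fact_mono) simp
    then have "inverse (fact (Suc n) :: real) \<le> inverse (fact n)" by (intro le_imp_inverse_le) auto
    then show ?thesis by (simp add: norm_mult norm_inverse norm_power norm_fact mult_right_mono del: fact_Suc)
  qed
  then show "\<exists>N. \<forall>n\<ge>N. norm (inverse (fact (Suc n)) * z ^ n) \<le> inverse (fact n) * norm z ^ n" by blast
  show "summable (\<lambda>n. inverse (fact n) * norm z ^ n)"
    using summable_exp[of "norm z"] by simp
qed

lemma mult_expm1_quot: "z * expm1_quot z = exp z - 1"
proof -
  have "(\<lambda>n. z * (inverse (fact (Suc n)) * z ^ n)) sums (z * expm1_quot z)"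
    unfolding expm1_quot_def by (intro sums_mult summable_sums summable_expm1_quot)
  moreover have "(\<lambda>n. inverse (fact n) * z ^ n) sums exp z"
    using exp_converges[of z] by (simp add: scaleR_conv_of_real of_real_inverse)
  then have "(\<lambda>n. inverse (fact (Suc n)) * z ^ Suc n) sums (exp z - 1)"
    by (subst sums_Suc_iff) simp
  ultimately show ?thesis
    using sums_unique2 by (simp add: mult_ac del: fact_Suc) blast
qed

text \<open>The relation is the product rule for \<open>z * expm1_quot z = exp z - 1\<close>. It is
  not solved for \<open>D\<close>, so z = 0 requires no separate case.\<close>

lemma expm1_quot_deriv:
  obtains D where "(expm1_quot has_field_derivative D) (at z)" "expm1_quot z + z * D = exp z"
proof -
  define D where "D = (\<Sum>n. diffs (\<lambda>n. inverse (fact (Suc n))) n * z ^ n)"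
  have D: "(expm1_quot has_field_derivative D) (at z)"
    unfolding expm1_quot_def D_def
    by (rule termdiffs_strong_converges_everywhere) (rule summable_expm1_quot)
  have "((\<lambda>z. z * expm1_quot z) has_field_derivative (expm1_quot z + z * D)) (at z)"
    by (auto intro!: derivative_eq_intros D)
  moreover have "((\<lambda>z. exp z - 1) has_field_derivative exp z) (at z)"
    by (auto intro!: derivative_eq_intros)
  ultimately have "expm1_quot z + z * D = exp z"
    unfolding mult_expm1_quot by (rule DERIV_unique)
  with D show thesis by (rule that)
qed

lemma continuous_on_expm1_quot [continuous_intros]:
  "continuous_on S f \<Longrightarrow> continuous_on S (\<lambda>x. expm1_quot (f x))"
  using expm1_quot_deriv DERIV_isCont
  by (metis continuous_at_imp_continuous_on continuous_on_compose2 subset_UNIV)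

lemma of_real_expm1_quot: "of_real (expm1_quot x) = (expm1_quot (of_real x) :: 'a::{real_normed_field,banach})"
  using suminf_of_real[OF summable_expm1_quot[of x], where 'a='a]
  by (simp add: expm1_quot_def del: fact_Suc)

text \<open>This is \<open>(1 - (1 - t) * exp (2 * W * t)) / t\<close>, continued to \<open>t = 0\<close>.\<close>

definition efun :: "'a::{real_normed_field,banach} \<Rightarrow> 'a \<Rightarrow> 'a" where
  "efun W t = exp (2 * W * t) - 2 * W * expm1_quot (2 * W * t)"

lemma mult_efun: "t * efun W t = 1 - (1 - t) * exp (2 * W * t)"
  using mult_expm1_quot[of "2 * W * t"] by (simp add: efun_def algebra_simps)

lemma efun_0: "efun W 0 = 1 - 2 * W"
  using expm1_quot_deriv[of 0] by (auto simp: efun_def)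

text \<open>Links the real function to its entire extension; the analyticity of the solution is
  proved through the latter.\<close>

lemma of_real_efun: "of_real (efun W t) = (efun (of_real W) (of_real t) :: 'a::{real_normed_field,banach})"
  by (simp add: efun_def of_real_expm1_quot exp_of_real[symmetric])

lemma continuous_on_efun [continuous_intros]:
  "continuous_on S f \<Longrightarrow> continuous_on S g \<Longrightarrow> continuous_on S (\<lambda>x. efun (f x) (g x))"
  unfolding efun_def by (intro continuous_intros)

text \<open>The derivative -2 (1 - t) exp (2 W t) is written through \<open>efun\<close> itself. In
  this form the moments below are closed under differentiation in W.\<close>

lemma efun_has_derivative_W:
  "((\<lambda>W. efun W t) has_field_derivative - 2 * (1 - t * efun W t)) (at W)"
proof -
  obtain D where D: "(expm1_quot has_field_derivative D) (at (2 * W * t))"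
    and e: "expm1_quot (2 * W * t) + 2 * W * t * D = exp (2 * W * t)"
    by (rule expm1_quot_deriv)
  have "((\<lambda>W. efun W t) has_field_derivative 2 * t * exp (2 * W * t)
      - (2 * expm1_quot (2 * W * t) + 2 * W * (D * (2 * t)))) (at W)"
    unfolding efun_def by (auto intro!: derivative_eq_intros DERIV_chain2[where f = expm1_quot and g = "\<lambda>W. 2 * W * t", OF D])
  also have "2 * t * exp (2 * W * t) - (2 * expm1_quot (2 * W * t) + 2 * W * (D * (2 * t)))
     = - 2 * (1 - t * efun W t)"
    unfolding mult_efun e[symmetric] by (simp add: algebra_simps)
  finally show ?thesis .
qed

lemma efun_has_derivative_t:
  obtains D where "(efun W has_field_derivative D) (at t)"
    "efun W t + t * D = exp (2 * W * t) * (1 - 2 * W * (1 - t))"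
proof -
  obtain D where D: "(expm1_quot has_field_derivative D) (at (2 * W * t))"
    and e: "expm1_quot (2 * W * t) + 2 * W * t * D = exp (2 * W * t)"
    by (rule expm1_quot_deriv)
  have *: "(efun W has_field_derivative 2 * W * exp (2 * W * t) - 2 * W * (D * (2 * W))) (at t)"
    unfolding efun_def by (auto intro!: derivative_eq_intros DERIV_chain2[where f = expm1_quot and g = "\<lambda>t. 2 * W * t", OF D])
  have "efun W t + t * (2 * W * exp (2 * W * t) - 2 * W * (D * (2 * W)))
     = exp (2 * W * t) - 2 * W * (expm1_quot (2 * W * t) + 2 * W * t * D) + 2 * W * t * exp (2 * W * t)"
    unfolding efun_def by (simp add: algebra_simps)
  also have "\<dots> = exp (2 * W * t) * (1 - 2 * W * (1 - t))"
    unfolding e by (simp add: algebra_simps)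
  finally show thesis by (rule that[OF *])
qed

text \<open>From 1 - t <= exp (- t), the term (1 - t) exp (2 W t) is at most exp (- (1 - 2 W) t),
  which is below 1 precisely because W < 1/2 and t > 0.\<close>

lemma efun_pos:
  fixes W t :: real
  assumes "W < 1 / 2" "0 \<le> t"
  shows "efun W t > 0"
proof (cases "t = 0")
  case False
  have "(1 - t) * exp (2 * W * t) \<le> exp (- t) * exp (2 * W * t)"
    using exp_ge_add_one_self[of "- t"] by (intro mult_right_mono) auto
  also have "\<dots> = exp (- ((1 - 2 * W) * t))" by (simp add: exp_add[symmetric] algebra_simps)
  also have "\<dots> < 1" using assms False by simp
  finally have "t * efun W t > 0" unfolding mult_efun by simp
  then show ?thesis using assms False by (simp add: zero_less_mult_iff)
qed (use assms in \<open>simp add: efun_0\<close>)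

lemma efun_le:
  fixes W t :: real
  assumes "0 \<le> t" "t \<le> 1"
  shows "efun W t \<le> 1 - 2 * W + 2 * W * t"
proof (cases "t = 0")
  case False
  have "(1 - t) * (1 + 2 * W * t) \<le> (1 - t) * exp (2 * W * t)"
    using assms by (intro mult_left_mono) auto
  then have "t * efun W t \<le> t * (1 - 2 * W + 2 * W * t)" unfolding mult_efun by (simp add: algebra_simps)
  then show ?thesis using assms False by (subst (asm) mult_le_cancel_left_pos) auto
qed (simp add: efun_0)

lemma mult_efun_le_1:
  fixes W t :: real
  assumes "0 \<le> t" "t \<le> 1"
  shows "t * efun W t \<le> 1"
  unfolding mult_efun using assms by simp

section \<open>Moments of powers of \<open>efun\<close> and their derivatives in W\<close>

text \<open>The index \<open>j\<close> counts powers of t = s^2 and \<open>n\<close> shifts the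
  exponent -1/2 down. Differentiation in W sends (j, n) to a combination of (j, n + 1) and (j + 1,
  n), so the family is closed under it.\<close>

definition emom :: "nat \<Rightarrow> nat \<Rightarrow> real \<Rightarrow> real" where
  "emom j n W = integral {0..1} (\<lambda>s. s ^ (2 * j) * efun W (s\<^sup>2) powr (- real n - 1 / 2))"

lemma continuous_on_emom_integrand:
  fixes W :: real and S :: "real set"
  assumes "W < 1 / 2"
  shows "continuous_on S (\<lambda>s. s ^ (2 * j) * efun W (s\<^sup>2) powr a)"
  using efun_pos[OF assms, of "_\<^sup>2"] by (intro continuous_intros) (auto simp: less_imp_neq[symmetric])

lemma integrable_emom_integrand:
  fixes W :: real
  assumes "W < 1 / 2"
  shows "(\<lambda>s. s ^ (2 * j) * efun W (s\<^sup>2) powr a) integrable_on {a'..b'}"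
  by (intro integrable_continuous_real continuous_on_emom_integrand assms)

lemma DERIV_powr_const:
  assumes "(f has_real_derivative D) (at x within S)" "f x > 0"
  shows "((\<lambda>x. f x powr a) has_real_derivative a * f x powr (a - 1) * D) (at x within S)"
  using DERIV_chain2[OF has_real_derivative_powr assms(1), of a] assms(2) by simp

lemma emom_has_derivative:
  assumes "W < 1 / 2"
  shows "(emom j n has_real_derivative (2 * real n + 1) * (emom j (Suc n) W - emom (Suc j) n W)) (at W)"
proof -
  define U :: "real set" where "U = {..<1 / 2}"
  define fx where "fx W s = s ^ (2 * j) * ((- real n - 1 / 2) * efun W (s\<^sup>2) powr (- real n - 1 / 2 - 1)
      * (- 2 * (1 - s\<^sup>2 * efun W (s\<^sup>2))))" for W s
  have "((\<lambda>W. integral (cbox 0 1) (\<lambda>s. s ^ (2 * j) * efun W (s\<^sup>2) powr (- real n - 1 / 2)))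
      has_field_derivative integral (cbox 0 1) (fx W)) (at W within U)"
  proof (rule leibniz_rule_field_derivative)
    fix W s :: real assume W: "W \<in> U"
    then have pos: "efun W (s\<^sup>2) > 0" by (intro efun_pos) (auto simp: U_def)
    have "((\<lambda>W. s ^ (2 * j) * efun W (s\<^sup>2) powr (- real n - 1 / 2)) has_field_derivative fx W s) (at W)"
      unfolding fx_def
      by (intro DERIV_cmult DERIV_powr_const efun_has_derivative_W pos)
    then show "((\<lambda>W. s ^ (2 * j) * efun W (s\<^sup>2) powr (- real n - 1 / 2)) has_field_derivative fx W s) (at W within U)"
      by (rule has_field_derivative_at_within)
  next
    have "efun (fst x) ((snd x)\<^sup>2) \<noteq> 0" if "x \<in> U \<times> cbox 0 1" for x :: "real \<times> real"
      using efun_pos[of "fst x" "(snd x)\<^sup>2"] that by (auto simp: U_def)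
    then show "continuous_on (U \<times> cbox 0 1) (\<lambda>(x, t). fx x t)"
      unfolding fx_def split_def by (intro continuous_intros) auto
  qed (use assms in \<open>auto simp: U_def cbox_interval intro: integrable_emom_integrand\<close>)
  moreover have "at W within U = at W" using assms by (intro at_within_open) (auto simp: U_def)
  moreover have "integral (cbox 0 1) (fx W) = (2 * real n + 1) * (emom j (Suc n) W - emom (Suc j) n W)"
  proof -
    have "integral (cbox 0 1) (fx W) = integral {0..1} (\<lambda>s. (2 * real n + 1) *
        (s ^ (2 * j) * efun W (s\<^sup>2) powr (- real (Suc n) - 1 / 2) - s ^ (2 * Suc j) * efun W (s\<^sup>2) powr (- real n - 1 / 2)))"
      unfolding cbox_interval
    proof (intro integral_cong)
      fix s :: real
      have pos: "efun W (s\<^sup>2) > 0" using assms by (intro efun_pos) auto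
      define P where "P = efun W (s\<^sup>2) powr (- real n - 1 / 2 - 1)"
      have a: "- real (Suc n) - 1 / 2 = - real n - 1 / 2 - 1" by simp
      have "efun W (s\<^sup>2) powr (- real n - 1 / 2) = P * efun W (s\<^sup>2)"

      proof -
        have "efun W (s\<^sup>2) powr ((- real n - 1 / 2 - 1) + 1) = P * efun W (s\<^sup>2)"
          unfolding P_def powr_add using pos by simp
        moreover have "(- real n - 1 / 2 - 1) + 1 = - real n - 1 / 2" by simp
        ultimately show ?thesis by (simp only:)
      qed
      then show "fx W s = (2 * real n + 1) *
        (s ^ (2 * j) * efun W (s\<^sup>2) powr (- real (Suc n) - 1 / 2) - s ^ (2 * Suc j) * efun W (s\<^sup>2) powr (- real n - 1 / 2))"
        unfolding fx_def a P_def[symmetric] by (simp add: power_add power2_eq_square field_simps)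
    qed
    also have "\<dots> = (2 * real n + 1) * (emom j (Suc n) W - emom (Suc j) n W)"
      unfolding emom_def by (subst integral_mult_right, subst integral_diff)
        (rule integrable_emom_integrand assms refl)+
    finally show ?thesis .
  qed
  ultimately show ?thesis by (simp add: emom_def[abs_def] cbox_interval)
qed

text \<open>The integrand on the left is the derivative of \<open>s * (1 - s\<^sup>2) * efun W (s\<^sup>2) powr (- 1 / 2)\<close>.\<close>

lemma emom_identity:
  assumes "W < 1 / 2"
  shows "2 * emom 0 0 W - 4 * emom 1 0 W
    + 2 * W * ((emom 0 1 W - emom 1 0 W) - (emom 1 1 W - emom 2 0 W)) - (emom 0 1 W - emom 1 0 W) = 0"
proof -
  define I where "I j n s = s ^ (2 * j) * efun W (s\<^sup>2) powr (- real n - 1 / 2)" for j n and s :: real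
  define g where "g s = s * (1 - s\<^sup>2) * efun W (s\<^sup>2) powr (- 1 / 2)" for s :: real
  have der: "(g has_real_derivative 2 * I 0 0 s - 4 * I 1 0 s
    + 2 * W * ((I 0 1 s - I 1 0 s) - (I 1 1 s - I 2 0 s)) - (I 0 1 s - I 1 0 s)) (at s)" for s
  proof -
    define e where "e = efun W (s\<^sup>2)"
    have pos: "e > 0" unfolding e_def using assms by (intro efun_pos) auto
    obtain D where D: "(efun W has_field_derivative D) (at (s\<^sup>2))"
      and eq: "efun W (s\<^sup>2) + s\<^sup>2 * D = exp (2 * W * s\<^sup>2) * (1 - 2 * W * (1 - s\<^sup>2))"
      by (rule efun_has_derivative_t)
    define r where "r = e powr (- 3 / 2)"
    have r: "e powr (- 1 / 2) = e * r"
      unfolding r_def using pos powr_add[of e 1 "- 3 / 2"] by simp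
    have r2: "e powr (- 1 / 2 - 1) = r" by (simp add: r_def)
    have "(g has_real_derivative (1 - 3 * s\<^sup>2) * e powr (- 1 / 2)
        + s * (1 - s\<^sup>2) * ((- 1 / 2) * e powr (- 1 / 2 - 1) * (D * (2 * s)))) (at s)"
      unfolding g_def e_def
      by (rule derivative_eq_intros DERIV_powr_const DERIV_chain2[where f = "efun W" and g = "\<lambda>s. s\<^sup>2", OF D] refl
            | (use pos in \<open>simp add: e_def power2_eq_square algebra_simps\<close>))+
    also have "(1 - 3 * s\<^sup>2) * e powr (- 1 / 2) + s * (1 - s\<^sup>2) * ((- 1 / 2) * e powr (- 1 / 2 - 1) * (D * (2 * s)))
       = r * ((1 - 3 * s\<^sup>2) * e - (1 - s\<^sup>2) * (s\<^sup>2 * D))"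
      unfolding r r2 by (simp add: power2_eq_square algebra_simps)
    \<comment> \<open>\<open>eq\<close> removes the unknown derivative \<open>D\<close>, and
      \<open>mult_efun\<close> below removes the exponential; only powers of s and \<open>e\<close>
      remain.\<close>
    also have "(1 - s\<^sup>2) * (s\<^sup>2 * D) = (1 - 2 * W * (1 - s\<^sup>2)) * ((1 - s\<^sup>2) * exp (2 * W * s\<^sup>2)) - (1 - s\<^sup>2) * e"
    proof -
      have "s\<^sup>2 * D = exp (2 * W * s\<^sup>2) * (1 - 2 * W * (1 - s\<^sup>2)) - e"
        using eq by (simp add: e_def)
      then show ?thesis by (simp only:) (simp add: algebra_simps)
    qed
    also have "(1 - s\<^sup>2) * exp (2 * W * s\<^sup>2) = 1 - s\<^sup>2 * e"
      using mult_efun[of "s\<^sup>2" W] by (simp add: e_def)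
    also have "r * ((1 - 3 * s\<^sup>2) * e - ((1 - 2 * W * (1 - s\<^sup>2)) * (1 - s\<^sup>2 * e) - (1 - s\<^sup>2) * e))
      = 2 * I 0 0 s - 4 * I 1 0 s
    + 2 * W * ((I 0 1 s - I 1 0 s) - (I 1 1 s - I 2 0 s)) - (I 0 1 s - I 1 0 s)"
    proof -
      have I: "I j 0 s = s ^ (2 * j) * (e * r)" "I j 1 s = s ^ (2 * j) * r" for j
        using r by (auto simp: I_def e_def r_def)
      show ?thesis unfolding I by (simp add: algebra_simps power2_eq_square power4_eq_xxxx)
    qed
    finally show ?thesis .
  qed
  have int: "I j n integrable_on {0..1}" for j n
    unfolding I_def by (intro integrable_emom_integrand assms)
  have M: "emom j n W = integral {0..1} (I j n)" for j n by (simp add: emom_def I_def[abs_def])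
  have "((\<lambda>s. 2 * I 0 0 s - 4 * I 1 0 s
    + 2 * W * ((I 0 1 s - I 1 0 s) - (I 1 1 s - I 2 0 s)) - (I 0 1 s - I 1 0 s)) has_integral g 1 - g 0) {0..1}"
    by (rule fundamental_theorem_of_calculus)
       (use der in \<open>auto simp only: has_real_derivative_iff_has_vector_derivative intro: has_vector_derivative_at_within\<close>)
  then have "integral {0..1} (\<lambda>s. 2 * I 0 0 s - 4 * I 1 0 s
    + 2 * W * ((I 0 1 s - I 1 0 s) - (I 1 1 s - I 2 0 s)) - (I 0 1 s - I 1 0 s)) = 0"
    by (simp add: integral_unique g_def)
  moreover have "((\<lambda>s. 2 * I 0 0 s - 4 * I 1 0 s
    + 2 * W * ((I 0 1 s - I 1 0 s) - (I 1 1 s - I 2 0 s)) - (I 0 1 s - I 1 0 s)) has_integral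
    2 * emom 0 0 W - 4 * emom 1 0 W
    + 2 * W * ((emom 0 1 W - emom 1 0 W) - (emom 1 1 W - emom 2 0 W)) - (emom 0 1 W - emom 1 0 W)) {0..1}"
    unfolding M by (intro has_integral_diff has_integral_add has_integral_mult_right integrable_integral int)
  ultimately show ?thesis by (simp add: integral_unique)
qed

section \<open>Parametrisation of c, of the free energy and of its slope by W\<close>

definition cpar :: "real \<Rightarrow> real" where "cpar W = 4 * W * emom 0 0 W"

definition cpar' :: "real \<Rightarrow> real" where
  "cpar' W = 4 * (emom 0 0 W + W * (emom 0 1 W - emom 1 0 W))"

text \<open>Minus the quotient of the derivatives of \<open>FW\<close> and \<open>cpar\<close>, in
  the form it takes after \<open>emom_identity\<close> has eliminated the differentiated
  moments.\<close>

definition fW :: "real \<Rightarrow> real" where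
  "fW W = (emom 0 0 W - emom 1 0 W) / (2 * (emom 0 0 W)\<^sup>2)"

text \<open>Equals 2 / c times the integral of ln h: with h = sqrt (4 W / c) exp (- W sigma^2), the
  prefactor gives 4 W / c = 1 / \<open>emom 0 0 W\<close>, and sigma^2 integrates to
  \<open>4 * W * emom 1 0 W\<close>.\<close>

definition FW :: "real \<Rightarrow> real" where
  "FW W = - ln (emom 0 0 W) - 2 * W * emom 1 0 W / emom 0 0 W"

lemma emom_0_0_ge:
  assumes "0 \<le> W" "W < 1 / 2"
  shows "emom 0 0 W \<ge> 1"
proof -
  have "integral {0..1} (\<lambda>s::real. 1 :: real) \<le> emom 0 0 W"
    unfolding emom_def
  proof (rule integral_le)
    fix s :: real assume s: "s \<in> {0..1}"
    have s2: "s\<^sup>2 \<le> 1" using s by (simp add: power_le_one)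
    have pos: "efun W (s\<^sup>2) > 0" using assms by (intro efun_pos) auto
    have "W * s\<^sup>2 \<le> W" using s2 assms by (simp add: mult_left_le)
    then have "efun W (s\<^sup>2) \<le> 1" using efun_le[of "s\<^sup>2" W] s2 by simp
    then have "efun W (s\<^sup>2) powr (1 / 2) \<le> 1" using pos by (intro powr_le1) auto
    then show "1 \<le> s ^ (2 * 0) * efun W (s\<^sup>2) powr (- real 0 - 1 / 2)"
      using pos by (simp add: powr_minus one_le_inverse)
  qed (use integrable_emom_integrand[OF assms(2), of 0 "- real 0 - 1 / 2"] in auto)
  then show ?thesis by simp
qed

lemma emom_0_0_pos:
  assumes "W < 1 / 2"
  shows "emom 0 0 W > 0"
proof -
  have c: "continuous_on {0..1} (\<lambda>s. s ^ (2 * 0) * efun W (s\<^sup>2) powr (- real 0 - 1 / 2))"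
    by (rule continuous_on_emom_integrand[OF assms])
  have pos: "s ^ (2 * 0) * efun W (s\<^sup>2) powr (- real 0 - 1 / 2) > 0" for s
    using efun_pos[OF assms, of "s\<^sup>2"] by simp
  have "integral {0..1} (\<lambda>s. s ^ (2 * 0) * efun W (s\<^sup>2) powr (- real 0 - 1 / 2)) \<noteq> 0"
  proof
    assume "integral {0..1} (\<lambda>s. s ^ (2 * 0) * efun W (s\<^sup>2) powr (- real 0 - 1 / 2)) = 0"
    then have "\<forall>s\<in>{0..1}. s ^ (2 * 0) * efun W (s\<^sup>2) powr (- real 0 - 1 / 2) = 0"
      using integral_eq_0_iff[OF c _ less_imp_le[OF pos]] by simp
    then have "(0::real) ^ (2 * 0) * efun W (0\<^sup>2) powr (- real 0 - 1 / 2) = 0" by (rule bspec) simp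
    with pos[of 0] show False by simp
  qed
  moreover have "emom 0 0 W \<ge> 0" unfolding emom_def
    using pos by (intro integral_nonneg integrable_emom_integrand assms) (auto intro: less_imp_le)
  ultimately show ?thesis by (simp add: emom_def)
qed

lemma emom_1_0_less:
  assumes "W < 1 / 2"
  shows "emom 1 0 W < emom 0 0 W"
proof -
  let ?g = "\<lambda>s. s ^ (2 * 0) * efun W (s\<^sup>2) powr (- real 0 - 1 / 2) - s ^ (2 * 1) * efun W (s\<^sup>2) powr (- real 0 - 1 / 2)"
  have c: "continuous_on {0..1} ?g"
    by (intro continuous_on_diff continuous_on_emom_integrand[OF assms])
  have g: "?g s = (1 - s\<^sup>2) * efun W (s\<^sup>2) powr (- 1 / 2)" for s by (simp add: left_diff_distrib)
  have nn: "?g s \<ge> 0" if "s \<in> {0..1}" for s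
    unfolding g using that by (intro mult_nonneg_nonneg) (auto simp: power_le_one)
  have p0: "?g 0 > 0" unfolding g using efun_pos[OF assms, of 0] by simp
  have "integral {0..1} ?g \<noteq> 0"
  proof
    assume "integral {0..1} ?g = 0"
    then have "\<forall>s\<in>{0..1}. ?g s = 0" using integral_eq_0_iff[OF c _ nn] by simp
    then have "?g 0 = 0" by (rule bspec) simp
    with p0 show False by simp
  qed
  moreover have "integral {0..1} ?g \<ge> 0"
    by (intro integral_nonneg integrable_continuous_real c nn)
  moreover have "integral {0..1} ?g = emom 0 0 W - emom 1 0 W"
    unfolding emom_def by (intro integral_diff integrable_emom_integrand assms)
  ultimately show ?thesis by simp
qed

text \<open>The difference of the two sides is the derivative of \<open>emom 0 0\<close>; its sign
  makes \<open>cpar\<close> increasing.\<close>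

lemma emom_0_1_ge:
  assumes "W < 1 / 2"
  shows "emom 1 0 W \<le> emom 0 1 W"
  unfolding emom_def
proof (intro integral_le integrable_emom_integrand assms)
  fix s :: real assume s: "s \<in> {0..1}"
  have pos: "efun W (s\<^sup>2) > 0" using assms by (intro efun_pos) auto
  have "efun W (s\<^sup>2) powr (- 1 / 2) = efun W (s\<^sup>2) powr (- 3 / 2) * efun W (s\<^sup>2)"
    using powr_add[of "efun W (s\<^sup>2)" "- 3 / 2" 1] pos by simp
  then have "s\<^sup>2 * efun W (s\<^sup>2) powr (- 1 / 2) = efun W (s\<^sup>2) powr (- 3 / 2) * (s\<^sup>2 * efun W (s\<^sup>2))"
    by (simp only: mult_ac)
  also have "\<dots> \<le> efun W (s\<^sup>2) powr (- 3 / 2) * 1"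
    using s by (intro mult_left_mono mult_efun_le_1) (auto simp: power_le_one)
  finally show "s ^ (2 * 1) * efun W (s\<^sup>2) powr (- real 0 - 1 / 2) \<le> s ^ (2 * 0) * efun W (s\<^sup>2) powr (- real 1 - 1 / 2)"
    by simp
qed

lemma cpar_has_derivative:
  assumes "W < 1 / 2"
  shows "(cpar has_real_derivative cpar' W) (at W)"
  unfolding cpar_def[abs_def] cpar'_def
  by (rule derivative_eq_intros emom_has_derivative assms refl | simp add: algebra_simps)+

lemma cpar'_pos:
  assumes "0 \<le> W" "W < 1 / 2"
  shows "cpar' W > 0"
  using emom_0_0_pos[OF assms(2)] emom_0_1_ge[OF assms(2)] assms
  by (simp add: cpar'_def add_pos_nonneg)

lemma cpar_strict_mono:
  assumes "0 \<le> W" "W < W'" "W' < 1 / 2"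
  shows "cpar W < cpar W'"
  using assms by (intro DERIV_pos_imp_increasing[of W W' cpar])
    (auto intro!: exI[of _ "cpar' _"] cpar_has_derivative cpar'_pos)

text \<open>With a^2 = 1 - 2 W, \<open>efun W (s\<^sup>2)\<close> is at most a^2 + s^2, hence at
  most (a + s)^2, and 1 / (a + s) integrates to a logarithm. The bound diverges as W tends to 1/2,
  so \<open>cpar\<close> reaches every positive c.\<close>

lemma emom_0_0_ge_ln:
  assumes "0 \<le> W" "W < 1 / 2"
  shows "emom 0 0 W \<ge> ln (1 / sqrt (1 - 2 * W))"
proof -
  define a where "a = sqrt (1 - 2 * W)"
  have a: "a > 0" "a\<^sup>2 = 1 - 2 * W" using assms by (auto simp: a_def)
  have I: "((\<lambda>s. 1 / (a + s)) has_integral ln (a + 1) - ln (a + 0)) {0..1}"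
  proof (rule fundamental_theorem_of_calculus)
    fix s :: real assume "s \<in> {0..1}"
    then show "((\<lambda>s. ln (a + s)) has_vector_derivative 1 / (a + s)) (at s within {0..1})"
      unfolding has_real_derivative_iff_has_vector_derivative[symmetric]
      using a by (auto intro!: derivative_eq_intros simp: add_pos_nonneg)
  qed simp
  have "ln (1 / a) \<le> ln (a + 1) - ln (a + 0)" using a by (simp add: ln_div)
  also have "\<dots> = integral {0..1} (\<lambda>s. 1 / (a + s))" using I by (simp add: integral_unique)
  also have "\<dots> \<le> emom 0 0 W" unfolding emom_def
  proof (rule integral_le)
    show "(\<lambda>s. 1 / (a + s)) integrable_on {0..1}" using I by blast
    show "(\<lambda>s. s ^ (2 * 0) * efun W (s\<^sup>2) powr (- real 0 - 1 / 2)) integrable_on {0..1}"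
      by (rule integrable_emom_integrand[OF assms(2)])
    fix s :: real assume s: "s \<in> {0..1}"
    then have s2: "s\<^sup>2 \<le> 1" by (simp add: power_le_one)
    have pos: "efun W (s\<^sup>2) > 0" using assms by (intro efun_pos) auto
    have "2 * W * s\<^sup>2 \<le> 1 * s\<^sup>2" using assms by (intro mult_right_mono) auto
    then have "efun W (s\<^sup>2) \<le> a\<^sup>2 + s\<^sup>2" using efun_le[of "s\<^sup>2" W] s2 a by simp
    also have "\<dots> \<le> (a + s)\<^sup>2" using a s by (simp add: power2_sum)
    finally have "sqrt (efun W (s\<^sup>2)) \<le> a + s" using a s by (intro real_le_lsqrt) auto
    then have "inverse (a + s) \<le> inverse (sqrt (efun W (s\<^sup>2)))" using pos by (intro le_imp_inverse_le) auto
    then show "1 / (a + s) \<le> s ^ (2 * 0) * efun W (s\<^sup>2) powr (- real 0 - 1 / 2)"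
      using pos by (simp add: powr_minus powr_half_sqrt inverse_eq_divide)
  qed
  finally show ?thesis by (simp add: a_def)
qed

lemma cpar_surj:
  assumes "c > 0"
  obtains W where "0 < W" "W < 1 / 2" "cpar W = c"
proof -
  \<comment> \<open>Chosen so that sqrt (1 - 2 W1) <= exp (- c), which lifts the logarithmic bound
    to c; the maximum with 1/4 gives 4 W1 >= 1.\<close>
  define W1 where "W1 = max (1 / 4) ((1 - exp (- 2 * c)) / 2)"
  have W1: "0 \<le> W1" "W1 < 1 / 2" "1 / 4 \<le> W1" using assms by (auto simp: W1_def max_def)
  have "exp (- 2 * c) \<ge> 1 - 2 * W1" by (auto simp: W1_def max_def field_simps)
  then have "sqrt (1 - 2 * W1) \<le> sqrt (exp (- c) ^ 2)"
    by (intro real_sqrt_le_mono) (simp add: exp_of_nat_mult[symmetric])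
  then have le: "sqrt (1 - 2 * W1) \<le> exp (- c)" by simp
  have s: "sqrt (1 - 2 * W1) > 0" using W1 by simp
  have "ln (sqrt (1 - 2 * W1)) \<le> ln (exp (- c))"
    using le s by (subst ln_le_cancel_iff) auto
  then have "c \<le> ln (1 / sqrt (1 - 2 * W1))" using s by (simp add: ln_div)
  also have "\<dots> \<le> emom 0 0 W1" by (rule emom_0_0_ge_ln) (use W1 in auto)
  also have "\<dots> \<le> cpar W1"
    unfolding cpar_def using W1 emom_0_0_pos[OF W1(2)] mult_right_mono[of 1 "4 * W1" "emom 0 0 W1"] by simp
  finally have "c \<le> cpar W1" .
  moreover have "cpar 0 \<le> c" using assms by (simp add: cpar_def)
  moreover have "continuous_on {0..W1} cpar"
    using W1 by (intro continuous_at_imp_continuous_on ballI DERIV_isCont[OF cpar_has_derivative]) auto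
  ultimately obtain W where W: "0 \<le> W" "W \<le> W1" "cpar W = c"
    using IVT'[of cpar 0 c W1] W1 by blast
  have "W \<noteq> 0" using W assms by (auto simp: cpar_def)
  then show thesis using W W1 by (intro that[of W]) auto
qed

definition Wpar :: "real \<Rightarrow> real" where
  "Wpar c = (THE W. 0 < W \<and> W < 1 / 2 \<and> cpar W = c)"

lemma Wpar_eqI:
  assumes "0 < W" "W < 1 / 2" "cpar W = c"
  shows "Wpar c = W"
  unfolding Wpar_def
proof (rule the_equality)
  fix V assume "0 < V \<and> V < 1 / 2 \<and> cpar V = c"
  then show "V = W" using cpar_strict_mono[of V W] cpar_strict_mono[of W V] assms
    by (cases V W rule: linorder_cases) auto
qed (use assms in auto)

lemma Wpar:
  assumes "c > 0"
  shows "0 < Wpar c" "Wpar c < 1 / 2" "cpar (Wpar c) = c"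
  using cpar_surj[OF assms] Wpar_eqI by metis+

lemma Wpar_has_derivative:
  assumes "c > 0"
  shows "(Wpar has_real_derivative inverse (cpar' (Wpar c))) (at c)"
proof -
  have "(Wpar has_real_derivative inverse (cpar' (Wpar c))) (at (cpar (Wpar c)))"
  proof (rule has_field_derivative_inverse_strong[where f = cpar and x = "Wpar c" and g = Wpar and S = "{0<..<1 / 2}"])
    show "(cpar has_real_derivative cpar' (Wpar c)) (at (Wpar c))"
      using Wpar[OF assms] by (intro cpar_has_derivative) auto
    show "cpar' (Wpar c) \<noteq> 0" using cpar'_pos[of "Wpar c"] Wpar[OF assms] by simp
    show "continuous_on {0<..<1 / 2} cpar"
      by (intro continuous_at_imp_continuous_on ballI DERIV_isCont[OF cpar_has_derivative]) auto
    show "Wpar (cpar z) = z" if "z \<in> {0<..<1 / 2}" for z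
      using that by (intro Wpar_eqI) auto
  qed (use Wpar[OF assms] in auto)
  then show ?thesis using Wpar[OF assms] by simp
qed

lemma Wpar_le:
  assumes "c > 0"
  shows "Wpar c \<le> c / 4"
proof -
  have "4 * Wpar c * 1 \<le> 4 * Wpar c * emom 0 0 (Wpar c)"
    using Wpar[OF assms] emom_0_0_ge[of "Wpar c"] by (intro mult_left_mono) auto
  then show ?thesis using Wpar(3)[OF assms] by (simp add: cpar_def)
qed

text \<open>The quotient rule leaves the derivatives M0' and M1'. \<open>emom_identity\<close> is
  the linear relation that removes M1', and the rest factors through M0 + W M0', which is
  \<open>cpar' W / 4\<close>.\<close>

lemma FW_has_derivative:
  assumes "0 < W" "W < 1 / 2"
  shows "(FW has_real_derivative - fW W * cpar' W) (at W)"
proof -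
  note W = assms(2)
  define M0 where "M0 = emom 0 0 W"
  define M1 where "M1 = emom 1 0 W"
  define M0' where "M0' = emom 0 1 W - emom 1 0 W"
  define M1' where "M1' = emom 1 1 W - emom 2 0 W"
  have pos: "M0 > 0" unfolding M0_def by (rule emom_0_0_pos[OF W])
  have d0: "(emom 0 0 has_real_derivative M0') (at W)"
    using emom_has_derivative[OF W, of 0 0] by (simp add: M0'_def)
  have d1: "(emom 1 0 has_real_derivative M1') (at W)"
    using emom_has_derivative[OF W, of 1 0] by (simp add: M1'_def numeral_2_eq_2)
  have id: "2 * M0 - 4 * M1 + 2 * W * (M0' - M1') - M0' = 0"
    using emom_identity[OF W] by (simp only: M0_def M1_def M0'_def M1'_def)
  have "(FW has_real_derivative - (M0' / M0)
     - ((2 * M1 + 2 * W * M1') * M0 - 2 * W * M1 * M0') / (M0 * M0)) (at W)"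
    unfolding FW_def[abs_def] M0_def M1_def
    by (rule derivative_eq_intros d0 d1 refl | (use pos in \<open>simp add: M0_def M1_def\<close>))+
  also have "- (M0' / M0) - ((2 * M1 + 2 * W * M1') * M0 - 2 * W * M1 * M0') / (M0 * M0) = - fW W * cpar' W"
  proof -
    \<comment> \<open>A polynomial identity whose last summand is M0^2 times the left side of
      \<open>id\<close>, hence zero.\<close>
    have "M0 * ((M0 - M1) * 2 * (M0 + W * M0')) = M0 * (M0' * M0 + ((2 * M1 + 2 * W * M1') * M0 - 2 * W * M1 * M0'))
        + M0 * M0 * (2 * M0 - 4 * M1 + 2 * W * (M0' - M1') - M0')"
      by (simp add: algebra_simps)
    then have "(M0 - M1) * 2 * (M0 + W * M0') = M0' * M0 + ((2 * M1 + 2 * W * M1') * M0 - 2 * W * M1 * M0')"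
      using id pos by simp
    then have "(M0 - M1) * 2 * (M0 + W * M0') / (M0 * M0) = M0' / M0 + ((2 * M1 + 2 * W * M1') * M0 - 2 * W * M1 * M0') / (M0 * M0)"
      using pos by (simp add: add_divide_distrib)
    moreover have e: "cpar' W = 4 * (M0 + W * M0')" "fW W = (M0 - M1) / (2 * M0\<^sup>2)"
      by (simp_all only: cpar'_def fW_def M0_def M1_def M0'_def)
    have "fW W * cpar' W = (M0 - M1) * 2 * (M0 + W * M0') / (M0 * M0)"
      unfolding e using pos by (simp add: power2_eq_square field_simps)
    ultimately show ?thesis by simp
  qed
  finally show ?thesis .
qed

definition f1 :: "real \<Rightarrow> real" where "f1 c = fW (Wpar c)"

definition F1 :: "real \<Rightarrow> real" where "F1 c = FW (Wpar c)"

lemma F1_has_derivative: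
  assumes "c > 0"
  shows "(F1 has_real_derivative - f1 c) (at c)"
proof -
  have "cpar' (Wpar c) \<noteq> 0" using cpar'_pos[of "Wpar c"] Wpar[OF assms] by simp
  then show ?thesis
    using DERIV_chain2[OF FW_has_derivative[OF Wpar(1,2)[OF assms]] Wpar_has_derivative[OF assms]]
    by (simp add: F1_def[abs_def] f1_def mult.assoc)
qed

lemma f1_pos:
  assumes "c > 0"
  shows "f1 c > 0"
  using emom_1_0_less[of "Wpar c"] emom_0_0_pos[of "Wpar c"] Wpar[OF assms]
  by (simp add: f1_def fW_def)

section \<open>Smoothness of \<open>f1\<close> and its limit at 0\<close>

text \<open>Functions of \<open>W\<close> obtained from the moments by algebraic operations: a class closed under
  differentiation that contains all \<open>(deriv ^^ n) f1 \<circ> cpar\<close>.\<close>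

inductive_set smoothW :: "(real \<Rightarrow> real) set" where
  mom: "emom j n \<in> smoothW"
| const: "(\<lambda>_. a) \<in> smoothW"
| id: "(\<lambda>W. W) \<in> smoothW"
| add: "u \<in> smoothW \<Longrightarrow> v \<in> smoothW \<Longrightarrow> (\<lambda>W. u W + v W) \<in> smoothW"
| mult: "u \<in> smoothW \<Longrightarrow> v \<in> smoothW \<Longrightarrow> (\<lambda>W. u W * v W) \<in> smoothW"
| inv: "u \<in> smoothW \<Longrightarrow> (\<And>W. 0 < W \<Longrightarrow> W < 1 / 2 \<Longrightarrow> u W \<noteq> 0) \<Longrightarrow> (\<lambda>W. inverse (u W)) \<in> smoothW"

lemma smoothW_diff: "u \<in> smoothW \<Longrightarrow> v \<in> smoothW \<Longrightarrow> (\<lambda>W. u W - v W) \<in> smoothW"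
  using smoothW.add[OF _ smoothW.mult[OF smoothW.const[of "-1"]], of u v] by simp

lemma smoothW_has_derivative:
  assumes "u \<in> smoothW"
  shows "\<exists>u'\<in>smoothW. \<forall>W. 0 < W \<longrightarrow> W < 1 / 2 \<longrightarrow> (u has_real_derivative u' W) (at W)"
  using assms
proof induction
  case (mom j n)
  show ?case
    by (rule bexI[of _ "\<lambda>W. (2 * real n + 1) * (emom j (Suc n) W - emom (Suc j) n W)"])
       (auto intro!: emom_has_derivative smoothW.mult smoothW_diff smoothW.intros(1,2))
next
  case (const a)
  show ?case by (rule bexI[of _ "\<lambda>_. 0"]) (auto intro: smoothW.const)
next
  case id
  show ?case by (rule bexI[of _ "\<lambda>_. 1"]) (auto intro: smoothW.const)
next
  case (add u v)
  then obtain u' v' where uv: "u' \<in> smoothW" "v' \<in> smoothW"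
    "\<And>W. 0 < W \<Longrightarrow> W < 1 / 2 \<Longrightarrow> (u has_real_derivative u' W) (at W)"
    "\<And>W. 0 < W \<Longrightarrow> W < 1 / 2 \<Longrightarrow> (v has_real_derivative v' W) (at W)" by blast
  show ?case
    by (rule bexI[of _ "\<lambda>W. u' W + v' W"]) (auto intro!: smoothW.add uv DERIV_add)
next
  case (mult u v)
  then obtain u' v' where uv: "u' \<in> smoothW" "v' \<in> smoothW"
    "\<And>W. 0 < W \<Longrightarrow> W < 1 / 2 \<Longrightarrow> (u has_real_derivative u' W) (at W)"
    "\<And>W. 0 < W \<Longrightarrow> W < 1 / 2 \<Longrightarrow> (v has_real_derivative v' W) (at W)" by blast
  show ?case
    by (rule bexI[of _ "\<lambda>W. u' W * v W + v' W * u W"])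
       (auto intro!: smoothW.add smoothW.mult uv mult.hyps DERIV_mult)
next
  case (inv u)
  then obtain u' where u: "u' \<in> smoothW"
    "\<And>W. 0 < W \<Longrightarrow> W < 1 / 2 \<Longrightarrow> (u has_real_derivative u' W) (at W)" by blast
  have i: "(\<lambda>W. inverse (u W)) \<in> smoothW" using inv.hyps by (rule smoothW.inv)
  show ?case
  proof (rule bexI[of _ "\<lambda>W. (- 1) * ((inverse (u W) * u' W) * inverse (u W))"])
    show "(\<lambda>W. (- 1) * ((inverse (u W) * u' W) * inverse (u W))) \<in> smoothW"
      by (intro smoothW.mult smoothW.const i u(1))
  qed (use DERIV_inverse'[OF u(2)] inv.hyps(2) in auto)
qed

lemma cpar'_smoothW: "cpar' \<in> smoothW"
  unfolding cpar'_def[abs_def]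
  by (intro smoothW.mult smoothW.add smoothW_diff smoothW.mom smoothW.const smoothW.id)

lemma fW_smoothW: "fW \<in> smoothW"
  unfolding fW_def[abs_def] divide_inverse power2_eq_square
  by (intro smoothW.mult smoothW.inv smoothW_diff smoothW.mom smoothW.const) (use emom_0_0_pos in \<open>simp add: less_imp_neq[symmetric]\<close>)

lemma smooth_on_f1: "smooth_on {0<..} f1"
proof -
  have "\<exists>v\<in>smoothW. \<forall>c>0. (deriv ^^ n) f1 c = v (Wpar c)" for n
  proof (induction n)
    case 0
    show ?case by (rule bexI[of _ fW]) (auto simp: f1_def fW_smoothW)
  next
    case (Suc n)
    then obtain v where v: "v \<in> smoothW" "\<And>c. c > 0 \<Longrightarrow> (deriv ^^ n) f1 c = v (Wpar c)" by blast
    obtain v' where v': "v' \<in> smoothW" "\<And>W. 0 < W \<Longrightarrow> W < 1 / 2 \<Longrightarrow> (v has_real_derivative v' W) (at W)"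
      using smoothW_has_derivative[OF v(1)] by blast
    have "(deriv ^^ Suc n) f1 c = v' (Wpar c) * inverse (cpar' (Wpar c))" if c: "c > 0" for c
    proof -
      have "((\<lambda>c. v (Wpar c)) has_real_derivative v' (Wpar c) * inverse (cpar' (Wpar c))) (at c)"
        by (intro DERIV_chain2[OF v'(2)] Wpar_has_derivative Wpar c)
      then have "((deriv ^^ n) f1 has_real_derivative v' (Wpar c) * inverse (cpar' (Wpar c))) (at c)"
        by (rule has_field_derivative_transform_within_open[of _ _ _ "{0<..}"]) (use c v(2) in auto)
      then show ?thesis by (simp add: DERIV_imp_deriv)
    qed
    moreover have "(\<lambda>W. v' W * inverse (cpar' W)) \<in> smoothW"
      by (intro smoothW.mult smoothW.inv v' cpar'_smoothW) (use cpar'_pos in \<open>simp add: less_imp_neq[symmetric] less_imp_le\<close>)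
    ultimately show ?case by (intro bexI[of _ "\<lambda>W. v' W * inverse (cpar' W)"]) auto
  qed
  then have "((deriv ^^ n) f1) differentiable_on {0<..}" for n
  proof -
    obtain v where v: "v \<in> smoothW" "\<And>c. c > 0 \<Longrightarrow> (deriv ^^ n) f1 c = v (Wpar c)"
      using \<open>\<And>n. \<exists>v\<in>smoothW. \<forall>c>0. (deriv ^^ n) f1 c = v (Wpar c)\<close> by blast
    obtain v' where v': "\<And>W. 0 < W \<Longrightarrow> W < 1 / 2 \<Longrightarrow> (v has_real_derivative v' W) (at W)"
      using smoothW_has_derivative[OF v(1)] by blast
    have "(\<lambda>c. v (Wpar c)) differentiable (at c within {0<..})" if "c > 0" for c
      using DERIV_chain2[OF v'[OF Wpar(1,2)] Wpar_has_derivative, OF that that that]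
      by (meson differentiable_at_withinI real_differentiable_def)
    then have "((deriv ^^ n) f1) differentiable (at c within {0<..})" if "c > 0" for c
      by (rule differentiable_transform_within[where d = 1]) (use that v(2) in auto)
    then show ?thesis by (simp add: differentiable_on_def)
  qed
  then show ?thesis by (simp add: smooth_on_def)
qed

text \<open>\<open>Wpar_le\<close> forces W to 0 together with c. Since \<open>efun 0 t = 1\<close>,
  the moments at W = 0 are 1 and 1/3, and \<open>fW 0\<close> is (1 - 1/3) / 2.\<close>

lemma f1_tendsto_at_0: "(f1 \<longlongrightarrow> 1 / 3) (at_right 0)"
proof -
  have M: "emom j 0 0 = 1 / (2 * real j + 1)" for j
  proof -
    have "((\<lambda>s. s ^ (2 * j)) has_integral 1 ^ Suc (2 * j) / real (Suc (2 * j)) - 0 ^ Suc (2 * j) / real (Suc (2 * j))) {0..1::real}"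
      by (rule fundamental_theorem_of_calculus)
         (auto simp: has_real_derivative_iff_has_vector_derivative[symmetric] simp del: power_Suc intro!: derivative_eq_intros)
    then show ?thesis by (simp add: emom_def efun_def integral_unique)
  qed
  have "isCont fW 0"
    unfolding fW_def[abs_def]
    using emom_0_0_pos[of 0]
    by (intro continuous_intros DERIV_isCont[OF emom_has_derivative]) auto
  moreover have "fW 0 = 1 / 3" by (simp add: fW_def M[of 0, simplified] M[of 1, simplified])
  ultimately have "(fW \<longlongrightarrow> 1 / 3) (nhds 0)" by (metis continuous_at tendsto_at_iff_tendsto_nhds)
  moreover have "(Wpar \<longlongrightarrow> 0) (at_right 0)"
  proof (rule tendsto_sandwich)
    show "\<forall>\<^sub>F c in at_right 0. 0 \<le> Wpar c" "\<forall>\<^sub>F c in at_right 0. Wpar c \<le> c / 4"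
      using Wpar(1) Wpar_le by (auto simp: eventually_at_right_field intro!: exI[of _ 1] less_imp_le)
    show "((\<lambda>_. 0) \<longlongrightarrow> 0) (at_right 0)" "((\<lambda>c. c / 4) \<longlongrightarrow> 0) (at_right (0::real))"
      by (auto intro!: tendsto_eq_intros)
  qed
  ultimately show ?thesis unfolding f1_def[abs_def] by (rule filterlim_compose)
qed

section \<open>The solution of the boundary value problem\<close>

text \<open>The base point is -2 because an integral over {0..\<sigma>} is 0 by default for negative
  \<sigma>. Starting outside [-1, 1] also makes the derivative two-sided at \<sigma> = -1.\<close>

definition eint :: "nat \<Rightarrow> real \<Rightarrow> real \<Rightarrow> real" where
  "eint j W \<sigma> = integral {-2..\<sigma>} (\<lambda>u. 2 * W * (u ^ (2 * j) * efun W (u\<^sup>2) powr (- 1 / 2)))"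

lemma eint_integrable:
  assumes "W < 1 / 2"
  shows "(\<lambda>u::real. 2 * W * (u ^ (2 * j) * efun W (u\<^sup>2) powr (- 1 / 2))) integrable_on {a..b}"
  by (intro integrable_continuous_real continuous_intros continuous_on_emom_integrand assms)

lemma eint_has_derivative:
  assumes "W < 1 / 2" "-2 < \<sigma>" "\<sigma> < 2"
  shows "(eint j W has_real_derivative 2 * W * (\<sigma> ^ (2 * j) * efun W (\<sigma>\<^sup>2) powr (- 1 / 2))) (at \<sigma>)"
proof -
  have "(eint j W has_real_derivative 2 * W * (\<sigma> ^ (2 * j) * efun W (\<sigma>\<^sup>2) powr (- 1 / 2))) (at \<sigma> within {-2..2})"
    unfolding eint_def[abs_def]
  proof (rule integral_has_real_derivative)
    show "continuous_on {-2..2} (\<lambda>u. 2 * W * (u ^ (2 * j) * efun W (u\<^sup>2) powr (- 1 / 2)))"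
      by (intro continuous_on_mult continuous_on_const continuous_on_emom_integrand assms)
  qed (use assms in auto)
  moreover have "at \<sigma> within {-2..2} = at \<sigma>"
    using assms by (intro at_within_interior) (auto simp: interior_atLeastAtMost_real)
  ultimately show ?thesis by simp
qed

lemma eint_diff:
  assumes "W < 1 / 2"
  shows "eint j W 1 - eint j W 0 = 2 * W * emom j 0 W" "eint j W 0 - eint j W (-1) = 2 * W * emom j 0 W"
proof -
  define g where "g u = 2 * W * (u ^ (2 * j) * efun W (u\<^sup>2) powr (- 1 / 2))" for u :: real
  have int: "g integrable_on {a..b}" for a b unfolding g_def by (rule eint_integrable[OF assms])
  have e: "eint j W \<sigma> = integral {-2..\<sigma>} g" for \<sigma> by (simp add: eint_def g_def[abs_def])
  have M: "integral {0..1} g = 2 * W * emom j 0 W"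
    by (simp add: g_def[abs_def] emom_def)
  show "eint j W 1 - eint j W 0 = 2 * W * emom j 0 W"
    using Henstock_Kurzweil_Integration.integral_combine[where a = "-2" and c = 0 and b = 1 and f = g] int M by (simp add: e)
  have "integral {-1..0} g = integral {0..1} g"
    using Henstock_Kurzweil_Integration.integral_reflect_real[where a = 0 and b = 1 and f = g] by (simp add: g_def[abs_def])
  then show "eint j W 0 - eint j W (-1) = 2 * W * emom j 0 W"
    using Henstock_Kurzweil_Integration.integral_combine[where a = "-2" and c = "-1" and b = 0 and f = g] int M by (simp add: e)
qed

text \<open>The quadrature: c / 2 - s as a function of sigma, zero at the midpoint of the
  interval.\<close>

definition Phi :: "real \<Rightarrow> real \<Rightarrow> real" where "Phi W \<sigma> = eint 0 W \<sigma> - eint 0 W 0"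

lemma Phi_has_derivative:
  assumes "W < 1 / 2" "-2 < \<sigma>" "\<sigma> < 2"
  shows "(Phi W has_real_derivative 2 * W * efun W (\<sigma>\<^sup>2) powr (- 1 / 2)) (at \<sigma>)"
  unfolding Phi_def[abs_def]
  using DERIV_diff[OF eint_has_derivative[OF assms, of 0] DERIV_const[of "eint 0 W 0"]] by simp

lemma Phi_strict_mono:
  assumes "0 < W" "W < 1 / 2" "-2 < \<sigma>" "\<sigma> < \<tau>" "\<tau> < 2"
  shows "Phi W \<sigma> < Phi W \<tau>"
proof (rule DERIV_pos_imp_increasing[OF assms(4)])
  fix x assume x: "\<sigma> \<le> x" "x \<le> \<tau>"
  then have "efun W (x\<^sup>2) > 0" using assms by (intro efun_pos) auto
  then show "\<exists>y. (Phi W has_real_derivative y) (at x) \<and> 0 < y"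
    using Phi_has_derivative[of W x] x assms by (intro exI[of _ "2 * W * efun W (x\<^sup>2) powr (- 1 / 2)"]) auto
qed

text \<open>The inverse is taken on (-2, 2) rather than [-1, 1], so that \<open>sig c\<close> has
  two-sided derivatives at s = 0 and s = c, where sigma is 1 and -1.\<close>

definition sig :: "real \<Rightarrow> real \<Rightarrow> real" where
  "sig c s = the_inv_into {-2<..<2} (Phi (Wpar c)) (c / 2 - s)"

definition hsol :: "real \<Rightarrow> real \<Rightarrow> real" where
  "hsol c s = sqrt (4 * Wpar c / c) * exp (- Wpar c * (sig c s)\<^sup>2)"

text \<open>The equation and the condition at 0 have the first integral h'^2 = h^2 - (4 / c) ln (h /
  h(0)). Inserting h = sqrt (4 W / c) exp (- W sigma^2) gives h'^2 = h^2 sigma^2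
  \<open>efun W (sigma^2)\<close>. Since sigma changes sign at the maximum of h, the root is taken
  smoothly through the turning point. There h^2 = 4 W / c, and W < 1/2 says that h'' is
  negative.\<close>

definition hsol' :: "real \<Rightarrow> real \<Rightarrow> real" where
  "hsol' c s = hsol c s * sig c s * sqrt (efun (Wpar c) ((sig c s)\<^sup>2))"

context
  fixes c W :: real
  assumes c: "c > 0" and W_def: "W = Wpar c"
begin

lemma W: "0 < W" "W < 1 / 2" "4 * W * emom 0 0 W = c"
  using Wpar[OF c] by (auto simp: W_def cpar_def)

lemma Phi_ends: "Phi W 1 = c / 2" "Phi W (-1) = - c / 2"
  using eint_diff[OF W(2), of 0] W(3) by (auto simp: Phi_def)

lemma inj_Phi: "inj_on (Phi W) {-2<..<2}"
  by (rule strict_mono_on_imp_inj_on) (auto simp: strict_mono_on_def intro: Phi_strict_mono W)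

lemma sig_Phi: "-2 < \<sigma> \<Longrightarrow> \<sigma> < 2 \<Longrightarrow> sig c (c / 2 - Phi W \<sigma>) = \<sigma>"
  unfolding sig_def W_def[symmetric] by (simp add: the_inv_into_f_f[OF inj_Phi])

lemma sig_ends: "sig c 0 = 1" "sig c c = -1"
  using sig_Phi[of 1] sig_Phi[of "-1"] by (simp_all add: Phi_ends)

lemma sig:
  assumes "s \<in> {0..c}"
  shows "-1 \<le> sig c s" "sig c s \<le> 1" "Phi W (sig c s) = c / 2 - s"
proof -
  have "continuous_on {-1..1} (Phi W)"
    by (intro continuous_at_imp_continuous_on ballI DERIV_isCont[OF Phi_has_derivative] W) auto
  then obtain \<sigma> where \<sigma>: "-1 \<le> \<sigma>" "\<sigma> \<le> 1" "Phi W \<sigma> = c / 2 - s"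
    using IVT'[of "Phi W" "-1" "c / 2 - s" 1] assms by (auto simp: Phi_ends)
  then have "sig c s = \<sigma>" using sig_Phi[of \<sigma>] by simp
  with \<sigma> show "-1 \<le> sig c s" "sig c s \<le> 1" "Phi W (sig c s) = c / 2 - s" by auto
qed

lemma efun_sig_pos: "efun W ((sig c s)\<^sup>2) > 0"
  by (intro efun_pos W) auto

lemma sig_has_derivative:
  assumes "s \<in> {0..c}"
  shows "(sig c has_real_derivative - sqrt (efun W ((sig c s)\<^sup>2)) / (2 * W)) (at s)"
proof -
  let ?\<sigma> = "sig c s" and ?P = "the_inv_into {-2<..<2} (Phi W)"
  have "(?P has_real_derivative inverse (2 * W * efun W (?\<sigma>\<^sup>2) powr (- 1 / 2))) (at (Phi W ?\<sigma>))"
  proof (rule has_field_derivative_inverse_strong[where f = "Phi W" and x = ?\<sigma> and g = ?P and S = "{-2<..<2}"])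
    show "(Phi W has_real_derivative 2 * W * efun W (?\<sigma>\<^sup>2) powr (- 1 / 2)) (at ?\<sigma>)"
      using sig[OF assms] W by (intro Phi_has_derivative) auto
    show "2 * W * efun W (?\<sigma>\<^sup>2) powr (- 1 / 2) \<noteq> 0" using efun_sig_pos[of s] W by simp
    show "continuous_on {-2<..<2} (Phi W)"
      by (intro continuous_at_imp_continuous_on ballI DERIV_isCont[OF Phi_has_derivative] W) auto
    show "?P (Phi W z) = z" if "z \<in> {-2<..<2}" for z
      using that by (rule the_inv_into_f_f[OF inj_Phi])
  qed (use sig[OF assms] in auto)
  moreover have "2 * W * efun W (?\<sigma>\<^sup>2) powr (- 1 / 2) = 2 * W / sqrt (efun W (?\<sigma>\<^sup>2))"
    using efun_sig_pos[of s] by (simp add: powr_minus powr_half_sqrt inverse_eq_divide)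
  ultimately have P: "(?P has_real_derivative sqrt (efun W (?\<sigma>\<^sup>2)) / (2 * W)) (at (c / 2 - s))"
    by (simp only: sig(3)[OF assms] inverse_divide)
  have "((\<lambda>s. ?P (c / 2 - s)) has_real_derivative sqrt (efun W (?\<sigma>\<^sup>2)) / (2 * W) * (- 1)) (at s)"
    by (rule DERIV_chain2[where f = ?P and g = "\<lambda>s. c / 2 - s", OF P]) (auto intro!: derivative_eq_intros)
  then show ?thesis unfolding sig_def[abs_def] W_def[symmetric] by simp
qed

lemma hsol_pos: "hsol c s > 0"
  using W c by (simp add: hsol_def W_def)

lemma hsol_has_derivative:
  assumes "s \<in> {0..c}"
  shows "(hsol c has_real_derivative hsol' c s) (at s)"
proof -
  have "(hsol c has_real_derivative hsol c s * (- W * (2 * sig c s * (- sqrt (efun W ((sig c s)\<^sup>2)) / (2 * W))))) (at s)"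
    unfolding hsol_def[abs_def] W_def[symmetric]
    by (rule derivative_eq_intros sig_has_derivative assms refl | simp)+
  also have "hsol c s * (- W * (2 * sig c s * (- sqrt (efun W ((sig c s)\<^sup>2)) / (2 * W)))) = hsol' c s"
    using W by (simp add: hsol'_def W_def[symmetric])
  finally show ?thesis .
qed

lemma hsol'_has_derivative:
  assumes "s \<in> {0..c}"
  shows "(hsol' c has_real_derivative hsol c s - 2 / (c * hsol c s)) (at s)"
proof -
  define \<sigma> where "\<sigma> = sig c s"
  define t where "t = \<sigma>\<^sup>2"
  define r where "r = sqrt (efun W t)"
  define X where "X = exp (2 * W * t)"
  have r: "r > 0" "r\<^sup>2 = efun W t" using efun_sig_pos[of s] by (auto simp: r_def t_def \<sigma>_def)
  obtain D where D: "(efun W has_field_derivative D) (at t)"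
    and eq: "efun W t + t * D = exp (2 * W * t) * (1 - 2 * W * (1 - t))"
    by (rule efun_has_derivative_t)
  have dsig: "(sig c has_real_derivative - r / (2 * W)) (at s)"
    using sig_has_derivative[OF assms] by (simp add: r_def t_def \<sigma>_def)
  have dr: "((\<lambda>s. sqrt (efun W ((sig c s)\<^sup>2))) has_real_derivative (inverse r / 2) * (D * (2 * \<sigma> * (- r / (2 * W))))) (at s)"
  proof (rule DERIV_chain2[where f = sqrt and g = "\<lambda>s. efun W ((sig c s)\<^sup>2)"])
    show "(sqrt has_real_derivative inverse r / 2) (at (efun W ((sig c s)\<^sup>2)))"
      unfolding r_def t_def \<sigma>_def by (intro DERIV_real_sqrt efun_sig_pos)
    show "((\<lambda>s. efun W ((sig c s)\<^sup>2)) has_real_derivative D * (2 * \<sigma> * (- r / (2 * W)))) (at s)"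
    proof (rule DERIV_chain2[where f = "efun W" and g = "\<lambda>s. (sig c s)\<^sup>2"])
      show "(efun W has_real_derivative D) (at ((sig c s)\<^sup>2))" using D by (simp add: t_def \<sigma>_def)
      show "((\<lambda>s. (sig c s)\<^sup>2) has_real_derivative 2 * \<sigma> * (- r / (2 * W))) (at s)"
        by (rule derivative_eq_intros dsig refl | simp add: \<sigma>_def)+
    qed
  qed
  let ?h = "hsol c s"
  have A: "hsol' c s = ?h * \<sigma> * r" by (simp add: hsol'_def W_def r_def t_def \<sigma>_def)
  have dh: "(hsol c has_real_derivative ?h * \<sigma> * r) (at s)"
    using hsol_has_derivative[OF assms] unfolding A .
  have "(hsol' c has_real_derivative (?h * \<sigma> * r * \<sigma> + (- r / (2 * W)) * ?h) * r
      + ((inverse r / 2) * (D * (2 * \<sigma> * (- r / (2 * W))))) * (?h * \<sigma>)) (at s)"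
    unfolding hsol'_def[abs_def] W_def[symmetric]
    using DERIV_mult[OF DERIV_mult[OF dh dsig] dr]
    by (simp only: r_def[symmetric] t_def[symmetric] \<sigma>_def[symmetric])
  \<comment> \<open>\<open>D\<close> enters only through r^2 + t D, which \<open>eq\<close>
    evaluates without dividing by t; the turning point sigma = 0 is thus covered.\<close>
  also have "(?h * \<sigma> * r * \<sigma> + (- r / (2 * W)) * ?h) * r + ((inverse r / 2) * (D * (2 * \<sigma> * (- r / (2 * W))))) * (?h * \<sigma>)
     = ?h * (t * r\<^sup>2 - (r\<^sup>2 + t * D) / (2 * W))"
    using r(1) W(1) by (simp add: t_def power2_eq_square field_simps)
  also have "r\<^sup>2 + t * D = X * (1 - 2 * W * (1 - t))" unfolding r eq X_def ..
  also have "t * r\<^sup>2 = 1 - (1 - t) * X" unfolding r mult_efun X_def ..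
  also have "1 - (1 - t) * X - X * (1 - 2 * W * (1 - t)) / (2 * W) = 1 - X / (2 * W)"
    using W(1) by (simp add: field_simps)
  \<comment> \<open>This is where the prefactor sqrt (4 W / c) matters: it gives c h^2 X = 4
    W.\<close>
  also have "?h * (1 - X / (2 * W)) = ?h - 2 / (c * ?h)"
  proof -
    have "?h * ?h = 4 * W / c * exp (- W * t) * exp (- W * t)"
    proof -
      have "sqrt (4 * W / c) * sqrt (4 * W / c) = 4 * W / c" using W(1) c by simp
      moreover have "x * y * (x * y) = z * y * y" if "x * x = z" for x y z :: real
        unfolding that[symmetric] by (simp only: mult_ac)
      ultimately show ?thesis unfolding hsol_def W_def[symmetric] t_def \<sigma>_def by blast
    qed
    also have "\<dots> = 4 * W / c * inverse X"
      by (simp add: X_def exp_minus[symmetric] mult.assoc exp_add[symmetric])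
    finally have "c * (?h * ?h) * X = 4 * W" using c by (simp add: X_def)
    then have "?h * (X / (2 * W)) = 2 / (c * ?h)"
      using hsol_pos[of s] W(1) c by (simp add: field_simps)
    then show ?thesis by (simp add: right_diff_distrib)
  qed
  finally show ?thesis .
qed

text \<open>At both ends sigma^2 = 1 and \<open>efun W 1 = 1\<close>, so h' = sigma h.\<close>

lemma hsol_boundary: "hsol' c 0 = hsol c 0" "hsol c 0 = hsol c c" "hsol' c c = - hsol c c"
proof -
  have "efun W 1 = 1" using mult_efun[of 1 W] by simp
  then show "hsol' c 0 = hsol c 0" "hsol c 0 = hsol c c" "hsol' c c = - hsol c c"
    by (auto simp: hsol'_def hsol_def sig_ends W_def)
qed

text \<open>Passing from s to sigma, the integral of sigma^2 over [0, c] becomes an integral over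
  [-1, 1], with primitive \<open>- eint 1 W (sig c s)\<close>; the value is twice the half-range
  moment.\<close>

lemma integral_ln_hsol: "((\<lambda>s. ln (hsol c s)) has_integral c / 2 * F1 c) {0..c}"
proof -
  have I: "((\<lambda>s. (sig c s)\<^sup>2) has_integral (- eint 1 W (sig c c)) - (- eint 1 W (sig c 0))) {0..c}"
  proof (rule fundamental_theorem_of_calculus)
    fix s assume s: "s \<in> {0..c}"
    let ?e = "efun W ((sig c s)\<^sup>2)"
    have "((\<lambda>s. eint 1 W (sig c s)) has_real_derivative
        2 * W * ((sig c s) ^ (2 * 1) * ?e powr (- 1 / 2)) * (- sqrt ?e / (2 * W))) (at s)"
      by (rule DERIV_chain2[OF eint_has_derivative sig_has_derivative]) (use sig[OF s] s W in auto)
    also have "2 * W * ((sig c s) ^ (2 * 1) * ?e powr (- 1 / 2)) * (- sqrt ?e / (2 * W)) = - (sig c s)\<^sup>2"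
      using efun_sig_pos[of s] W by (simp add: powr_minus powr_half_sqrt power2_eq_square field_simps)
    finally have "((\<lambda>s. - eint 1 W (sig c s)) has_real_derivative (sig c s)\<^sup>2) (at s)"
      using DERIV_minus by fastforce
    then show "((\<lambda>s. - eint 1 W (sig c s)) has_vector_derivative (sig c s)\<^sup>2) (at s within {0..c})"
      unfolding has_real_derivative_iff_has_vector_derivative by (rule has_vector_derivative_at_within)
  qed (use c in simp)
  have "(- eint 1 W (sig c c)) - (- eint 1 W (sig c 0)) = 4 * W * emom 1 0 W"
    using eint_diff[OF W(2), of 1] by (simp add: sig_ends)
  with I have I: "((\<lambda>s. (sig c s)\<^sup>2) has_integral 4 * W * emom 1 0 W) {0..c}" by simp
  have ln: "ln (hsol c s) = ln (4 * W / c) / 2 + (- W) * (sig c s)\<^sup>2" for s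
    using W c by (simp add: hsol_def W_def[symmetric] ln_mult ln_sqrt)
  have "((\<lambda>s. ln (hsol c s)) has_integral (c * (ln (4 * W / c) / 2)) + (- W) * (4 * W * emom 1 0 W)) {0..c}"
    unfolding ln
    by (intro has_integral_add has_integral_mult_right I)
       (use has_integral_const_real[of "ln (4 * W / c) / 2" 0 c] c in simp)
  moreover have "(c * (ln (4 * W / c) / 2)) + (- W) * (4 * W * emom 1 0 W) = c / 2 * F1 c"
  proof -
    have p: "emom 0 0 W > 0" by (rule emom_0_0_pos[OF W(2)])
    have "4 * W / c = inverse (emom 0 0 W)" using W(1) p by (simp add: W(3)[symmetric] field_simps)
    then have "ln (4 * W / c) = - ln (emom 0 0 W)" using p by (simp add: ln_inverse)
    then have "c / 2 * F1 c = c * (ln (4 * W / c) / 2) - c * (W * emom 1 0 W / emom 0 0 W)"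
      by (simp add: F1_def FW_def W_def[symmetric] algebra_simps)
    also have "c * (W * emom 1 0 W / emom 0 0 W) = W * (4 * W * emom 1 0 W)"
      using p by (simp add: W(3)[symmetric])
    finally show ?thesis by simp
  qed
  ultimately show ?thesis by (simp only:)
qed

end

section \<open>Analyticity of the solution up to the end points\<close>

text \<open>The coefficients are the real parts of the Taylor coefficients of a local holomorphic
  extension, which lives on a full disc even about an end point of S.\<close>

lemma real_analytic_onI:
  assumes "\<And>x. x \<in> S \<Longrightarrow> \<exists>r>0. \<exists>H. H holomorphic_on ball (complex_of_real x) r
    \<and> (\<forall>y\<in>S. \<bar>y - x\<bar> < r \<longrightarrow> H (of_real y) = of_real (f y))"
  shows "real_analytic_on f S"
  unfolding real_analytic_on_def
proof
  fix x assume "x \<in> S"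
  then obtain r H where r: "r > 0" and H: "H holomorphic_on ball (complex_of_real x) r"
    and Hf: "\<And>y. y \<in> S \<Longrightarrow> \<bar>y - x\<bar> < r \<Longrightarrow> H (of_real y) = of_real (f y)" using assms by blast
  let ?a = "\<lambda>n. (deriv ^^ n) H (of_real x) / fact n"
  have "(\<lambda>n. Re (?a n) * (y - x) ^ n) sums f y" if y: "y \<in> S" "\<bar>y - x\<bar> < r" for y
  proof -
    have "complex_of_real y \<in> ball (of_real x) r"
      using y by (simp add: dist_real_def abs_minus_commute)
    then have "(\<lambda>n. ?a n * (of_real y - of_real x) ^ n) sums H (of_real y)"
      by (rule holomorphic_power_series[OF H])
    then have "(\<lambda>n. Re (?a n * (of_real y - of_real x) ^ n)) sums Re (H (of_real y))"
      by (rule sums_Re)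
    moreover have "Re (?a n * (of_real y - of_real x) ^ n) = Re (?a n) * (y - x) ^ n" for n
    proof -
      have "(complex_of_real y - of_real x) ^ n = of_real ((y - x) ^ n)" by simp
      moreover have "Re (A * complex_of_real b) = Re A * b" for A b by simp
      ultimately show ?thesis by (simp only:)
    qed
    ultimately show ?thesis using Hf[OF y] by simp
  qed
  then show "\<exists>r>0. \<exists>a. \<forall>y\<in>S. \<bar>y - x\<bar> < r \<longrightarrow> (\<lambda>n. a n * (y - x) ^ n) sums f y"
    by (intro exI[of _ r] conjI exI[of _ "\<lambda>n. Re (?a n)"] r ballI impI)
qed

text \<open>Analytic inverse function theorem. A primitive of \<open>g\<close>, normalised at x0,
  agrees with \<Phi> on the real segment because the difference has derivative zero there. Its
  derivative at x0 is nonzero, so it is locally injective and has a holomorphic inverse on an open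
  image.\<close>

lemma holomorphic_inverse_of_real:
  fixes g :: "complex \<Rightarrow> complex" and \<Phi> gr :: "real \<Rightarrow> real"
  assumes "r > 0" and hol: "g holomorphic_on ball (of_real x0) r"
    and g: "\<And>x. \<bar>x - x0\<bar> < r \<Longrightarrow> g (of_real x) = of_real (gr x)"
    and der: "\<And>x. \<bar>x - x0\<bar> < r \<Longrightarrow> (\<Phi> has_real_derivative gr x) (at x)"
    and nz: "gr x0 \<noteq> 0"
  obtains P e \<delta> where "e > 0" "\<delta> > 0" "P holomorphic_on ball (of_real (\<Phi> x0)) e"
    "\<And>x. \<bar>x - x0\<bar> < \<delta> \<Longrightarrow> P (of_real (\<Phi> x)) = of_real x"
proof -
  let ?z0 = "complex_of_real x0"
  obtain G0 where "\<And>z. z \<in> ball ?z0 r \<Longrightarrow> (G0 has_field_derivative g z) (at z within ball ?z0 r)"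
    using holomorphic_convex_primitive'[OF convex_ball open_ball hol] by blast
  then have G0: "(G0 has_field_derivative g z) (at z)" if "z \<in> ball ?z0 r" for z
    using that at_within_open[OF that open_ball] by metis
  define G where "G z = G0 z + (of_real (\<Phi> x0) - G0 ?z0)" for z
  have G: "(G has_field_derivative g z) (at z)" if "z \<in> ball ?z0 r" for z
    unfolding G_def using G0[OF that] by (auto intro!: derivative_eq_intros)
  have holG: "G holomorphic_on ball ?z0 r"
    unfolding holomorphic_on_open[OF open_ball] using G by blast
  have Gr: "G (of_real x) = of_real (\<Phi> x)" if x: "\<bar>x - x0\<bar> < r" for x
  proof -
    have in_ball: "complex_of_real y \<in> ball ?z0 r" if "y \<in> ball x0 r" for y
      using that by (simp add: dist_real_def)
    have hv: "((\<lambda>y. G (of_real y) - of_real (\<Phi> y)) has_vector_derivative 0) (at y within ball x0 r)"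
      if y: "y \<in> ball x0 r" for y
    proof -
      from y have y': "\<bar>y - x0\<bar> < r" by (simp add: dist_real_def abs_minus_commute)
      have 1: "((\<lambda>y. G (of_real y)) has_vector_derivative g (of_real y)) (at y)"
        using G[OF in_ball[OF y]] by (rule has_vector_derivative_real_field)
      have 2: "((\<lambda>y. complex_of_real (\<Phi> y)) has_vector_derivative of_real (gr y)) (at y)"
        using der[OF y'] unfolding has_real_derivative_iff_has_vector_derivative
        by (rule bounded_linear.has_vector_derivative[OF bounded_linear_of_real])
      have "((\<lambda>y. G (of_real y) - of_real (\<Phi> y)) has_vector_derivative 0) (at y)"
        using has_vector_derivative_diff[OF 1 2] g[OF y'] by simp
      then show ?thesis
        by (rule has_vector_derivative_at_within)
    qed
    obtain C where C: "\<And>y. y \<in> ball x0 r \<Longrightarrow> G (of_real y) - of_real (\<Phi> y) = C"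
      using has_vector_derivative_zero_constant[OF convex_ball hv] by blast
    have "C = 0" using C[of x0] \<open>r > 0\<close> by (simp add: G_def)
    then show ?thesis using C[of x] x by (simp add: dist_real_def abs_minus_commute)
  qed
  have "deriv G ?z0 \<noteq> 0"
    using DERIV_imp_deriv[OF G[of ?z0]] \<open>r > 0\<close> g[of x0] nz by simp
  then obtain r2 where r2: "r2 > 0" "ball ?z0 r2 \<subseteq> ball ?z0 r" "inj_on G (ball ?z0 r2)"
    using has_complex_derivative_locally_injective[OF holG, of ?z0] \<open>r > 0\<close>
    by (metis centre_in_ball open_ball)
  have holG2: "G holomorphic_on ball ?z0 r2" using holG r2(2) by (rule holomorphic_on_subset)
  obtain P where P1: "P holomorphic_on G ` ball ?z0 r2" and P2: "\<And>z. z \<in> ball ?z0 r2 \<Longrightarrow> P (G z) = z"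
  proof (rule holomorphic_has_inverse[OF holG2 open_ball r2(3)])
    fix P assume "P holomorphic_on G ` ball ?z0 r2" "\<And>z. z \<in> ball ?z0 r2 \<Longrightarrow> P (G z) = z"
    then show thesis by (rule that)
  qed
  have "open (G ` ball ?z0 r2)" by (rule open_mapping_thm3[OF holG2 open_ball r2(3)])
  moreover have "of_real (\<Phi> x0) \<in> G ` ball ?z0 r2"
    using Gr[of x0] \<open>r > 0\<close> r2(1) by (intro image_eqI[of _ _ ?z0]) auto
  ultimately obtain e where e: "e > 0" "ball (of_real (\<Phi> x0)) e \<subseteq> G ` ball ?z0 r2"
    by (meson openE)
  have "P (of_real (\<Phi> x)) = of_real x" if "\<bar>x - x0\<bar> < r2" for x
  proof -
    have z: "complex_of_real x \<in> ball ?z0 r2"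
      using that by (simp add: dist_real_def abs_minus_commute)
    then have "complex_of_real x \<in> ball ?z0 r" using r2(2) by blast
    then have "\<bar>x - x0\<bar> < r" by (simp add: dist_real_def abs_minus_commute)
    then show ?thesis using P2[OF z] Gr by simp
  qed
  then show thesis
    using e r2(1) holomorphic_on_subset[OF P1 e(2)] by (intro that[of e r2 P])
qed

lemma holomorphic_efun: "(\<lambda>z. efun (W::complex) (z\<^sup>2)) holomorphic_on S"
proof -
  have "(\<lambda>z. efun W (z\<^sup>2)) field_differentiable (at z)" for z
  proof -
    obtain D where D: "(efun W has_field_derivative D) (at (z\<^sup>2))"
      by (rule efun_has_derivative_t)
    have "((\<lambda>z. efun W (z\<^sup>2)) has_field_derivative D * (2 * z)) (at z)"
      by (rule DERIV_chain2[where f = "efun W" and g = "\<lambda>z. z\<^sup>2", OF D])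
         (auto intro!: derivative_eq_intros)
    then show ?thesis by (auto simp: field_differentiable_def)
  qed
  then show ?thesis
    by (auto simp: holomorphic_on_def field_differentiable_at_within)
qed

lemma real_analytic_on_hsol:
  assumes c: "c > 0"
  shows "real_analytic_on (hsol c) {0..c}"
proof (rule real_analytic_onI)
  fix s assume s: "s \<in> {0..c}"
  define W where "W = Wpar c"
  note W = W[OF c W_def]
  define x0 where "x0 = sig c s"
  have x0: "-1 \<le> x0" "x0 \<le> 1" "Phi W x0 = c / 2 - s"
    using sig[OF c W_def s] by (simp_all add: x0_def)
  define E where "E z = efun (complex_of_real W) (z\<^sup>2)" for z
  have holE: "E holomorphic_on UNIV" unfolding E_def[abs_def] by (rule holomorphic_efun)
  have Er: "E (of_real x) = of_real (efun W (x\<^sup>2))" for x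
    by (simp add: E_def of_real_efun)
  have pos: "efun W (x\<^sup>2) > 0" for x using W by (intro efun_pos) auto
  \<comment> \<open>On a disc with positive real part, E avoids the branch cut of
    \<open>csqrt\<close>.\<close>
  have "open {z. Re (E z) > 0}"
    by (intro open_Collect_less continuous_intros holomorphic_on_imp_continuous_on[OF holE])
  moreover have "complex_of_real x0 \<in> {z. Re (E z) > 0}" by (simp add: Er pos)
  ultimately obtain r0 where r0: "r0 > 0" "ball (complex_of_real x0) r0 \<subseteq> {z. Re (E z) > 0}"
    by (meson openE)
  \<comment> \<open>Radius at most 1 and |x0| <= 1 keep the real points inside (-2, 2), where
    \<open>Phi\<close> has the stated derivative.\<close>
  define r where "r = min r0 1"
  have r: "r > 0" using r0 by (simp add: r_def)
  have near: "-2 < x \<and> x < 2" if "\<bar>x - x0\<bar> < r" for x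
    using that x0 by (auto simp: r_def)
  define g where "g z = 2 * of_real W / csqrt (E z)" for z
  have E_ball: "E z \<notin> \<real>\<^sub>\<le>\<^sub>0" if "z \<in> ball (complex_of_real x0) r" for z
  proof -
    have "z \<in> ball (complex_of_real x0) r0" using that by (auto simp: r_def)
    then have "Re (E z) > 0" using r0(2) by blast
    then show ?thesis by (auto simp: complex_nonpos_Reals_iff)
  qed
  have "(\<lambda>z. csqrt (E z)) holomorphic_on ball (of_real x0) r"
  proof -
    have "E ` ball (of_real x0) r \<subseteq> - \<real>\<^sub>\<le>\<^sub>0" using E_ball by blast
    then show ?thesis
      using holomorphic_on_compose_gen[of E "ball (of_real x0) r" csqrt "- \<real>\<^sub>\<le>\<^sub>0"]
        holomorphic_on_subset[OF holE] holomorphic_on_csqrt by (simp add: o_def)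
  qed
  then have holg: "g holomorphic_on ball (of_real x0) r"
    unfolding g_def
  proof (intro holomorphic_on_divide holomorphic_on_const)
    fix z assume "z \<in> ball (complex_of_real x0) r"
    from E_ball[OF this] have "E z \<noteq> 0" by auto
    then show "csqrt (E z) \<noteq> 0" by simp
  qed
  have gr: "g (of_real x) = of_real (2 * W * efun W (x\<^sup>2) powr (- 1 / 2))" for x
  proof -
    have "csqrt (of_real (efun W (x\<^sup>2))) = of_real (sqrt (efun W (x\<^sup>2)))"
      using pos[of x] by (simp add: of_real_sqrt[symmetric] less_imp_le)
    moreover have "efun W (x\<^sup>2) powr (- 1 / 2) = 1 / sqrt (efun W (x\<^sup>2))"
      using pos[of x] by (simp add: powr_minus powr_half_sqrt inverse_eq_divide)
    ultimately show ?thesis by (simp add: g_def Er)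
  qed
  have der: "(Phi W has_real_derivative 2 * W * efun W (x\<^sup>2) powr (- 1 / 2)) (at x)" if "\<bar>x - x0\<bar> < r" for x
    using near[OF that] W by (intro Phi_has_derivative) auto
  have nz: "2 * W * efun W (x0\<^sup>2) powr (- 1 / 2) \<noteq> 0" using pos[of x0] W(1) by simp
  obtain P e \<delta> where e: "e > 0" and \<delta>: "\<delta> > 0"
    and P: "P holomorphic_on ball (of_real (Phi W x0)) e" "\<And>x. \<bar>x - x0\<bar> < \<delta> \<Longrightarrow> P (of_real (Phi W x)) = of_real x"
  proof (rule holomorphic_inverse_of_real[OF r holg gr der nz])
    fix P e \<delta> assume "e > (0::real)" "\<delta> > (0::real)" "P holomorphic_on ball (of_real (Phi W x0)) e"
      "\<And>x. \<bar>x - x0\<bar> < \<delta> \<Longrightarrow> P (of_real (Phi W x)) = of_real x"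
    then show thesis by (rule that)
  qed
  \<comment> \<open>\<open>P\<close> inverts \<open>Phi W\<close> only near x0; continuity of
    \<open>sig c\<close> guarantees that points near s are sent there.\<close>
  have "isCont (sig c) s" using sig_has_derivative[OF c W_def s] by (rule DERIV_isCont)
  then obtain d where d: "d > 0" "\<And>y. \<bar>y - s\<bar> < d \<Longrightarrow> \<bar>sig c y - x0\<bar> < \<delta>"
    using \<delta> unfolding continuous_at_eps_delta x0_def by (auto simp: dist_real_def)
  define H where "H z = of_real (sqrt (4 * W / c)) * exp (- of_real W * (P (of_real (c / 2) - z))\<^sup>2)" for z
  show "\<exists>r>0. \<exists>H. H holomorphic_on ball (complex_of_real s) r
    \<and> (\<forall>y\<in>{0..c}. \<bar>y - s\<bar> < r \<longrightarrow> H (of_real y) = of_real (hsol c y))"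
  proof (intro exI conjI ballI impI)
    show "min d e > 0" using d e by simp
    have "(\<lambda>z. P (of_real (c / 2) - z)) holomorphic_on ball (of_real s) (min d e)"
    proof -
      have "(\<lambda>z. complex_of_real (c / 2) - z) ` ball (of_real s) (min d e) \<subseteq> ball (of_real (Phi W x0)) e"
        
      proof -
        have "dist (a - x) (a - z) = dist x z" for a x z :: complex
          by (simp add: dist_norm norm_minus_commute)
        then show ?thesis unfolding x0(3) by (auto simp: of_real_diff simp del: of_real_divide)
      qed
      moreover have "(\<lambda>z. complex_of_real (c / 2) - z) holomorphic_on ball (of_real s) (min d e)"
        by (intro holomorphic_intros)
      ultimately have "(P \<circ> (\<lambda>z. complex_of_real (c / 2) - z)) holomorphic_on ball (of_real s) (min d e)"
        using P(1) by (intro holomorphic_on_compose_gen)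
      then show ?thesis by (simp only: o_def)
    qed
    then show "H holomorphic_on ball (of_real s) (min d e)"
      unfolding H_def by (intro holomorphic_intros)
    fix y assume y: "y \<in> {0..c}" "\<bar>y - s\<bar> < min d e"
    have "P (of_real (c / 2) - of_real y) = of_real (sig c y)"
      using P(2)[of "sig c y"] d(2)[of y] y(2) sig(3)[OF c W_def y(1)] by simp
    then show "H (of_real y) = of_real (hsol c y)"
      by (simp add: H_def hsol_def W_def exp_of_real[symmetric])
  qed
qed

section \<open>Uniqueness of the positive solution\<close>

lemma has_real_derivative_withinD_at:
  fixes a b :: real
  assumes "(f has_real_derivative D) (at s within {a..b})" "a < s" "s < b"
  shows "(f has_real_derivative D) (at s)"
  using assms at_within_interior[of s "{a..b}"] by (simp add: interior_atLeastAtMost_real)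

lemma mono_of_derivative_within:
  fixes f :: "real \<Rightarrow> real"
  assumes der: "\<And>s. s \<in> {a..b} \<Longrightarrow> (f has_real_derivative f' s) (at s within {a..b})"
    and nonneg: "\<And>s. s \<in> {a..b} \<Longrightarrow> f' s \<ge> 0" and "a \<le> x" "x \<le> y" "y \<le> b"
  shows "f x \<le> f y"
proof (rule DERIV_nonneg_imp_increasing_open[OF \<open>x \<le> y\<close>])
  fix s assume s: "x < s" "s < y"
  show "\<exists>D. (f has_real_derivative D) (at s) \<and> D \<ge> 0"
    using has_real_derivative_withinD_at[OF der[of s]] nonneg[of s] s assms
    by (intro exI[of _ "f' s"]) auto
next
  have "continuous_on {a..b} f"
    using der by (rule DERIV_continuous_on)
  then show "continuous_on {x..y} f" by (rule continuous_on_subset) (use assms in auto)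
qed

lemma sdot_eq:
  assumes "c > 0" "s \<in> {0..c}" "(y has_real_derivative D) (at s within {0..c})"
  shows "sdot c y s = D"
  unfolding sdot_def
  using assms vector_derivative_within_closed_interval[of 0 c s y D]
  by (simp add: has_real_derivative_iff_has_vector_derivative)

lemma sdot_has_derivative:
  assumes "c > 0" "s \<in> {0..c}" "y differentiable_on {0..c}"
  shows "(y has_real_derivative sdot c y s) (at s within {0..c})"
proof -
  obtain D where "(y has_real_derivative D) (at s within {0..c})"
    using assms(2,3) unfolding differentiable_on_def real_differentiable_def by blast
  then show ?thesis using sdot_eq[OF assms(1,2)] by simp
qed

text \<open>The difference \<open>d\<close> of two positive solutions satisfies \<open>d'' = q * d\<close> with \<open>q \<ge> 0\<close>, so \<open>d * d'\<close> is
  nondecreasing, while the boundary conditions make it \<open>\<ge> 0\<close> at \<open>0\<close> and \<open>\<le> 0\<close> at \<open>c\<close>.\<close>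

lemma bvp_positive_unique:
  assumes c: "c > 0" and y: "solves_bvp c y" "\<And>s. s \<in> {0..c} \<Longrightarrow> y s > 0"
    and z: "solves_bvp c z" "\<And>s. s \<in> {0..c} \<Longrightarrow> z s > 0" and s: "s \<in> {0..c}"
  shows "y s = z s"
proof -
  let ?I = "{0..c}"
  define d where "d s = y s - z s" for s
  define d' where "d' s = sdot c y s - sdot c z s" for s
  define q where "q s = 1 + 2 / (c * (y s * z s))" for s
  have dd: "(d has_real_derivative d' s) (at s within ?I)" if "s \<in> ?I" for s
    unfolding d_def[abs_def] d'_def
    using y(1) z(1) by (intro DERIV_diff sdot_has_derivative c that) (auto simp: solves_bvp_def)
  have d'd: "(d' has_real_derivative q s * d s) (at s within ?I)" if "s \<in> ?I" for s
  proof -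
    have "(d' has_real_derivative (- 2 / (c * y s) + y s) - (- 2 / (c * z s) + z s)) (at s within ?I)"
      unfolding d'_def[abs_def] using y(1) z(1) that by (intro DERIV_diff) (auto simp: solves_bvp_def)
    also have "(- 2 / (c * y s) + y s) - (- 2 / (c * z s) + z s) = q s * d s"
      using y(2)[OF that] z(2)[OF that] c by (simp add: q_def d_def field_simps)
    finally show ?thesis .
  qed
  have q: "q s \<ge> 0" if "s \<in> ?I" for s
    unfolding q_def using y(2)[OF that] z(2)[OF that] c by (simp add: add_nonneg_nonneg)
  have e: "d a * d' a \<le> d b * d' b" if "0 \<le> a" "a \<le> b" "b \<le> c" for a b
  proof (rule mono_of_derivative_within[where f = "\<lambda>s. d s * d' s" and f' = "\<lambda>s. d' s * d' s + q s * d s * d s"])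
    fix s assume s: "s \<in> ?I"
    show "((\<lambda>s. d s * d' s) has_real_derivative d' s * d' s + q s * d s * d s) (at s within ?I)"
      using DERIV_mult[OF dd[OF s] d'd[OF s]] .
    show "d' s * d' s + q s * d s * d s \<ge> 0" using q[OF s] by (simp add: mult.assoc)
  qed (use that in auto)
  have b0: "d' 0 = d 0" "d' c = - d c"
    using y(1) z(1) by (auto simp: d_def d'_def solves_bvp_def)
  have zero: "d s * d' s = 0" if "s \<in> ?I" for s
  proof -
    have "d 0 * d 0 \<le> d s * d' s" using e[of 0 s] that b0 by simp
    moreover have "d s * d' s \<le> - (d c * d c)" using e[of s c] that b0 by simp
    ultimately show ?thesis using zero_le_square[of "d 0"] zero_le_square[of "d c"] by linarith
  qed
  have "((\<lambda>s. d s * d s) has_real_derivative 0) (at s within ?I)" if "s \<in> ?I" for s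
    using zero[OF that] by (intro DERIV_cong[OF DERIV_mult[OF dd[OF that] dd[OF that]]]) (simp add: mult.commute)
  then obtain C where C: "\<And>s. s \<in> ?I \<Longrightarrow> d s * d s = C"
    using has_field_derivative_zero_constant[of ?I "\<lambda>s. d s * d s"] by auto
  have "d 0 * d 0 = 0" using zero[of 0] b0 c by simp
  then have "C = 0" using C[of 0] c by simp
  then show ?thesis using C[OF s] by (simp add: d_def)
qed

section \<open>The functional and the integral equation for the solution\<close>

context
  fixes c :: real
  assumes c: "c > 0"
begin

lemmas hsol_within = hsol_has_derivative[OF c refl, THEN has_field_derivative_at_within]
lemmas hsol'_within = hsol'_has_derivative[OF c refl, THEN has_field_derivative_at_within]

lemma sdot_hsol: "s \<in> {0..c} \<Longrightarrow> sdot c (hsol c) s = hsol' c s"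
  by (rule sdot_eq[OF c _ hsol_within])

lemma solves_bvp_hsol: "solves_bvp c (hsol c)"
  unfolding solves_bvp_def
proof (intro conjI ballI)
  show "hsol c differentiable_on {0..c}"
    using hsol_within unfolding differentiable_on_def real_differentiable_def by blast
  fix s assume s: "s \<in> {0..c}"
  show "hsol c s \<noteq> 0" using hsol_pos[OF c refl, of s] by simp
  have "(hsol' c has_real_derivative - 2 / (c * hsol c s) + hsol c s) (at s within {0..c})"
    using hsol'_within[OF s] by simp
  then show "(sdot c (hsol c) has_real_derivative - 2 / (c * hsol c s) + hsol c s) (at s within {0..c})"
    by (rule has_field_derivative_transform_within[OF _ zero_less_one s]) (simp add: sdot_hsol)
qed (use hsol_boundary[OF c refl] c in \<open>simp_all add: sdot_hsol\<close>)

lemma unique_positive_solution_hsol: "unique_positive_solution c (hsol c)"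
  unfolding unique_positive_solution_def
  using solves_bvp_hsol hsol_pos[OF c refl] bvp_positive_unique[OF c] by blast

lemma continuous_on_hsol: "continuous_on {0..c} (hsol c)"
  by (rule DERIV_continuous_on) (rule hsol_within)

text \<open>By the equation, h h'' = h^2 - 2 / c, so \<open>Q\<close> is a primitive of (h + h')^2 /
  2. The boundary conditions give Q(c) = 1 and Q(0) = h(0)^2, which cancels the boundary term of the
  functional up to the constant 1.\<close>

lemma bvp_functional_hsol: "bvp_functional c (hsol c) = F1 c - 1"
proof -
  define Q where "Q s = 1 / 2 * (hsol c s * hsol' c s) + 1 / 2 * (hsol c s * hsol c s) + s / c" for s
  have "((\<lambda>s. 1 / 2 * (hsol c s + hsol' c s)\<^sup>2) has_integral Q c - Q 0) {0..c}"
  proof (rule fundamental_theorem_of_calculus)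
    fix s assume s: "s \<in> {0..c}"
    have h: "hsol c s > 0" by (rule hsol_pos[OF c refl])
    have "(Q has_real_derivative 1 / 2 * (hsol' c s * hsol' c s + (hsol c s - 2 / (c * hsol c s)) * hsol c s)
       + 1 / 2 * (hsol' c s * hsol c s + hsol' c s * hsol c s) + 1 / c) (at s within {0..c})"
      unfolding Q_def[abs_def]
      by (intro DERIV_add DERIV_cmult DERIV_mult hsol_within hsol'_within s DERIV_cdivide DERIV_ident)
    also have "1 / 2 * (hsol' c s * hsol' c s + (hsol c s - 2 / (c * hsol c s)) * hsol c s)
       + 1 / 2 * (hsol' c s * hsol c s + hsol' c s * hsol c s) + 1 / c = 1 / 2 * (hsol c s + hsol' c s)\<^sup>2"
      using h c by (simp add: power2_eq_square field_simps)
    finally show "(Q has_vector_derivative 1 / 2 * (hsol c s + hsol' c s)\<^sup>2) (at s within {0..c})"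
      by (simp only: has_real_derivative_iff_has_vector_derivative)
  qed (use c in simp)
  moreover have "Q c - Q 0 = 1 - (hsol c 0)\<^sup>2"
    using hsol_boundary[OF c refl] c by (simp add: Q_def power2_eq_square)
  ultimately have I1: "((\<lambda>s. 1 / 2 * (hsol c s + hsol' c s)\<^sup>2) has_integral 1 - (hsol c 0)\<^sup>2) {0..c}" by simp
  have "((\<lambda>s. 2 / c * ln (hsol c s) - 1 / 2 * (hsol c s + hsol' c s)\<^sup>2) has_integral
      2 / c * (c / 2 * F1 c) - (1 - (hsol c 0)\<^sup>2)) {0..c}"
    by (intro has_integral_diff has_integral_mult_right integral_ln_hsol[OF c refl] I1)
  then have "integral {0..c} (\<lambda>s. 2 / c * ln (hsol c s) - 1 / 2 * (hsol c s + hsol' c s)\<^sup>2) = F1 c - (1 - (hsol c 0)\<^sup>2)"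
    using c by (simp add: integral_unique)
  moreover have "integral {0..c} (\<lambda>s. 2 / c * ln (hsol c s) - 1 / 2 * (hsol c s + sdot c (hsol c) s)\<^sup>2)
     = integral {0..c} (\<lambda>s. 2 / c * ln (hsol c s) - 1 / 2 * (hsol c s + hsol' c s)\<^sup>2)"
    by (intro integral_cong) (simp add: sdot_hsol)
  ultimately show ?thesis by (simp add: bvp_functional_def)
qed

text \<open>With \<open>h = hsol c\<close>, the parts \<open>msol s\<close> and \<open>psol s\<close> are the contributions of \<open>t \<le> s\<close> and \<open>t \<ge> s\<close> to
  the integral equation \<open>h s = (\<integral> exp (- \<bar>s - t\<bar>) / (c * h t) dt)\<close>.\<close>

definition psol :: "real \<Rightarrow> real" where "psol s = (hsol c s + hsol' c s) / 2"

definition msol :: "real \<Rightarrow> real" where "msol s = (hsol c s - hsol' c s) / 2"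

lemma psol_add_msol: "psol s + msol s = hsol c s"
  by (simp add: psol_def msol_def add_divide_distrib[symmetric])

lemma psol_has_derivative:
  assumes "s \<in> {0..c}"
  shows "(psol has_real_derivative psol s - 1 / (c * hsol c s)) (at s within {0..c})"
proof -
  have "(psol has_real_derivative (hsol' c s + (hsol c s - 2 / (c * hsol c s))) / 2) (at s within {0..c})"
    unfolding psol_def[abs_def] by (intro DERIV_cdivide DERIV_add hsol_within hsol'_within assms)
  then show ?thesis by (rule DERIV_cong) (simp add: psol_def field_simps)
qed

lemma msol_has_derivative:
  assumes "s \<in> {0..c}"
  shows "(msol has_real_derivative 1 / (c * hsol c s) - msol s) (at s within {0..c})"
proof -
  have "(msol has_real_derivative (hsol' c s - (hsol c s - 2 / (c * hsol c s))) / 2) (at s within {0..c})"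
    unfolding msol_def[abs_def] by (intro DERIV_cdivide DERIV_diff hsol_within hsol'_within assms)
  then show ?thesis by (rule DERIV_cong) (simp add: msol_def field_simps)
qed

lemma exp_msol_has_derivative:
  assumes "s \<in> {0..c}"
  shows "((\<lambda>t. exp (t - a) * msol t) has_real_derivative exp (s - a) / (c * hsol c s)) (at s within {0..c})"
proof -
  have "((\<lambda>t. exp (t - a)) has_real_derivative exp (s - a)) (at s within {0..c})"
    by (auto intro!: derivative_eq_intros)
  from DERIV_mult[OF this msol_has_derivative[OF assms]] show ?thesis
    by (rule DERIV_cong) (simp add: algebra_simps)
qed

lemma exp_psol_has_derivative:
  assumes "s \<in> {0..c}"
  shows "((\<lambda>t. - (exp (a - t) * psol t)) has_real_derivative exp (a - s) / (c * hsol c s)) (at s within {0..c})"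
proof -
  have "((\<lambda>t. exp (a - t)) has_real_derivative - exp (a - s)) (at s within {0..c})"
    by (auto intro!: derivative_eq_intros)
  from DERIV_minus[OF DERIV_mult[OF this psol_has_derivative[OF assms]]] show ?thesis
    by (rule DERIV_cong) (simp add: algebra_simps)
qed

text \<open>The boundary conditions in integral form: nothing lies to the left of 0 or to the right
  of c.\<close>

lemma msol_0: "msol 0 = 0" and psol_c: "psol c = 0"
  using hsol_boundary[OF c refl] by (simp_all add: msol_def psol_def)

lemma hsol_integral_left:
  assumes "s \<in> {0..c}"
  shows "((\<lambda>t. exp (t - s) / (c * hsol c t)) has_integral msol s) {0..s}"
proof -
  have "((\<lambda>t. exp (t - s) / (c * hsol c t)) has_integral exp (s - s) * msol s - exp (0 - s) * msol 0) {0..s}"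
  proof (rule fundamental_theorem_of_calculus)
    fix t assume t: "t \<in> {0..s}"
    show "((\<lambda>t. exp (t - s) * msol t) has_vector_derivative exp (t - s) / (c * hsol c t)) (at t within {0..s})"
      unfolding has_real_derivative_iff_has_vector_derivative[symmetric]
      by (rule has_field_derivative_subset[OF exp_msol_has_derivative]) (use t assms in auto)
  qed (use assms in auto)
  then show ?thesis by (simp add: msol_0)
qed

lemma hsol_integral_right:
  assumes "s \<in> {0..c}"
  shows "((\<lambda>t. exp (s - t) / (c * hsol c t)) has_integral psol s) {s..c}"
proof -
  have "((\<lambda>t. exp (s - t) / (c * hsol c t)) has_integral - (exp (s - c) * psol c) - - (exp (s - s) * psol s)) {s..c}"
  proof (rule fundamental_theorem_of_calculus)
    fix t assume t: "t \<in> {s..c}"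
    show "((\<lambda>t. - (exp (s - t) * psol t)) has_vector_derivative exp (s - t) / (c * hsol c t)) (at t within {s..c})"
      unfolding has_real_derivative_iff_has_vector_derivative[symmetric]
      by (rule has_field_derivative_subset[OF exp_psol_has_derivative]) (use t assms in auto)
  qed (use assms in auto)
  then show ?thesis by (simp add: psol_c)
qed

lemma psol_nonneg: "s \<in> {0..c} \<Longrightarrow> psol s \<ge> 0" and msol_nonneg: "s \<in> {0..c} \<Longrightarrow> msol s \<ge> 0"
  using has_integral_nonneg[OF hsol_integral_right, of s] has_integral_nonneg[OF hsol_integral_left, of s]
    c hsol_pos[OF c refl] by (auto simp: less_imp_le)

text \<open>Equivalently, the kernel exp (- |s - t|) / (c h(s) h(t)) integrates to 1 in t for every
  s. This is the doubly stochastic scaling that makes the weights 1 / h asymptotically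
  optimal.\<close>

lemma hsol_integral_eq:
  assumes "s \<in> {0..c}"
  shows "((\<lambda>t. exp (- \<bar>s - t\<bar>) / (c * hsol c t)) has_integral hsol c s) {0..c}"
proof -
  have "((\<lambda>t. exp (- \<bar>s - t\<bar>) / (c * hsol c t)) has_integral msol s) {0..s}"
    by (rule has_integral_eq[OF _ hsol_integral_left[OF assms]]) simp
  moreover have "((\<lambda>t. exp (- \<bar>s - t\<bar>) / (c * hsol c t)) has_integral psol s) {s..c}"
    by (rule has_integral_eq[OF _ hsol_integral_right[OF assms]]) simp
  ultimately have "((\<lambda>t. exp (- \<bar>s - t\<bar>) / (c * hsol c t)) has_integral msol s + psol s) {0..c}"
    using assms by (intro has_integral_combine[of 0 s c]) auto
  then show ?thesis using psol_add_msol[of s] by (simp add: add.commute)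
qed

end

lemma bvp_functional_has_derivative:
  assumes "c > 0"
  shows "((\<lambda>c. bvp_functional c (hsol c)) has_real_derivative - f1 c) (at c)"
proof (rule has_field_derivative_transform_within_open[of "\<lambda>c. F1 c - 1" _ _ "{0<..}"])
  show "((\<lambda>c. F1 c - 1) has_real_derivative - f1 c) (at c)"
    using DERIV_diff[OF F1_has_derivative[OF assms] DERIV_const] by simp
qed (use assms bvp_functional_hsol in auto)

section \<open>The limit of the free energy\<close>

text \<open>Uniformity in s is essential: the estimate is applied to all row sums of the kernel at
  once, one for each site.\<close>

lemma riemann_sum_uniform:
  fixes G :: "real \<Rightarrow> real \<Rightarrow> real"
  assumes cont: "continuous_on ({0..c} \<times> {0..c}) (\<lambda>(s, t). G s t)" and c: "c > 0" and \<eta>: "\<eta> > 0"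
  shows "\<forall>\<^sub>F N in sequentially. \<forall>s\<in>{0..c}.
    \<bar>c / real N * (\<Sum>k\<in>{1..N}. G s (c * real k / real N)) - integral {0..c} (G s)\<bar> \<le> \<eta>"
proof -
  have "uniformly_continuous_on ({0..c} \<times> {0..c}) (\<lambda>(s, t). G s t)"
    by (intro compact_uniformly_continuous cont compact_Times compact_Icc)
  then obtain \<delta> where \<delta>: "\<delta> > 0"
    and uc: "\<And>x y. x \<in> {0..c} \<times> {0..c} \<Longrightarrow> y \<in> {0..c} \<times> {0..c} \<Longrightarrow> dist y x < \<delta> \<Longrightarrow>
      dist ((\<lambda>(s, t). G s t) y) ((\<lambda>(s, t). G s t) x) < \<eta> / c"
    unfolding uniformly_continuous_on_def using divide_pos_pos[OF \<eta> c] by meson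
  have unif: "\<bar>G s t - G s t'\<bar> \<le> \<eta> / c" if "s \<in> {0..c}" "t \<in> {0..c}" "t' \<in> {0..c}" "\<bar>t - t'\<bar> < \<delta>" for s t t'
    using uc[of "(s, t')" "(s, t)"] that by (auto simp: dist_Pair_Pair dist_real_def)
  obtain N0 :: nat where N0: "real N0 > c / \<delta>" using reals_Archimedean2 by blast
  show ?thesis
  proof (rule eventually_sequentiallyI[of "max N0 1"], intro ballI)
    fix N s assume N: "max N0 1 \<le> N" and s: "s \<in> {0..c}"
    have Npos: "real N > 0" using N by simp
    have step: "c / real N < \<delta>"
    proof -
      have "c / \<delta> < real N" using N0 N by linarith
      then show ?thesis using \<delta> Npos by (simp add: field_simps)
    qed
    have "continuous_on {0..c} (\<lambda>t. (\<lambda>(s, t). G s t) (s, t))"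
      by (rule continuous_on_compose2[OF cont]) (use s in \<open>auto intro!: continuous_intros\<close>)
    then have int: "G s integrable_on {a..b}" if "0 \<le> a" "b \<le> c" for a b
      using that by (intro integrable_continuous_real) (auto intro: continuous_on_subset)
    have "\<bar>c / real N * (\<Sum>k\<in>{1..n}. G s (c * real k / real N)) - integral {0..c * real n / real N} (G s)\<bar>
        \<le> real n * (c / real N * (\<eta> / c))" if "n \<le> N" for n
      using that
    proof (induction n)
      case (Suc n)
      define a where "a = c * real n / real N"
      define b where "b = c * real (Suc n) / real N"
      have "c * real (Suc n) \<le> c * real N" using c Suc.prems by (intro mult_left_mono) auto
      then have bc: "b \<le> c" using Npos by (simp add: b_def pos_divide_le_eq)
      have ab: "0 \<le> a" "a \<le> b" "b \<le> c" "b - a = c / real N"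
        using c Npos bc by (auto simp: a_def b_def divide_right_mono mult_left_mono diff_divide_distrib[symmetric] right_diff_distrib[symmetric])
      have "((\<lambda>t. G s t - G s b) has_integral (integral {a..b} (G s) - (b - a) * G s b)) {a..b}"
        using has_integral_const_real[of "G s b" a b] ab
        by (intro has_integral_diff integrable_integral int) auto
      then have I: "((\<lambda>t. G s t - G s b) has_integral (integral {a..b} (G s) - (b - a) * G s b)) (cbox a b)"
        by (simp add: cbox_interval)
      have "norm (integral {a..b} (G s) - (b - a) * G s b) \<le> \<eta> / c * measure lborel (cbox a b)"
      proof (rule has_integral_bound[OF _ I])
        show "0 \<le> \<eta> / c" using \<eta> c by simp
        fix t assume t: "t \<in> cbox a b"
        have "\<bar>t - b\<bar> < \<delta>" using t ab step by auto
        then show "norm (G s t - G s b) \<le> \<eta> / c" using unif[OF s, of t b] t ab by auto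
      qed
      then have 1: "\<bar>(b - a) * G s b - integral {a..b} (G s)\<bar> \<le> c / real N * (\<eta> / c)"
        using ab by (simp add: abs_minus_commute mult.commute)
      have 2: "integral {0..b} (G s) = integral {0..a} (G s) + integral {a..b} (G s)"
        using ab by (intro Henstock_Kurzweil_Integration.integral_combine[symmetric] int) auto
      have 3: "\<bar>c / real N * (\<Sum>k\<in>{1..n}. G s (c * real k / real N)) - integral {0..a} (G s)\<bar>
        \<le> real n * (c / real N * (\<eta> / c))" using Suc by (simp add: a_def)
      have 4: "c / real N * (\<Sum>k\<in>{1..Suc n}. G s (c * real k / real N))
        = c / real N * (\<Sum>k\<in>{1..n}. G s (c * real k / real N)) + (b - a) * G s b"
        unfolding ab(4) by (simp add: b_def distrib_left)
      have "\<bar>c / real N * (\<Sum>k\<in>{1..Suc n}. G s (c * real k / real N)) - integral {0..b} (G s)\<bar>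
        \<le> real n * (c / real N * (\<eta> / c)) + c / real N * (\<eta> / c)"
        using 1 3 unfolding 2 4 by linarith
      then show ?case by (simp add: b_def distrib_right)
    qed simp
    from this[of N] show "\<bar>c / real N * (\<Sum>k\<in>{1..N}. G s (c * real k / real N)) - integral {0..c} (G s)\<bar> \<le> \<eta>"
      using Npos c by simp
  qed
qed

lemma riemann_sum:
  fixes g :: "real \<Rightarrow> real"
  assumes cont: "continuous_on {0..c} g" and "c > 0"
  shows "(\<lambda>N. (\<Sum>k\<in>{1..N}. g (c * real k / real N)) / real N) \<longlonglongrightarrow> integral {0..c} g / c"
proof (rule tendstoI)
  fix \<eta> :: real assume \<eta>: "\<eta> > 0"
  have "continuous_on ({0..c} \<times> {0..c}) (\<lambda>(s, t). g t)"
    unfolding split_def by (rule continuous_on_compose2[OF cont]) (auto intro!: continuous_intros)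
  then have "\<forall>\<^sub>F N in sequentially. \<forall>s\<in>{0..c}.
    \<bar>c / real N * (\<Sum>k\<in>{1..N}. g (c * real k / real N)) - integral {0..c} g\<bar> \<le> \<eta> * c / 2"
    using riemann_sum_uniform[of c "\<lambda>s t. g t" "\<eta> * c / 2"] assms(2) \<eta> by simp
  then show "\<forall>\<^sub>F N in sequentially. dist ((\<Sum>k\<in>{1..N}. g (c * real k / real N)) / real N) (integral {0..c} g / c) < \<eta>"
  proof (rule eventually_mono)
    fix N assume *: "\<forall>s\<in>{0..c}. \<bar>c / real N * (\<Sum>k\<in>{1..N}. g (c * real k / real N)) - integral {0..c} g\<bar> \<le> \<eta> * c / 2"
    let ?S = "(\<Sum>k\<in>{1..N}. g (c * real k / real N)) / real N"
    have "\<bar>c * (?S - integral {0..c} g / c)\<bar> \<le> \<eta> * c / 2"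
      using *[rule_format, of 0] assms(2) by (simp add: right_diff_distrib)
    then have "c * \<bar>?S - integral {0..c} g / c\<bar> \<le> c * (\<eta> / 2)"
      using assms(2) by (simp add: abs_mult mult.commute)
    then have "\<bar>?S - integral {0..c} g / c\<bar> \<le> \<eta> / 2" using assms(2) by simp
    then show "dist ?S (integral {0..c} g / c) < \<eta>" using \<eta> by (simp add: dist_real_def)
  qed
qed

lemma sum_ln_hsol_tendsto:
  assumes "c > 0"
  shows "(\<lambda>N. 2 * ((\<Sum>k\<in>{1..N}. ln (hsol c (c * real k / real N))) / real N)) \<longlonglongrightarrow> F1 c"
proof -
  have "continuous_on {0..c} (\<lambda>s. ln (hsol c s))"
    using hsol_pos[OF assms refl] continuous_on_hsol[OF assms]
    by (intro continuous_on_ln) (auto simp: less_imp_neq[symmetric])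
  from tendsto_mult_left[OF riemann_sum[OF this assms], of 2]
  show ?thesis using integral_unique[OF integral_ln_hsol[OF assms refl]] assms by simp
qed

lemma hsol_lower_bound:
  assumes "c > 0"
  obtains b where "b > 0" "\<And>s. s \<in> {0..c} \<Longrightarrow> b \<le> hsol c s"
proof -
  obtain s0 where "s0 \<in> {0..c}" "\<And>s. s \<in> {0..c} \<Longrightarrow> hsol c s0 \<le> hsol c s"
    using continuous_attains_inf[of "{0..c}" "hsol c"] continuous_on_hsol[OF assms] assms by auto
  then show thesis using hsol_pos[OF assms refl, of s0] that by blast
qed

section \<open>Lower bound for the free energy at \<beta> = c / N\<close>

text \<open>\<open>partition_fun_ge\<close> with weights 1 / (N h) at the points c k / N. By
  \<open>hsol_integral_eq\<close> the row sums are close to h, so the quadratic form is close to 1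
  and the squared product contributes twice the sum of ln h.\<close>

lemma ln_partition_fun_eventually_ge:
  assumes c: "c > 0" and \<eta>: "\<eta> > 0"
  shows "\<forall>\<^sub>F N in sequentially. F1 c - \<eta> \<le> (ln (partition_fun N (c / real N)) - ln (fact N)) / real N"
proof -
  obtain b where b: "b > 0" "\<And>s. s \<in> {0..c} \<Longrightarrow> b \<le> hsol c s" by (rule hsol_lower_bound[OF c]) blast
  \<comment> \<open>Relative errors \<epsilon> in the row sums and the quadratic form cost at most 5
    \<epsilon> <= \<eta> / 2 per site: 2 ln (1 - \<epsilon>) >= -4 \<epsilon> and ln (1 +
    \<epsilon>) <= \<epsilon>. The other half of \<eta> is for the Riemann sum of ln h.\<close>
  define \<epsilon> where "\<epsilon> = min (1 / 2) (\<eta> / 10)"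
  have \<epsilon>: "0 < \<epsilon>" "\<epsilon> \<le> 1 / 2" "\<epsilon> \<le> \<eta> / 10" using \<eta> by (auto simp: \<epsilon>_def)
  define G where "G s t = exp (- \<bar>s - t\<bar>) / (c * hsol c t)" for s t
  have "continuous_on ({0..c} \<times> {0..c}) (\<lambda>(s, t). G s t)"
    unfolding G_def split_def
    using hsol_pos[OF c refl] c
    by (intro continuous_intros continuous_on_compose2[OF continuous_on_hsol[OF c] continuous_on_snd])
       (auto simp: less_imp_neq[symmetric])
  \<comment> \<open>The absolute tolerance \<epsilon> b is a relative one, since h >= b.\<close>
  from riemann_sum_uniform[OF this c mult_pos_pos[OF \<epsilon>(1) b(1)]]
  have ev1: "\<forall>\<^sub>F N in sequentially. \<forall>s\<in>{0..c}.
    \<bar>c / real N * (\<Sum>k\<in>{1..N}. G s (c * real k / real N)) - hsol c s\<bar> \<le> \<epsilon> * b"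
    using integral_unique[OF hsol_integral_eq[OF c]] by (simp add: G_def[abs_def])
  have ev2: "\<forall>\<^sub>F N in sequentially. F1 c - \<eta> / 2 < 2 * ((\<Sum>k\<in>{1..N}. ln (hsol c (c * real k / real N))) / real N)"
    by (rule order_tendstoD[OF sum_ln_hsol_tendsto[OF c]]) (use \<eta> in simp)
  show ?thesis
    using ev1 ev2 eventually_gt_at_top[of 0]
  proof eventually_elim
    case (elim N)
    have N: "real N > 0" using elim by simp
    define s where "s k = c * real k / real N" for k :: nat
    have s: "s k \<in> {0..c}" if "k \<in> {1..N}" for k using that c N by (auto simp: s_def field_simps)
    have h: "hsol c x > 0" for x by (rule hsol_pos[OF c refl])
    define w where "w k = 1 / (real N * hsol c (s k))" for k
    define g where "g i = (\<Sum>j\<in>{1..N}. exp (- (c / real N) * \<bar>real i - real j\<bar>) * w j)" for i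
    have g_eq: "g i = c / real N * (\<Sum>k\<in>{1..N}. G (s i) (c * real k / real N))" for i
      unfolding g_def sum_distrib_left
    proof (intro sum.cong refl)
      fix j
      have "(c / real N) * \<bar>real i - real j\<bar> = \<bar>s i - s j\<bar>"
        using c N by (simp add: s_def diff_divide_distrib[symmetric] right_diff_distrib[symmetric] abs_mult)
      then show "exp (- (c / real N) * \<bar>real i - real j\<bar>) * w j = c / real N * G (s i) (c * real j / real N)"
        using c by (simp add: w_def G_def s_def)
    qed
    have g: "(1 - \<epsilon>) * hsol c (s i) \<le> g i" "g i \<le> (1 + \<epsilon>) * hsol c (s i)" if "i \<in> {1..N}" for i
    proof -
      have "\<bar>g i - hsol c (s i)\<bar> \<le> \<epsilon> * b" using elim(1) s[OF that] unfolding g_eq by blast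
      also have "\<epsilon> * b \<le> \<epsilon> * hsol c (s i)" using b(2)[OF s[OF that]] \<epsilon> by (intro mult_left_mono) auto
      finally show "(1 - \<epsilon>) * hsol c (s i) \<le> g i" "g i \<le> (1 + \<epsilon>) * hsol c (s i)"
        by (auto simp: algebra_simps)
    qed
    have quad: "(\<Sum>i\<in>{1..N}. \<Sum>j\<in>{1..N}. w i * exp (- (c / real N) * \<bar>real i - real j\<bar>) * w j) = (\<Sum>i\<in>{1..N}. w i * g i)"
      by (simp add: g_def sum_distrib_left mult.assoc)
    have "(\<Sum>i\<in>{1..N}. w i * g i) \<le> (\<Sum>i\<in>{1..N}. (1 + \<epsilon>) / real N)"
    proof (rule sum_mono)
      fix i assume i: "i \<in> {1..N}"
      have "w i * g i \<le> w i * ((1 + \<epsilon>) * hsol c (s i))"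
        using g(2)[OF i] N h[of "s i"] by (intro mult_left_mono) (auto simp: w_def)
      then show "w i * g i \<le> (1 + \<epsilon>) / real N" using h[of "s i"] by (simp add: w_def)
    qed
    then have q1: "(\<Sum>i\<in>{1..N}. w i * g i) \<le> 1 + \<epsilon>" using N by simp
    have q0: "0 \<le> (\<Sum>i\<in>{1..N}. w i * g i)"
    proof (rule sum_nonneg)
      fix i assume i: "i \<in> {1..N}"
      have "0 \<le> (1 - \<epsilon>) * hsol c (s i)" using \<epsilon> h[of "s i"] by simp
      then show "0 \<le> w i * g i" using g(1)[OF i] h[of "s i"] N by (simp add: w_def)
    qed
    define Y where "Y = (\<Prod>i\<in>{1..N}. (1 - \<epsilon>) * hsol c (s i))"
    have Y: "Y > 0" unfolding Y_def using \<epsilon> h by (intro prod_pos) auto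
    have Yg: "Y \<le> (\<Prod>i\<in>{1..N}. g i)" unfolding Y_def using \<epsilon> h g(1)
      by (intro prod_mono) (auto intro!: mult_nonneg_nonneg less_imp_le)
    define Z where "Z = partition_fun N (c / real N)"
    have Z: "Z > 0" unfolding Z_def by (rule partition_fun_pos)
    have "fact N * Y\<^sup>2 \<le> fact N * (\<Prod>i\<in>{1..N}. g i)\<^sup>2"
      using Yg Y by (intro mult_left_mono power_mono) auto
    also have "\<dots> \<le> Z * (\<Sum>i\<in>{1..N}. w i * g i) ^ N"
      using partition_fun_ge[of "c / real N" N w] c N unfolding quad Z_def g_def by simp
    also have "\<dots> \<le> Z * (1 + \<epsilon>) ^ N"
      using q0 q1 Z by (intro mult_left_mono power_mono) auto
    finally have "ln (fact N * Y\<^sup>2) \<le> ln (Z * (1 + \<epsilon>) ^ N)"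
      using Y Z \<epsilon> by (subst ln_le_cancel_iff) auto
    moreover have "ln (fact N * Y\<^sup>2) = ln (fact N) + 2 * ln Y" using Y by (simp add: ln_mult ln_realpow)
    moreover have "ln (Z * (1 + \<epsilon>) ^ N) = ln Z + real N * ln (1 + \<epsilon>)" using Z \<epsilon> by (simp add: ln_mult ln_realpow)
    moreover have "ln Y = real N * ln (1 - \<epsilon>) + (\<Sum>i\<in>{1..N}. ln (hsol c (s i)))"
    proof -
      have "(1 - \<epsilon>) * hsol c (s i) \<noteq> 0" for i using \<epsilon> h[of "s i"] by simp
      moreover have "(1 - \<epsilon>) * hsol c (s i) > 0" for i using \<epsilon> h[of "s i"] by simp
      ultimately have "ln Y = (\<Sum>i\<in>{1..N}. ln ((1 - \<epsilon>) * hsol c (s i)))"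
        unfolding Y_def by (intro ln_prod) auto
      also have "\<dots> = (\<Sum>i\<in>{1..N}. ln (1 - \<epsilon>) + ln (hsol c (s i)))"
        using \<epsilon> h by (intro sum.cong refl ln_mult_pos) auto
      finally show ?thesis by (simp add: sum.distrib)
    qed
    ultimately have "ln (fact N) + 2 * (real N * ln (1 - \<epsilon>) + (\<Sum>i\<in>{1..N}. ln (hsol c (s i)))) \<le> ln Z + real N * ln (1 + \<epsilon>)"
      by (simp only:)
    then have "2 * (real N * ln (1 - \<epsilon>) + (\<Sum>i\<in>{1..N}. ln (hsol c (s i)))) - real N * ln (1 + \<epsilon>) \<le> ln Z - ln (fact N)"
      by linarith
    then have "(2 * (real N * ln (1 - \<epsilon>) + (\<Sum>i\<in>{1..N}. ln (hsol c (s i)))) - real N * ln (1 + \<epsilon>)) / real N \<le> (ln Z - ln (fact N)) / real N"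
      using N by (intro divide_right_mono) auto
    moreover have "(2 * (real N * ln (1 - \<epsilon>) + (\<Sum>i\<in>{1..N}. ln (hsol c (s i)))) - real N * ln (1 + \<epsilon>)) / real N
        = 2 * ln (1 - \<epsilon>) + 2 * ((\<Sum>i\<in>{1..N}. ln (hsol c (s i))) / real N) - ln (1 + \<epsilon>)"
      using N by (simp add: field_simps)
    moreover have "ln (1 - \<epsilon>) \<ge> - 2 * \<epsilon>"
    proof -
      have "- \<epsilon> - 2 * \<epsilon>\<^sup>2 \<le> ln (1 - \<epsilon>)" by (rule ln_one_minus_pos_lower_bound) (use \<epsilon> in auto)
      moreover have "2 * \<epsilon>\<^sup>2 \<le> \<epsilon>" using \<epsilon> mult_right_mono[of "2 * \<epsilon>" 1 \<epsilon>] by (simp add: power2_eq_square)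
      ultimately show ?thesis by linarith
    qed
    moreover have "ln (1 + \<epsilon>) \<le> \<epsilon>" using \<epsilon> by (intro ln_add_one_self_le_self) auto
    moreover have "F1 c - \<eta> / 2 < 2 * ((\<Sum>i\<in>{1..N}. ln (hsol c (s i))) / real N)"
      using elim(2) by (simp add: s_def)
    ultimately show ?case unfolding Z_def using \<epsilon>(3) by linarith
  qed
qed

section \<open>Upper bound for the free energy at \<beta> = c / N\<close>

context
  fixes c \<epsilon> :: real
  assumes c: "c > 0" and \<epsilon>: "\<epsilon> > 0"
begin

text \<open>The upper bound is used with \<open>r k = exp (pot (c * k / N))\<close>; \<open>\<epsilon>\<close> keeps the logarithms finite at the
  ends, where \<open>psol\<close> or \<open>msol\<close> vanishes.\<close>

definition pot :: "real \<Rightarrow> real" where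
  "pot s = ln (psol c s + \<epsilon>) - ln (msol c s + \<epsilon>) - 2 * s"

text \<open>Minus the derivative of \<open>pot\<close>. Its formal value at \<epsilon> = 0 is 1 / (c
  p m) with p = \<open>psol c s\<close> and m = \<open>msol c s\<close>, which blows up at both
  ends.\<close>

definition pot' :: "real \<Rightarrow> real" where
  "pot' s = (1 / (c * hsol c s) + \<epsilon>) * (hsol c s + 2 * \<epsilon>) / ((psol c s + \<epsilon>) * (msol c s + \<epsilon>))"

lemma pm_pos: "s \<in> {0..c} \<Longrightarrow> psol c s + \<epsilon> > 0" "s \<in> {0..c} \<Longrightarrow> msol c s + \<epsilon> > 0"
  using psol_nonneg[OF c, of s] msol_nonneg[OF c, of s] \<epsilon> by auto

lemma pot'_pos:
  assumes "s \<in> {0..c}"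
  shows "pot' s > 0"
proof -
  have h: "hsol c s > 0" by (rule hsol_pos[OF c refl])
  then have "1 / (c * hsol c s) > 0" using c by simp
  then have "1 / (c * hsol c s) + \<epsilon> > 0" using \<epsilon> by (rule add_pos_pos)
  with h show ?thesis unfolding pot'_def
    using pm_pos[OF assms] \<epsilon> by (intro divide_pos_pos mult_pos_pos) auto
qed

lemma pot_has_derivative:
  assumes s: "s \<in> {0..c}"
  shows "(pot has_real_derivative - pot' s) (at s within {0..c})"
proof -
  define A where "A = 1 / (c * hsol c s)"
  define p where "p = psol c s + \<epsilon>"
  define m where "m = msol c s + \<epsilon>"
  have pm: "p > 0" "m > 0" using pm_pos[OF s] by (auto simp: p_def m_def)
  have 1: "((\<lambda>s. ln (psol c s + \<epsilon>)) has_real_derivative (p - \<epsilon> - A) / p) (at s within {0..c})"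
    using psol_has_derivative[OF c s] pm
    by (auto intro!: derivative_eq_intros simp: A_def p_def)
  have 2: "((\<lambda>s. ln (msol c s + \<epsilon>)) has_real_derivative (A - (m - \<epsilon>)) / m) (at s within {0..c})"
    using msol_has_derivative[OF c s] pm
    by (auto intro!: derivative_eq_intros simp: A_def m_def)
  have "(pot has_real_derivative (p - \<epsilon> - A) / p - (A - (m - \<epsilon>)) / m - 2) (at s within {0..c})"
    unfolding pot_def[abs_def]
    by (rule DERIV_cong[OF DERIV_diff[OF DERIV_diff[OF 1 2] DERIV_cmult[OF DERIV_ident]]]) simp
  moreover have "pot' s = (A + \<epsilon>) * (p + m) / (p * m)"
    using psol_add_msol[OF c, of s] by (simp add: pot'_def A_def p_def m_def)
  moreover have "(p - \<epsilon> - A) / p - (A - (m - \<epsilon>)) / m - 2 = - ((A + \<epsilon>) * (p + m) / (p * m))"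
    using pm by (simp add: field_simps)
  ultimately show ?thesis by simp
qed

lemma continuous_on_pot': "continuous_on {0..c} pot'"
proof -
  have "continuous_on {0..c} (psol c)" "continuous_on {0..c} (msol c)"
    by (rule DERIV_continuous_on, rule psol_has_derivative[OF c], assumption)
       (rule DERIV_continuous_on, rule msol_has_derivative[OF c], assumption)
  moreover have "c * hsol c s \<noteq> 0" for s using c hsol_pos[OF c refl, of s] by simp
  moreover have "(psol c s + \<epsilon>) * (msol c s + \<epsilon>) \<noteq> 0" if "s \<in> {0..c}" for s
    using pm_pos[OF that] by simp
  ultimately show ?thesis
    unfolding pot'_def[abs_def] by (intro continuous_intros continuous_on_hsol[OF c]) blast+
qed

lemma pot_diff:
  assumes "0 \<le> a" "a < b" "b \<le> c"
  obtains x where "a < x" "x < b" "pot a - pot b = (b - a) * pot' x"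
proof -
  have "\<exists>x\<in>{a<..<b}. pot b - pot a = - pot' x * (b - a)"
  proof (rule mvt_simple[OF assms(2)])
    fix x assume "a \<le> x" "x \<le> b"
    then have "(pot has_real_derivative - pot' x) (at x within {a..b})"
      using assms by (intro has_field_derivative_subset[OF pot_has_derivative]) auto
    then show "(pot has_derivative times (- pot' x)) (at x within {a..b})"
      by (simp only: has_field_derivative_def)
  qed
  then obtain x where "x \<in> {a<..<b}" "pot b - pot a = - pot' x * (b - a)" by blast
  then show thesis by (intro that[of x]) (auto simp: algebra_simps)
qed

end

text \<open>Error budget per site: \<eta> / 4 for freezing \<open>pot'\<close> over one mesh cell,
  \<eta> / 4 for the shift by \<epsilon>, \<eta> / 4 for the Riemann sum of ln h, and \<eta> / 8 for
  the sum of \<open>\<kappa>\<close> divided by N.\<close>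

lemma ln_partition_fun_eventually_le:
  assumes c: "c > 0" and \<eta>: "\<eta> > 0"
  shows "\<forall>\<^sub>F N in sequentially. (ln (partition_fun N (c / real N)) - ln (fact N)) / real N \<le> F1 c + \<eta>"
proof -
  obtain b where b: "b > 0" "\<And>s. s \<in> {0..c} \<Longrightarrow> b \<le> hsol c s" by (rule hsol_lower_bound[OF c]) blast
  \<comment> \<open>Makes ln (1 + 2 \<epsilon> / h), the cost of the shift, at most \<eta> /
    4.\<close>
  define \<epsilon> where "\<epsilon> = \<eta> * b / 8"
  have \<epsilon>: "\<epsilon> > 0" "2 * \<epsilon> / b = \<eta> / 4" using \<eta> b by (auto simp: \<epsilon>_def)
  note g_pos = pot'_pos[OF c \<epsilon>(1)]
  have "continuous_on {0..c} (\<lambda>s. ln (pot' c \<epsilon> s))"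
    using g_pos by (intro continuous_on_ln continuous_on_pot'[OF c \<epsilon>(1)]) (auto simp: less_imp_neq[symmetric])
  then have "uniformly_continuous_on {0..c} (\<lambda>s. ln (pot' c \<epsilon> s))"
    by (intro compact_uniformly_continuous compact_Icc)
  then obtain \<delta> where \<delta>: "\<delta> > 0" and uc: "\<And>x y. x \<in> {0..c} \<Longrightarrow> y \<in> {0..c} \<Longrightarrow> \<bar>y - x\<bar> < \<delta> \<Longrightarrow>
      \<bar>ln (pot' c \<epsilon> y) - ln (pot' c \<epsilon> x)\<bar> < \<eta> / 4"
    unfolding uniformly_continuous_on_def dist_real_def using \<eta> by (metis divide_pos_pos zero_less_numeral)
  \<comment> \<open>The sum of \<open>\<kappa>\<close> telescopes to \<open>K\<close>, which does
    not depend on N.\<close>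
  define K where "K = pot c \<epsilon> 0 - pot c \<epsilon> c"
  have ev1: "\<forall>\<^sub>F N in sequentially. c / real N < \<delta>"
    by (rule order_tendstoD[OF _ \<delta>]) real_asymp
  have ev2: "\<forall>\<^sub>F N in sequentially. K / real N < \<eta> / 8"
    by (rule order_tendstoD[of _ 0]) (use \<eta> in \<open>real_asymp | simp\<close>)+
  have ev3: "\<forall>\<^sub>F N in sequentially. 2 * ((\<Sum>k\<in>{1..N}. ln (hsol c (c * real k / real N))) / real N) < F1 c + \<eta> / 4"
    by (rule order_tendstoD[OF sum_ln_hsol_tendsto[OF c]]) (use \<eta> in simp)
  show ?thesis
    using ev1 ev2 ev3 eventually_gt_at_top[of 0]
  proof eventually_elim
    case (elim N)
    have N: "real N > 0" using elim by simp
    define s where "s k = c * real k / real N" for k :: nat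
    have s: "s k \<in> {0..c}" if "k \<le> N" for k
      using that c N mult_left_mono[of "real k" "real N" c] by (auto simp: s_def pos_divide_le_eq)
    have s_diff: "s k - s (k - 1) = c / real N" if "k \<in> {1..N}" for k
      using that by (simp add: s_def diff_divide_distrib[symmetric] right_diff_distrib[symmetric] of_nat_diff)
    define \<kappa> where "\<kappa> k = pot c \<epsilon> (s (k - 1)) - pot c \<epsilon> (s k)" for k
    define r where "r k = exp (pot c \<epsilon> (s k))" for k
    have \<kappa>: "\<kappa> k > 0" "- ln (\<kappa> k) \<le> - ln (c / real N) - ln (pot' c \<epsilon> (s k)) + \<eta> / 4" if k: "k \<in> {1..N}" for k
    proof -
      have "k \<le> N" "k - 1 \<le> N" using k by auto
      then have le: "0 \<le> s (k - 1)" "s (k - 1) < s k" "s k \<le> c"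
      proof -
        have "c / real N > 0" using c N by simp
        then show "s (k - 1) < s k" using s_diff[OF k] by linarith
      qed (use s[of k] s[of "k - 1"] \<open>k \<le> N\<close> \<open>k - 1 \<le> N\<close> in auto)
      obtain x where x: "s (k - 1) < x" "x < s k" "\<kappa> k = (s k - s (k - 1)) * pot' c \<epsilon> x"
        unfolding \<kappa>_def by (rule pot_diff[OF c \<epsilon>(1) le]) blast
      have xc: "x \<in> {0..c}" using x le by auto
      have sk: "s k \<in> {0..c}" using le by auto
      have "\<bar>s k - x\<bar> < \<delta>" using x s_diff[OF k] elim(1) by auto
      then have "\<bar>ln (pot' c \<epsilon> (s k)) - ln (pot' c \<epsilon> x)\<bar> < \<eta> / 4" using uc xc sk by blast
      moreover have k_eq: "\<kappa> k = c / real N * pot' c \<epsilon> x" unfolding x(3) s_diff[OF k] ..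
      moreover have "ln (\<kappa> k) = ln (c / real N) + ln (pot' c \<epsilon> x)"
        unfolding k_eq using c N g_pos[OF xc] by (intro ln_mult_pos) auto
      ultimately show "- ln (\<kappa> k) \<le> - ln (c / real N) - ln (pot' c \<epsilon> (s k)) + \<eta> / 4" by linarith
      show "\<kappa> k > 0" unfolding k_eq using c N g_pos[OF xc] by simp
    qed
    have r_ratio: "ln (r (k - 1) / r k) = \<kappa> k" for k
      by (simp add: r_def \<kappa>_def exp_diff[symmetric])
    define T where "T k = (r k + exp (- 2 * (c / real N) * real k))\<^sup>2 / (exp (- 2 * (c / real N) * real k) * r k)
      * (exp (ln (r (k - 1) / r k) - 1) / ln (r (k - 1) / r k))" for k
    have Z: "partition_fun N (c / real N) \<le> (\<Prod>k\<in>{1..N}. T k)"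
      unfolding T_def
    proof (rule partition_fun_le)
      show "r k > 0" for k by (simp add: r_def)
      show "r (Suc k) < r k" if "k < N" for k
        using \<kappa>(1)[of "Suc k"] that by (simp add: r_def \<kappa>_def)
    qed
    have T: "T k > 0" "ln (T k) \<le> 2 * ln (hsol c (s k)) + \<eta> / 2 + \<kappa> k - 1 + ln (real N)" if k: "k \<in> {1..N}" for k
    proof -
      have sk: "s k \<in> {0..c}" using s k by auto
      define h where "h = hsol c (s k)"
      define p where "p = psol c (s k) + \<epsilon>"
      define m where "m = msol c (s k) + \<epsilon>"
      define A where "A = 1 / (c * h)"
      have h: "h > 0" unfolding h_def by (rule hsol_pos[OF c refl])
      have hb: "b \<le> h" unfolding h_def by (rule b(2)[OF sk])
      have A: "A > 0" using c h by (simp add: A_def)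
      have pm: "p > 0" "m > 0" using pm_pos[OF c \<epsilon>(1) sk] by (auto simp: p_def m_def)
      have pmh: "p + m = h + 2 * \<epsilon>" using psol_add_msol[OF c, of "s k"] by (simp add: p_def m_def h_def)
      define X where "X = exp (- 2 * (c / real N) * real k)"
      have X: "X > 0" by (simp add: X_def)
      have "pot c \<epsilon> (s k) = ln p - ln m + (- 2 * (c / real N) * real k)"
        by (simp add: pot_def[OF c \<epsilon>(1)] p_def m_def s_def)
      then have rX: "r k = p / m * X"
        using pm unfolding r_def X_def by (simp only: exp_add exp_diff exp_ln)
      \<comment> \<open>As r / X = p / m, the exponential \<open>X\<close> cancels from the
        ratio.\<close>
      have B: "(r k + X)\<^sup>2 / (X * r k) = (h + 2 * \<epsilon>)\<^sup>2 / (p * m)"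
        unfolding pmh[symmetric] rX using pm X by (simp add: power2_eq_square field_simps)
      have Tk: "T k = (h + 2 * \<epsilon>)\<^sup>2 / (p * m) * (exp (\<kappa> k - 1) / \<kappa> k)"
        unfolding T_def r_ratio X_def[symmetric] B ..
      have pos: "(h + 2 * \<epsilon>)\<^sup>2 / (p * m) > 0" using h \<epsilon> pm by simp
      show "T k > 0" unfolding Tk using \<kappa>(1)[OF k] by (intro mult_pos_pos pos divide_pos_pos) auto
      have "ln (B * (exp (a - 1) / a)) = ln B + (a - 1) - ln a" if "B > 0" "a > 0" for B a :: real
        using that by (simp add: ln_mult_pos ln_div)
      from this[OF pos \<kappa>(1)[OF k]] have "ln (T k) = ln ((h + 2 * \<epsilon>)\<^sup>2 / (p * m)) + (\<kappa> k - 1) - ln (\<kappa> k)"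
        unfolding Tk .
      also have "\<dots> \<le> ln ((h + 2 * \<epsilon>)\<^sup>2 / (p * m)) - ln (pot' c \<epsilon> (s k)) + (\<kappa> k - 1) - ln (c / real N) + \<eta> / 4"
        using \<kappa>(2)[OF k] by linarith
      \<comment> \<open>\<open>pot'\<close> carries the same denominator p m as the squared factor;
        the quantities that vanish at the ends cancel, leaving only h and \<epsilon>.\<close>
      also have "ln ((h + 2 * \<epsilon>)\<^sup>2 / (p * m)) - ln (pot' c \<epsilon> (s k)) = ln ((h + 2 * \<epsilon>) / (A + \<epsilon>))"
      proof -
        have "pot' c \<epsilon> (s k) = (A + \<epsilon>) * (h + 2 * \<epsilon>) / (p * m)"
          by (simp add: pot'_def[OF c \<epsilon>(1)] A_def h_def p_def m_def)
        then have "(h + 2 * \<epsilon>)\<^sup>2 / (p * m) / pot' c \<epsilon> (s k) = (h + 2 * \<epsilon>) / (A + \<epsilon>)"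
          using pm h A \<epsilon>(1) by (simp add: power2_eq_square)
        moreover have "ln (B / a) = ln B - ln a" if "B > 0" "a > 0" for B a :: real
          using that by (simp add: ln_div)
        note this[OF pos g_pos[OF sk]]
        ultimately show ?thesis by (simp only:)
      qed
      also have "ln ((h + 2 * \<epsilon>) / (A + \<epsilon>)) \<le> ln ((h + 2 * \<epsilon>) / A)"
        using h A \<epsilon>(1) by (subst ln_le_cancel_iff) (auto intro!: divide_left_mono divide_pos_pos add_pos_pos)
      also have "ln ((h + 2 * \<epsilon>) / A) = ln c + ln h + ln (h * (1 + 2 * \<epsilon> / h))"
      proof -
        have "(h + 2 * \<epsilon>) / A = c * h * (h * (1 + 2 * \<epsilon> / h))" using h by (simp add: A_def field_simps)
        moreover have "h * (1 + 2 * \<epsilon> / h) > 0" using h \<epsilon>(1) by (intro mult_pos_pos add_pos_pos) auto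
        ultimately show ?thesis using c h by (simp add: ln_mult_pos)
      qed
      also have "ln (h * (1 + 2 * \<epsilon> / h)) = ln h + ln (1 + 2 * \<epsilon> / h)"
        using h \<epsilon>(1) by (intro ln_mult_pos add_pos_pos) auto
      also have "ln (1 + 2 * \<epsilon> / h) \<le> 2 * \<epsilon> / h" using h \<epsilon>(1) by (intro ln_add_one_self_le_self) auto
      also have "2 * \<epsilon> / h \<le> 2 * \<epsilon> / b" using hb b(1) \<epsilon>(1) by (intro divide_left_mono) auto
      also have "2 * \<epsilon> / b = \<eta> / 4" by (rule \<epsilon>(2))
      also have "ln (c / real N) = ln c - ln (real N)" using c N by (simp add: ln_div)
      finally show "ln (T k) \<le> 2 * ln (hsol c (s k)) + \<eta> / 2 + \<kappa> k - 1 + ln (real N)"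
        by (simp add: h_def)
    qed
    have tele: "(\<Sum>k\<in>{1..n}. \<kappa> k) = pot c \<epsilon> (s 0) - pot c \<epsilon> (s n)" for n
      by (induction n) (auto simp: \<kappa>_def)
    have "ln (partition_fun N (c / real N)) \<le> ln (\<Prod>k\<in>{1..N}. T k)"
      using Z partition_fun_pos[of N "c / real N"] by (intro ln_mono) auto
    also have "\<dots> = (\<Sum>k\<in>{1..N}. ln (T k))"
    proof (rule ln_prod)
      show "T k \<noteq> 0" if "k \<in> {1..N}" for k using T(1)[OF that] by linarith
    qed (use T(1) in auto)
    also have "\<dots> \<le> (\<Sum>k\<in>{1..N}. 2 * ln (hsol c (s k)) + \<eta> / 2 + \<kappa> k - 1 + ln (real N))"
      by (intro sum_mono T)
    also have "\<dots> = 2 * (\<Sum>k\<in>{1..N}. ln (hsol c (s k))) + real N * (\<eta> / 2) + (\<Sum>k\<in>{1..N}. \<kappa> k) - real N + real N * ln (real N)"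
      by (simp add: sum.distrib sum_subtractf sum_distrib_left)
    also have "(\<Sum>k\<in>{1..N}. \<kappa> k) = K" using N unfolding tele by (simp add: K_def s_def)
    \<comment> \<open>The terms N ln N - N are absorbed by ln (fact N) through
      \<open>ln_fact_ge\<close>.\<close>
    finally have "ln (partition_fun N (c / real N)) - ln (fact N)
       \<le> 2 * (\<Sum>k\<in>{1..N}. ln (hsol c (s k))) + real N * (\<eta> / 2) + K"
      using ln_fact_ge[of N] by linarith
    then have "(ln (partition_fun N (c / real N)) - ln (fact N)) / real N
       \<le> (2 * (\<Sum>k\<in>{1..N}. ln (hsol c (s k))) + real N * (\<eta> / 2) + K) / real N"
      using N by (intro divide_right_mono) auto
    also have "\<dots> = 2 * ((\<Sum>k\<in>{1..N}. ln (hsol c (s k))) / real N) + \<eta> / 2 + K / real N"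
      using N by (simp add: add_divide_distrib)
    also have "\<dots> \<le> F1 c + \<eta>" using elim(2,3) \<eta> unfolding s_def by linarith
    finally show ?case .
  qed
qed

lemma ln_partition_fun_tendsto:
  assumes "c > 0"
  shows "(\<lambda>N. (ln (partition_fun N (c / real N)) - ln (fact N)) / real N) \<longlonglongrightarrow> F1 c"
proof (rule tendstoI)
  fix \<eta> :: real assume "\<eta> > 0"
  then have "\<eta> / 2 > 0" by simp
  from ln_partition_fun_eventually_ge[OF assms this] ln_partition_fun_eventually_le[OF assms this]
  show "\<forall>\<^sub>F N in sequentially. dist ((ln (partition_fun N (c / real N)) - ln (fact N)) / real N) (F1 c) < \<eta>"
    by eventually_elim (use \<open>\<eta> > 0\<close> in \<open>auto simp: dist_real_def abs_less_iff\<close>)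
qed

section \<open>The three regimes\<close>

lemma f1_tendsto:
  assumes "c > 0"
  shows "(f1 \<longlongrightarrow> f1 c) (at c)"
proof -
  have "f1 differentiable (at c within {0<..})"
    using smooth_on_f1 assms by (auto simp: smooth_on_def differentiable_on_def dest: spec[of _ 0])
  then have "isCont f1 c"
    using assms at_within_open[of c "{0<..}"] differentiable_imp_continuous_within by fastforce
  then show ?thesis by (simp add: continuous_at)
qed

text \<open>Pointwise convergence of convex functions to a differentiable limit forces convergence
  of the slopes. By \<open>key\<close>, the slope at c lies between the difference quotients over
  [c - d, c] and [c, c + d]; d is fixed first from the derivative of \<open>F1\<close>, and only
  then N tends to infinity.\<close>

lemma mean_displacement_tendsto:
  assumes c: "c > 0"
  shows "(\<lambda>N. mean_displacement N (c / real N) / real N) \<longlonglongrightarrow> f1 c"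
proof (rule tendstoI)
  fix \<eta> :: real assume \<eta>: "\<eta> > 0"
  define L where "L x N = (ln (partition_fun N (x / real N)) - ln (fact N)) / real N" for x N
  have L: "L x \<longlonglongrightarrow> F1 x" if "x > 0" for x unfolding L_def using that by (rule ln_partition_fun_tendsto)
  have slope: "((\<lambda>d. (F1 (c + d) - F1 c) / d) \<longlongrightarrow> - f1 c) (at 0)"
    using F1_has_derivative[OF c] by (simp add: DERIV_def)
  then have "\<forall>\<^sub>F d in at 0. dist ((F1 (c + d) - F1 c) / d) (- f1 c) < \<eta>"
    using \<eta> by (rule tendstoD)
  then obtain r where r: "r > 0" "\<And>d. d \<noteq> 0 \<Longrightarrow> \<bar>d\<bar> < r \<Longrightarrow> \<bar>(F1 (c + d) - F1 c) / d + f1 c\<bar> < \<eta>"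
    unfolding eventually_at by (auto simp: dist_real_def)
  define d where "d = min (r / 2) (c / 2)"
  have d: "0 < d" "d < r" "d < c" using r c by (auto simp: d_def)
  have key: "(L x N - L y N) \<le> mean_displacement N (x / real N) / real N * (y - x)" if "N \<ge> 1" for x y N
  proof -
    have N: "real N > 0" using that by simp
    have "ln (partition_fun N (x / real N)) - ln (partition_fun N (y / real N))
      \<le> mean_displacement N (x / real N) * (y - x)"
    proof -
      have "real N * mean_displacement N (x / real N) * (y / real N - x / real N) = mean_displacement N (x / real N) * (y - x)"
        using N by (simp only: diff_divide_distrib[symmetric]) simp
      then show ?thesis using ln_partition_fun_diff_le[OF that, of "x / real N" "y / real N"] by (simp only:)
    qed
    then have "(ln (partition_fun N (x / real N)) - ln (partition_fun N (y / real N))) / real N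
      \<le> mean_displacement N (x / real N) * (y - x) / real N"
      using N by (intro divide_right_mono) auto
    then show ?thesis by (simp add: L_def diff_divide_distrib[symmetric])
  qed
  have up: "(\<lambda>N. (L (c - d) N - L c N) / d) \<longlonglongrightarrow> (F1 (c - d) - F1 c) / d"
    using d c by (intro tendsto_divide tendsto_diff L tendsto_const) auto
  have low: "(\<lambda>N. (L c N - L (c + d) N) / d) \<longlonglongrightarrow> (F1 c - F1 (c + d)) / d"
    using d c by (intro tendsto_divide tendsto_diff L tendsto_const) auto
  have up': "(F1 (c - d) - F1 c) / d < f1 c + \<eta>"
    using r(2)[of "- d"] d by (auto simp: abs_less_iff field_simps)
  have low': "(F1 c - F1 (c + d)) / d > f1 c - \<eta>"
    using r(2)[of d] d by (auto simp: abs_less_iff field_simps)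
  show "\<forall>\<^sub>F N in sequentially. dist (mean_displacement N (c / real N) / real N) (f1 c) < \<eta>"
    using order_tendstoD(2)[OF up up'] order_tendstoD(1)[OF low low'] eventually_ge_at_top[of 1]
  proof eventually_elim
    case (elim N)
    let ?m = "mean_displacement N (c / real N) / real N"
    have "(L c N - L (c + d) N) / d \<le> ?m" using key[of N c "c + d"] elim d by (simp add: field_simps)
    moreover have "?m \<le> (L (c - d) N - L c N) / d" using key[of N c "c - d"] elim d by (simp add: field_simps)
    ultimately show ?case using elim by (auto simp: dist_real_def abs_less_iff)
  qed
qed

text \<open>Monotonicity passes to the limit from the mean displacements at finite N.\<close>

lemma f1_antimono:
  assumes "0 < a" "a \<le> b"
  shows "f1 b \<le> f1 a"
proof (rule tendsto_le[OF sequentially_bot mean_displacement_tendsto mean_displacement_tendsto])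
  show "\<forall>\<^sub>F N in sequentially. mean_displacement N (b / real N) / real N \<le> mean_displacement N (a / real N) / real N"
    using eventually_ge_at_top[of 1]
    by eventually_elim (use assms in \<open>auto intro!: divide_right_mono mean_displacement_antimono\<close>)
qed (use assms in auto)

text \<open>The limit of \<open>mean_displacement_bound\<close> along \<beta> = c / N, where \<beta>
  + 1 / (\<beta> N) tends to 1 / c. The threshold 32 leaves half of the allowance 1/16 for the term
  c / N.\<close>

lemma f1_bound:
  assumes "c \<ge> 32"
  shows "\<bar>c * f1 c - 1\<bar> \<le> 21 * sqrt (1 / c)"
proof (rule tendsto_le[OF sequentially_bot])
  have c: "c > 0" using assms by simp
  show "(\<lambda>N. \<bar>c * (mean_displacement N (c / real N) / real N) - 1\<bar>) \<longlonglongrightarrow> \<bar>c * f1 c - 1\<bar>"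
    by (intro tendsto_intros mean_displacement_tendsto c)
  have "(\<lambda>N. c / real N + 1 / c) \<longlonglongrightarrow> 0 + 1 / c"
    by (intro tendsto_intros)
  then show "(\<lambda>N. 21 * sqrt (c / real N + 1 / c)) \<longlonglongrightarrow> 21 * sqrt (1 / c)"
    by (intro tendsto_intros) simp
  have "\<forall>\<^sub>F N in sequentially. c / real N < 1 / 32"
    by (rule order_tendstoD[of _ 0]) (real_asymp | simp)+
  then show "\<forall>\<^sub>F N in sequentially. \<bar>c * (mean_displacement N (c / real N) / real N) - 1\<bar> \<le> 21 * sqrt (c / real N + 1 / c)"
    using eventually_ge_at_top[of 1]
  proof eventually_elim
    case (elim N)
    have e: "1 / (c / real N * real N) = 1 / c" using elim by simp
    have "1 / c \<le> 1 / 32" using assms by simp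
    then have "c / real N + 1 / (c / real N * real N) \<le> 1 / 16" unfolding e using elim by linarith
    then have "\<bar>c / real N * mean_displacement N (c / real N) - 1\<bar> \<le> 21 * sqrt (c / real N + 1 / (c / real N * real N))"
      using elim c by (intro mean_displacement_bound) auto
    then show ?case unfolding e by simp
  qed
qed

lemma f1_Theta: "f1 \<in> \<Theta>[at_top](\<lambda>c. 1 / c)"
proof -
  \<comment> \<open>42 = 2 * 21, so that 21 sqrt (1 / c) <= 1/2.\<close>
  have b: "1 / 2 \<le> c * f1 c \<and> c * f1 c \<le> 3 / 2" if "c \<ge> 42\<^sup>2" for c
  proof -
    have "sqrt (1 / c) \<le> 1 / 42"
      using that by (intro real_le_lsqrt) (auto simp: power2_eq_square field_simps)
    then have "\<bar>c * f1 c - 1\<bar> \<le> 1 / 2" using f1_bound[of c] that by auto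
    then show ?thesis by (intro conjI; linarith)
  qed
  have "\<forall>\<^sub>F c in at_top. norm (f1 c) \<le> 3 / 2 * norm (1 / c)"
    using eventually_ge_at_top[of "42\<^sup>2 :: real"]
  proof eventually_elim
    case (elim c)
    then have "c > 0" by simp
    then show ?case using b[OF elim] f1_pos[of c] by (simp add: field_simps)
  qed
  moreover have "\<forall>\<^sub>F c in at_top. norm (1 / c) \<le> 2 * norm (f1 c)"
    using eventually_ge_at_top[of "42\<^sup>2 :: real"]
  proof eventually_elim
    case (elim c)
    then have "c > 0" by simp
    then show ?case using b[OF elim] f1_pos[of c] by (simp add: field_simps)
  qed
  ultimately show ?thesis
    unfolding bigtheta_def using bigoI bigomega_iff_bigo by blast
qed

section \<open>The asymptotic statements for each range of \<beta>\<close>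

text \<open>There is a single error \<open>R\<close>, bounded by 21 (a + b). It is divided between
  the two required error terms in proportion to \<open>a\<close> and \<open>b\<close>, so each part
  inherits its own bound.\<close>

lemma regime_small_beta:
  fixes \<beta> :: "nat \<Rightarrow> real"
  assumes "(\<lambda>N. 1 / real N) \<in> o(\<beta>)" "\<beta> \<in> o(\<lambda>_. 1)" and nonneg: "\<forall>N\<ge>1. \<beta> N \<ge> 0"
  shows "\<exists>e\<^sub>1 e\<^sub>2 :: nat \<Rightarrow> real. e\<^sub>1 \<in> O(\<lambda>N. \<beta> N powr (1 / 2)) \<and> e\<^sub>2 \<in> O(\<lambda>N. (\<beta> N * real N) powr (- 1 / 2)) \<and>
    (\<forall>\<^sub>F N in at_top. mean_displacement N (\<beta> N) = 1 / \<beta> N * (1 + e\<^sub>1 N + e\<^sub>2 N))"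
proof -
  define R where "R N = \<beta> N * mean_displacement N (\<beta> N) - 1" for N
  define a where "a N = \<beta> N powr (1 / 2)" for N
  define b where "b N = (\<beta> N * real N) powr (- 1 / 2)" for N
  define e1 where "e1 N = R N * (a N / (a N + b N))" for N
  define e2 where "e2 N = R N * (b N / (a N + b N))" for N
  have "\<forall>\<^sub>F N in sequentially. norm (1 / real N) \<le> 1 / 32 * norm (\<beta> N)"
    by (rule landau_o.smallD[OF assms(1)]) simp
  moreover have "\<forall>\<^sub>F N in sequentially. norm (\<beta> N) \<le> 1 / 32 * norm (1::real)"
    by (rule landau_o.smallD[OF assms(2)]) simp
  ultimately have ev: "\<forall>\<^sub>F N in sequentially. \<beta> N > 0 \<and> a N > 0 \<and> b N > 0 \<and> \<bar>R N\<bar> \<le> 21 * (a N + b N)"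
    using eventually_ge_at_top[of 1]
  proof eventually_elim
    case (elim N)
    have N: "real N > 0" using elim by simp
    have b0: "\<beta> N \<ge> 0" using nonneg elim by blast
    have b1: "\<beta> N > 0" using elim(1) b0 N by (cases "\<beta> N = 0") auto
    have bN: "\<beta> N * real N > 0" using b1 N by simp
    have "1 / (\<beta> N * real N) \<le> 1 / 32" using elim(1) b1 N by (simp add: field_simps)
    moreover have "\<beta> N \<le> 1 / 32" using elim(2) b1 by simp
    ultimately have "\<beta> N + 1 / (\<beta> N * real N) \<le> 1 / 16" by linarith
    then have "\<bar>R N\<bar> \<le> 21 * sqrt (\<beta> N + 1 / (\<beta> N * real N))"
      unfolding R_def using b1 elim by (intro mean_displacement_bound) auto
    also have "sqrt (\<beta> N + 1 / (\<beta> N * real N)) \<le> sqrt (\<beta> N) + sqrt (1 / (\<beta> N * real N))"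
      using b1 bN by (intro sqrt_add_le_add_sqrt) auto
    also have "sqrt (\<beta> N) = a N" using b1 by (simp add: a_def powr_half_sqrt)
    also have "sqrt (1 / (\<beta> N * real N)) = b N"
      using bN by (simp add: b_def powr_minus powr_half_sqrt real_sqrt_divide inverse_eq_divide)
    finally show ?case using b1 bN elim by (simp add: a_def b_def)
  qed
  have "e1 \<in> O(a)"
  proof (rule bigoI[of _ 21])
    show "\<forall>\<^sub>F N in sequentially. norm (e1 N) \<le> 21 * norm (a N)"
      using ev
    proof eventually_elim
      case (elim N)
      have "\<bar>e1 N\<bar> = \<bar>R N\<bar> * (a N / (a N + b N))" using elim by (simp add: e1_def abs_mult)
      also have "\<dots> \<le> 21 * (a N + b N) * (a N / (a N + b N))" using elim by (intro mult_right_mono) auto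
      also have "\<dots> = 21 * a N" using elim by (simp add: field_simps)
      finally show ?case using elim by simp
    qed
  qed
  moreover have "e2 \<in> O(b)"
  proof (rule bigoI[of _ 21])
    show "\<forall>\<^sub>F N in sequentially. norm (e2 N) \<le> 21 * norm (b N)"
      using ev
    proof eventually_elim
      case (elim N)
      have "\<bar>e2 N\<bar> = \<bar>R N\<bar> * (b N / (a N + b N))" using elim by (simp add: e2_def abs_mult)
      also have "\<dots> \<le> 21 * (a N + b N) * (b N / (a N + b N))" using elim by (intro mult_right_mono) auto
      also have "\<dots> = 21 * b N" using elim by (simp add: field_simps)
      finally show ?case using elim by simp
    qed
  qed
  moreover have "\<forall>\<^sub>F N in at_top. mean_displacement N (\<beta> N) = 1 / \<beta> N * (1 + e1 N + e2 N)"
    using ev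
  proof eventually_elim
    case (elim N)
    have "a N / (a N + b N) + b N / (a N + b N) = 1" using elim by (simp add: add_divide_distrib[symmetric])
    then have "e1 N + e2 N = R N" by (simp only: e1_def e2_def distrib_left[symmetric])
    then have "1 + e1 N + e2 N = \<beta> N * mean_displacement N (\<beta> N)" by (simp add: R_def)
    then show ?case using elim by simp
  qed
  ultimately show ?thesis unfolding a_def b_def by blast
qed

text \<open>Eventually \<beta> lies between (c - d) / N and (c + d) / N. Monotonicity in \<beta>
  gives the sandwich, and continuity of \<open>f1\<close> at c closes it.\<close>

lemma regime_critical:
  assumes c: "c > 0" and \<beta>: "\<beta> \<sim>[at_top] (\<lambda>N. c / real N)"
  shows "(\<lambda>N. mean_displacement N (\<beta> N) / real N) \<longlonglongrightarrow> f1 c"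
proof (rule tendstoI)
  fix \<eta> :: real assume \<eta>: "\<eta> > 0"
  have "\<forall>\<^sub>F x in at c. dist (f1 x) (f1 c) < \<eta> / 2"
    by (rule tendstoD[OF f1_tendsto[OF c]]) (use \<eta> in simp)
  then obtain r where r: "r > 0" "\<And>x. x \<noteq> c \<Longrightarrow> \<bar>x - c\<bar> < r \<Longrightarrow> \<bar>f1 x - f1 c\<bar> < \<eta> / 2"
    unfolding eventually_at by (auto simp: dist_real_def)
  define d where "d = min (r / 2) (c / 2)"
  have d: "0 < d" "d < r" "d < c" using r c by (auto simp: d_def)
  have f: "\<bar>f1 (c - d) - f1 c\<bar> < \<eta> / 2" "\<bar>f1 (c + d) - f1 c\<bar> < \<eta> / 2"
    using r(2)[of "c - d"] r(2)[of "c + d"] d by auto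
  have "((\<lambda>N. \<beta> N / (c / real N)) \<longlongrightarrow> 1) sequentially"
    by (rule asymp_equivD_strong[OF \<beta>]) (use c in \<open>auto intro: eventually_mono[OF eventually_gt_at_top[of 0]]\<close>)
  then have "(\<lambda>N. c * (\<beta> N / (c / real N))) \<longlonglongrightarrow> c * 1" by (intro tendsto_intros)
  then have lim: "(\<lambda>N. \<beta> N * real N) \<longlonglongrightarrow> c" using c by (simp add: mult.commute)
  have "(\<lambda>N. mean_displacement N ((c - d) / real N) / real N) \<longlonglongrightarrow> f1 (c - d)"
    "(\<lambda>N. mean_displacement N ((c + d) / real N) / real N) \<longlonglongrightarrow> f1 (c + d)"
    using d c by (auto intro!: mean_displacement_tendsto)
  moreover have "f1 (c - d) < f1 c + \<eta>" "f1 c - \<eta> < f1 (c + d)" using f \<eta> by linarith+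
  ultimately have "\<forall>\<^sub>F N in sequentially. mean_displacement N ((c - d) / real N) / real N < f1 c + \<eta>"
    "\<forall>\<^sub>F N in sequentially. mean_displacement N ((c + d) / real N) / real N > f1 c - \<eta>"
    by (auto intro: order_tendstoD)
  moreover have "\<forall>\<^sub>F N in sequentially. \<beta> N * real N > c - d" "\<forall>\<^sub>F N in sequentially. \<beta> N * real N < c + d"
    using d by (auto intro!: order_tendstoD[OF lim])
  ultimately show "\<forall>\<^sub>F N in sequentially. dist (mean_displacement N (\<beta> N) / real N) (f1 c) < \<eta>"
    using eventually_ge_at_top[of 1]
  proof eventually_elim
    case (elim N)
    have N: "real N > 0" using elim by simp
    have "(c - d) / real N \<le> \<beta> N" "\<beta> N \<le> (c + d) / real N" using elim N by (auto simp: field_simps)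
    then have "mean_displacement N (\<beta> N) \<le> mean_displacement N ((c - d) / real N)"
      "mean_displacement N ((c + d) / real N) \<le> mean_displacement N (\<beta> N)"
      using elim by (auto intro!: mean_displacement_antimono)
    then have "mean_displacement N (\<beta> N) / real N \<le> mean_displacement N ((c - d) / real N) / real N"
      "mean_displacement N ((c + d) / real N) / real N \<le> mean_displacement N (\<beta> N) / real N"
      using N by (auto intro: divide_right_mono)
    then show ?case using elim by (auto simp: dist_real_def abs_less_iff)
  qed
qed

lemma regime_high_temperature:
  assumes \<beta>: "\<beta> \<in> o(\<lambda>N. 1 / real N)" and nonneg: "\<forall>N\<ge>1. \<beta> N \<ge> 0"
  shows "(\<lambda>N. mean_displacement N (\<beta> N) / real N) \<longlonglongrightarrow> 1 / 3"
proof (rule tendstoI)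
  fix \<eta> :: real assume \<eta>: "\<eta> > 0"
  have "\<forall>\<^sub>F c in at_right 0. f1 c > 1 / 3 - \<eta>"
    by (rule order_tendstoD[OF f1_tendsto_at_0]) (use \<eta> in simp)
  then obtain r where r: "r > 0" "\<And>c. 0 < c \<Longrightarrow> c < r \<Longrightarrow> f1 c > 1 / 3 - \<eta>"
    unfolding eventually_at_right_field by auto
  define c where "c = r / 2"
  have c: "c > 0" "f1 c > 1 / 3 - \<eta>" using r by (auto simp: c_def)
  have "\<forall>\<^sub>F N in sequentially. mean_displacement N (c / real N) / real N > 1 / 3 - \<eta>"
    by (rule order_tendstoD[OF mean_displacement_tendsto]) (use c in auto)
  moreover have "\<forall>\<^sub>F N in sequentially. norm (\<beta> N) \<le> c * norm (1 / real N)"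
    by (rule landau_o.smallD[OF \<beta> c(1)])
  ultimately show "\<forall>\<^sub>F N in sequentially. dist (mean_displacement N (\<beta> N) / real N) (1 / 3) < \<eta>"
    using eventually_ge_at_top[of 1]
  proof eventually_elim
    case (elim N)
    have N: "real N > 0" using elim by simp
    have "mean_displacement N (\<beta> N) \<le> real N / 3"
      using mean_displacement_antimono[of N 0 "\<beta> N"] mean_displacement_zero_le[of N] nonneg elim by fastforce
    then have 1: "mean_displacement N (\<beta> N) / real N \<le> 1 / 3" using N by (simp add: field_simps)
    have "\<beta> N \<le> c / real N" using elim by simp
    then have "mean_displacement N (c / real N) \<le> mean_displacement N (\<beta> N)"
      using elim by (intro mean_displacement_antimono) auto
    then have "mean_displacement N (c / real N) / real N \<le> mean_displacement N (\<beta> N) / real N"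
      using N by (intro divide_right_mono) auto
    then show ?case using 1 elim by (auto simp: dist_real_def abs_less_iff)
  qed
qed

lemma relative_error_of_tendsto:
  fixes X :: "nat \<Rightarrow> real"
  assumes lim: "(\<lambda>N. X N / real N) \<longlonglongrightarrow> L" and "L \<noteq> 0"
  shows "\<exists>e :: nat \<Rightarrow> real. e \<in> o(\<lambda>_. 1) \<and> (\<forall>\<^sub>F N in at_top. X N = real N * L * (1 + e N))"
proof (intro exI conjI)
  let ?e = "\<lambda>N. X N / real N / L - 1"
  have "?e \<longlonglongrightarrow> L / L - 1" by (intro tendsto_intros lim assms)
  then show "?e \<in> o(\<lambda>_. 1)" using assms(2) by (intro smalloI_tendsto) auto
  show "\<forall>\<^sub>F N in at_top. X N = real N * L * (1 + ?e N)"
    using eventually_gt_at_top[of 0] by eventually_elim (use assms(2) in simp)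
qed

theorem theorem1p2:
  "\<exists>(f :: real \<Rightarrow> real) (h :: real \<Rightarrow> real \<Rightarrow> real).
     (\<forall>c>0. f c > 0) \<and> smooth_on {0<..} f \<and> antimono_on {0<..} f \<and>
     (\<forall>\<beta> :: nat \<Rightarrow> real. (\<forall>N\<ge>1. \<beta> N \<ge> 0) \<longrightarrow>
        ((\<lambda>N. 1 / real N) \<in> o(\<beta>) \<and> \<beta> \<in> o(\<lambda>_. 1) \<longrightarrow>
           (\<exists>e\<^sub>1 e\<^sub>2 :: nat \<Rightarrow> real.
              e\<^sub>1 \<in> O(\<lambda>N. \<beta> N powr (1 / 2)) \<and> e\<^sub>2 \<in> O(\<lambda>N. (\<beta> N * real N) powr (- 1 / 2)) \<and>
              (\<forall>\<^sub>F N in at_top.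
                 mean_displacement N (\<beta> N) = 1 / \<beta> N * (1 + e\<^sub>1 N + e\<^sub>2 N)))) \<and>
        (\<forall>c>0. \<beta> \<sim>[at_top] (\<lambda>N. c / real N) \<longrightarrow>
           (\<exists>e :: nat \<Rightarrow> real. e \<in> o(\<lambda>_. 1) \<and>
              (\<forall>\<^sub>F N in at_top. mean_displacement N (\<beta> N) = real N * f c * (1 + e N)))) \<and>
        (\<beta> \<in> o(\<lambda>N. 1 / real N) \<longrightarrow>
           (\<exists>e :: nat \<Rightarrow> real. e \<in> o(\<lambda>_. 1) \<and>
              (\<forall>\<^sub>F N in at_top. mean_displacement N (\<beta> N) = real N / 3 * (1 + e N))))) \<and>
     (f \<longlongrightarrow> 1 / 3) (at_right 0) \<and>
     f \<in> \<Theta>[at_top](\<lambda>c. 1 / c) \<and>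
     (\<forall>c>0. unique_positive_solution c (h c) \<and> real_analytic_on (h c) {0..c}) \<and>
     (\<forall>c>0. ((\<lambda>c. bvp_functional c (h c)) has_real_derivative - f c) (at c))"
proof (intro exI[of _ f1] exI[of _ hsol] conjI allI impI)
  show "smooth_on {0<..} f1" by (rule smooth_on_f1)
  show "antimono_on {0<..} f1" by (auto simp: monotone_on_def intro: f1_antimono)
  show "(f1 \<longlongrightarrow> 1 / 3) (at_right 0)" by (rule f1_tendsto_at_0)
  show "f1 \<in> \<Theta>[at_top](\<lambda>c. 1 / c)" by (rule f1_Theta)
next
  fix c :: real assume c: "c > 0"
  show "f1 c > 0" "unique_positive_solution c (hsol c)" "real_analytic_on (hsol c) {0..c}"
    "((\<lambda>c. bvp_functional c (hsol c)) has_real_derivative - f1 c) (at c)"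
    using c by (rule f1_pos unique_positive_solution_hsol real_analytic_on_hsol bvp_functional_has_derivative)+
next
  fix \<beta> :: "nat \<Rightarrow> real" assume nonneg: "\<forall>N\<ge>1. \<beta> N \<ge> 0"
  {
    assume "(\<lambda>N. 1 / real N) \<in> o(\<beta>) \<and> \<beta> \<in> o(\<lambda>_. 1)"
    then show "\<exists>e\<^sub>1 e\<^sub>2 :: nat \<Rightarrow> real. e\<^sub>1 \<in> O(\<lambda>N. \<beta> N powr (1 / 2)) \<and> e\<^sub>2 \<in> O(\<lambda>N. (\<beta> N * real N) powr (- 1 / 2)) \<and>
      (\<forall>\<^sub>F N in at_top. mean_displacement N (\<beta> N) = 1 / \<beta> N * (1 + e\<^sub>1 N + e\<^sub>2 N))"
      using nonneg by (intro regime_small_beta) auto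
  next
    fix c :: real assume "c > 0" "\<beta> \<sim>[at_top] (\<lambda>N. c / real N)"
    then show "\<exists>e :: nat \<Rightarrow> real. e \<in> o(\<lambda>_. 1) \<and>
      (\<forall>\<^sub>F N in at_top. mean_displacement N (\<beta> N) = real N * f1 c * (1 + e N))"
      using f1_pos[of c] by (intro relative_error_of_tendsto regime_critical) auto
  next
    assume "\<beta> \<in> o(\<lambda>N. 1 / real N)"
    then show "\<exists>e :: nat \<Rightarrow> real. e \<in> o(\<lambda>_. 1) \<and>
      (\<forall>\<^sub>F N in at_top. mean_displacement N (\<beta> N) = real N / 3 * (1 + e N))"
      using relative_error_of_tendsto[OF regime_high_temperature, of \<beta>] nonneg by simp
  }
qed

end
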